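(* Let $\mathcal{F}$ be a reduced convex foliation of degree $d\geq2$ on $\mathbb{P}^2_{\mathbb{C}}$. Then (a) $\emptyset\neq\mathcal{CS}(\mathcal{F})\subset\mathcal{HCS}_d$; (b) for all $\lambda\in\mathcal{CS}(\mathcal{F})$, $\frac1\lambda\in\mathcal{CS}(\mathcal{F})$.
   Context: Foliations on $\mathbb{P}^2_{\mathbb{C}}$ are holomorphic, with isolated singularities. The degree of a foliation is the number of tangencies (with multiplicity) with a generic line. Convexity: a foliation on $\mathbb{P}^2_{\mathbb{C}}$ is convex if its leaves other than straight lines have no inflection points. A foliation of degree $d\ge1$ has at most $3d$ distinct invariant lines, and if this bound is reached it is convex; a foliation of degree $d$ having exactly $3d$ distinct invariant lines is called reduced convex. Homogeneous foliations: a foliation $\mathcal{H}$ of degree $d$ is homogeneous if, for a suitable choice of affine coordinates $(x,y)$, it is given by $A(x,y)\,\mathrm{d}x+B(x,y)\,\mathrm{d}y$ with $A,B$ homogeneous polynomials of degree $d$ and $\gcd(A,B)=1$; $\ell_\infty$ denotes the line at infinity of this affine chart (it is invariant by $\mathcal{H}$). Singularities: a singular point $s$ is non-degenerate if the linear part at $s$ of a local vector field (with isolated zero) defining the foliation is invertible. If $\ell$ is an invariant line and $s\in\ell$ a singular point, choose local coordinates $(u,v)$ centered at $s$ with $\ell=\{v=0\}$ and a local vector field $P(u,v)\partial_u+vQ(u,v)\partial_v$ with isolated zero defining $\mathcal{F}$; the Camacho–Sad index is $\mathrm{CS}(\mathcal{F},\ell,s)=\mathrm{Res}_{u=0}\frac{Q(u,0)}{P(u,0)}\,\mathrm{d}u$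 (for $s$ non-degenerate it is the ratio of the eigenvalue transverse to $\ell$ by the eigenvalue tangent to $\ell$). The sets: $\mathcal{CS}(\mathcal{F})$ is the set of $\lambda\in\mathbb{C}\setminus\{0,1\}$ for which there is a line $\ell$ invariant by $\mathcal{F}$ and a non-degenerate singular point $s\in\ell$ of $\mathcal{F}$ such that $\mathrm{CS}(\mathcal{F},\ell,s)=\lambda$. $\mathcal{HCS}_d$ is the set of $\lambda\in\mathbb{C}\setminus\{0,1\}$ for which there exist two homogeneous convex foliations $\mathcal{H}$ and $\mathcal{H}'$ of degree $d$ on $\mathbb{P}^2_{\mathbb{C}}$ having respective singular points $s$ and $s'$ on the line at infinity $\ell_\infty$ such that $\mathrm{CS}(\mathcal{H},\ell_\infty,s)=\lambda$ and $\mathrm{CS}(\mathcal{H}',\ell_\infty,s')=\frac1\lambda$. *)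

theory Defs
  imports "HOL-Complex_Analysis.Complex_Analysis"
begin

text \<open>
  The complex projective plane is the set of one-dimensional subspaces of \<open>complex^3\<close>;
  projective lines are the two-dimensional subspaces, and incidence is inclusion.
\<close>

definition proj_points :: "(complex^3) set set" where
  "proj_points = {s. vec.subspace s \<and> vec.dim s = 1}"

definition proj_lines :: "(complex^3) set set" where
  "proj_lines = {l. vec.subspace l \<and> vec.dim l = 2}"


text \<open>
  Polynomials are represented by the functions they induce, which is harmless over the
  infinite field of complex numbers. The exponent of the variable \<open>x $ i\<close> in the monomial
  with multi-index \<open>\<alpha>\<close> is \<open>\<alpha> i\<close>.
\<close>

definition monomial_fun :: "('n::finite \<Rightarrow> nat) \<Rightarrow> complex^'n \<Rightarrow> complex" where
  "monomial_fun \<alpha> x = (\<Prod>i\<in>UNIV. x $ i ^ \<alpha> i)"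

definition polynomial_fun :: "(complex^'n::finite \<Rightarrow> complex) \<Rightarrow> bool" where
  "polynomial_fun f \<longleftrightarrow>
     (\<exists>N c. \<forall>x. f x = (\<Sum>\<alpha> | sum \<alpha> UNIV \<le> N. c \<alpha> * monomial_fun \<alpha> x))"

definition homogeneous_fun :: "nat \<Rightarrow> (complex^'n::finite \<Rightarrow> complex) \<Rightarrow> bool" where
  "homogeneous_fun n f \<longleftrightarrow>
     (\<exists>c. \<forall>x. f x = (\<Sum>\<alpha> | sum \<alpha> UNIV = n. c \<alpha> * monomial_fun \<alpha> x))"

definition poly_divides ::
  "(complex^'n::finite \<Rightarrow> complex) \<Rightarrow> (complex^'n \<Rightarrow> complex) \<Rightarrow> bool" where
  "poly_divides g f \<longleftrightarrow> (\<exists>h. polynomial_fun h \<and> (\<forall>x. f x = g x * h x))"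

definition poly_coprime ::
  "(complex^'n::finite \<Rightarrow> complex) \<Rightarrow> (complex^'n \<Rightarrow> complex) \<Rightarrow> bool" where
  "poly_coprime f g \<longleftrightarrow>
     (\<forall>h. polynomial_fun h \<and> poly_divides h f \<and> poly_divides h g \<longrightarrow>
        (\<exists>c. c \<noteq> 0 \<and> (\<forall>x. h x = c)))"


text \<open>
  A foliation is given by a 1-form on \<open>complex^3\<close> with homogeneous polynomial coefficients of
  the same degree, annihilated by the radial vector field and vanishing at only finitely
  many points of the plane (isolated singularities, by compactness). The form is unique up to
  a nonzero constant factor, which affects none of the notions below. The vector
  \<open>\<omega> x\<close> lists the coefficients of the form at \<open>x\<close>.
\<close>

type_synonym one_form = "complex^3 \<Rightarrow> complex^3"

definition form_app :: "one_form \<Rightarrow> complex^3 \<Rightarrow> complex^3 \<Rightarrow> complex" where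
  "form_app \<omega> x v = (\<Sum>i\<in>UNIV. \<omega> x $ i * v $ i)"

definition singular_point :: "one_form \<Rightarrow> (complex^3) set \<Rightarrow> bool" where
  "singular_point \<omega> s \<longleftrightarrow> s \<in> proj_points \<and> (\<forall>x\<in>s. \<omega> x = 0)"

definition foliation :: "one_form \<Rightarrow> bool" where
  "foliation \<omega> \<longleftrightarrow>
     (\<exists>m. \<forall>i. homogeneous_fun m (\<lambda>x. \<omega> x $ i)) \<and>
     (\<forall>x. form_app \<omega> x x = 0) \<and>
     finite {s. singular_point \<omega> s}"

definition invariant_line :: "one_form \<Rightarrow> (complex^3) set \<Rightarrow> bool" where
  "invariant_line \<omega> l \<longleftrightarrow> l \<in> proj_lines \<and> (\<forall>x\<in>l. \<forall>v\<in>l. form_app \<omega> x v = 0)"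


text \<open>
  The multiplicity of tangency with a line \<open>l\<close> at a point \<open>s\<close> of \<open>l\<close> is the order of vanishing at
  \<open>t = 0\<close> of the restriction of the form to \<open>l\<close>, in an affine parameter \<open>t \<mapsto> p + t q\<close> of \<open>l\<close>
  centered at \<open>s\<close>. It is meaningful for lines that are not invariant.
\<close>

definition tangency_order :: "one_form \<Rightarrow> (complex^3) set \<Rightarrow> (complex^3) set \<Rightarrow> int" where
  "tangency_order \<omega> l s =
     (let (p, q) = (SOME (p, q). p \<in> s \<and> p \<noteq> 0 \<and> q \<in> l \<and> q \<notin> s)
      in zorder (\<lambda>t. form_app \<omega> (p + t *s q) q) 0)"

definition number_of_tangencies :: "one_form \<Rightarrow> (complex^3) set \<Rightarrow> int" where
  "number_of_tangencies \<omega> l =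
     (\<Sum>s | s \<in> proj_points \<and> s \<subseteq> l \<and> tangency_order \<omega> l s \<noteq> 0. tangency_order \<omega> l s)"

text \<open>
  A generic line is one whose equation \<open>a\<close> avoids the zero set of a suitable nonzero
  polynomial \<open>g\<close>.
\<close>

definition foliation_degree :: "one_form \<Rightarrow> nat \<Rightarrow> bool" where
  "foliation_degree \<omega> d \<longleftrightarrow>
     (\<exists>g::complex^3 \<Rightarrow> complex. polynomial_fun g \<and> (\<exists>a. g a \<noteq> 0) \<and>
        (\<forall>a. a \<noteq> 0 \<and> g a \<noteq> 0 \<longrightarrow>
           number_of_tangencies \<omega> {x. (\<Sum>i\<in>UNIV. a $ i * x $ i) = 0} = int d))"

definition reduced_convex :: "nat \<Rightarrow> one_form \<Rightarrow> bool" where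
  "reduced_convex d \<omega> \<longleftrightarrow>
     foliation \<omega> \<and> foliation_degree \<omega> d \<and> card {l. invariant_line \<omega> l} = 3 * d"


text \<open>
  Pieces of leaves are parametrized by lifts \<open>\<gamma>\<close> to \<open>complex^3\<close> of immersed holomorphic curves in
  the plane; \<open>\<gamma>\<close> projects to an immersion when \<open>\<gamma> t\<close> and \<open>\<gamma>' t\<close> are linearly independent, and
  the projected curve has an inflection point at \<open>t\<close> when moreover \<open>\<gamma>'' t\<close> lies in their span, the
  tangent line. Leaves arise by concatenating such pieces.
\<close>

definition curve_deriv :: "(complex \<Rightarrow> complex^3) \<Rightarrow> complex \<Rightarrow> complex^3" where
  "curve_deriv \<gamma> t = (\<chi> i. deriv (\<lambda>z. \<gamma> z $ i) t)"

definition integral_curve :: "one_form \<Rightarrow> complex set \<Rightarrow> (complex \<Rightarrow> complex^3) \<Rightarrow> bool" where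
  "integral_curve \<omega> D \<gamma> \<longleftrightarrow>
     open D \<and> connected D \<and> (\<forall>i. (\<lambda>z. \<gamma> z $ i) holomorphic_on D) \<and>
     (\<forall>t\<in>D. \<gamma> t \<noteq> 0 \<and> curve_deriv \<gamma> t \<notin> vec.span {\<gamma> t} \<and>
            \<omega> (\<gamma> t) \<noteq> 0 \<and> form_app \<omega> (\<gamma> t) (curve_deriv \<gamma> t) = 0)"

definition joined :: "one_form \<Rightarrow> (complex^3) set \<Rightarrow> (complex^3) set \<Rightarrow> bool" where
  "joined \<omega> m m' \<longleftrightarrow>
     (\<exists>D \<gamma>. integral_curve \<omega> D \<gamma> \<and>
        (\<exists>t\<in>D. \<exists>t'\<in>D. m = vec.span {\<gamma> t} \<and> m' = vec.span {\<gamma> t'}))"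

definition leaf :: "one_form \<Rightarrow> (complex^3) set \<Rightarrow> (complex^3) set set" where
  "leaf \<omega> m = {m'. (joined \<omega>)\<^sup>*\<^sup>* m m'}"

definition straight_leaf :: "one_form \<Rightarrow> (complex^3) set \<Rightarrow> bool" where
  "straight_leaf \<omega> m \<longleftrightarrow> (\<exists>l\<in>proj_lines. \<forall>m'\<in>leaf \<omega> m. m' \<subseteq> l)"

definition inflection_point :: "one_form \<Rightarrow> (complex^3) set \<Rightarrow> bool" where
  "inflection_point \<omega> m \<longleftrightarrow>
     (\<exists>D \<gamma>. integral_curve \<omega> D \<gamma> \<and>
        (\<exists>t\<in>D. m = vec.span {\<gamma> t} \<and>
           curve_deriv (curve_deriv \<gamma>) t \<in> vec.span {\<gamma> t, curve_deriv \<gamma> t}))"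

definition convex_foliation :: "one_form \<Rightarrow> bool" where
  "convex_foliation \<omega> \<longleftrightarrow>
     (\<forall>m\<in>proj_points. \<not> singular_point \<omega> m \<and> \<not> straight_leaf \<omega> m \<longrightarrow>
        \<not> inflection_point \<omega> m)"


text \<open>
  A basis \<open>p, q, r\<close> gives affine coordinates \<open>(u, v) \<mapsto> [p + u q + v r]\<close> centered at \<open>[p]\<close>. There
  the form reads \<open>\<alpha> du + \<beta> dv\<close> with \<open>\<alpha>\<close> and \<open>\<beta>\<close> its values on \<open>q\<close> and \<open>r\<close>, and the
  foliation is defined by the vector field with isolated zeros \<open>\<beta> \<partial>u - \<alpha> \<partial>v\<close>.
\<close>

definition chart_field ::
  "one_form \<Rightarrow> complex^3 \<Rightarrow> complex^3 \<Rightarrow> complex^3 \<Rightarrow> complex \<times> complex \<Rightarrow> complex \<times> complex" where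
  "chart_field \<omega> p q r =
     (\<lambda>(u, v). let x = p + u *s q + v *s r in (form_app \<omega> x r, - form_app \<omega> x q))"

definition nondegenerate :: "one_form \<Rightarrow> (complex^3) set \<Rightarrow> bool" where
  "nondegenerate \<omega> s \<longleftrightarrow> singular_point \<omega> s \<and>
     (\<exists>p q r. p \<in> s \<and> vec.span {p, q, r} = UNIV \<and>
        (\<exists>L. (chart_field \<omega> p q r has_derivative L) (at 0) \<and> bij L))"

text \<open>
  With \<open>p\<close> spanning \<open>s\<close>, \<open>q\<close> in \<open>l\<close> and \<open>r\<close> outside \<open>l\<close>, the line \<open>l\<close> is \<open>v = 0\<close>. If it is
  invariant, the field is \<open>P \<partial>u + v Q \<partial>v\<close>, so that \<open>Q(u, 0)\<close> is the derivative
  in \<open>v\<close> of its second component at \<open>v = 0\<close>.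
\<close>

definition camacho_sad :: "one_form \<Rightarrow> (complex^3) set \<Rightarrow> (complex^3) set \<Rightarrow> complex" where
  "camacho_sad \<omega> l s =
     (let (p, q, r) =
        (SOME (p, q, r). p \<in> s \<and> p \<noteq> 0 \<and> q \<in> l \<and> q \<notin> s \<and> r \<notin> l);
        X = chart_field \<omega> p q r
      in residue (\<lambda>u. deriv (\<lambda>v. snd (X (u, v))) 0 / fst (X (u, 0))) 0)"

definition CS_set :: "one_form \<Rightarrow> complex set" where
  "CS_set \<omega> = {\<mu>. \<mu> \<noteq> 0 \<and> \<mu> \<noteq> 1 \<and>
     (\<exists>l s. invariant_line \<omega> l \<and> s \<subseteq> l \<and> nondegenerate \<omega> s \<and> camacho_sad \<omega> l s = \<mu>)}"


text \<open>
  The affine coordinates \<open>(x, y)\<close> are those of the chart \<open>(x, y) \<mapsto> [x e1 + y e2 + e3]\<close>, whose line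
  at infinity \<open>l\<close> is spanned by \<open>e1\<close> and \<open>e2\<close>. A constant factor between the pulled back form and
  \<open>A dx + B dy\<close> is absorbed in \<open>A\<close> and \<open>B\<close>.
\<close>

definition homogeneous_foliation :: "nat \<Rightarrow> (complex^3) set \<Rightarrow> one_form \<Rightarrow> bool" where
  "homogeneous_foliation d l \<omega> \<longleftrightarrow>
     foliation \<omega> \<and> foliation_degree \<omega> d \<and>
     (\<exists>e1 e2 e3. vec.span {e1, e2, e3} = UNIV \<and> l = vec.span {e1, e2} \<and>
        (\<exists>A B :: complex^2 \<Rightarrow> complex.
           homogeneous_fun d A \<and> homogeneous_fun d B \<and> poly_coprime A B \<and>
           (\<forall>x y. form_app \<omega> (x *s e1 + y *s e2 + e3) e1 = A (vector [x, y]) \<and>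
                  form_app \<omega> (x *s e1 + y *s e2 + e3) e2 = B (vector [x, y]))))"

definition HCS :: "nat \<Rightarrow> complex set" where
  "HCS d = {\<mu>. \<mu> \<noteq> 0 \<and> \<mu> \<noteq> 1 \<and>
     (\<exists>\<eta> l s \<eta>' l' s'.
        homogeneous_foliation d l \<eta> \<and> convex_foliation \<eta> \<and>
        homogeneous_foliation d l' \<eta>' \<and> convex_foliation \<eta>' \<and>
        singular_point \<eta> s \<and> s \<subseteq> l \<and> camacho_sad \<eta> l s = \<mu> \<and>
        singular_point \<eta>' s' \<and> s' \<subseteq> l' \<and> camacho_sad \<eta>' l' s' = 1 / \<mu>)}"

end

theory Submission
  imports Defs "HOL-Computational_Algebra.Fundamental_Theorem_Algebra"
begin

unbundle no Formal_Power_Series.fps_syntax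

text \<open>
  Write the form as \<open>\<omega> x = x \<times> Z x\<close> with a homogeneous vector field \<open>Z\<close> of degree \<open>d\<close>. The polynomial
  \<open>E x = det (x, Z x, DZ x (Z x))\<close> of degree \<open>3d\<close> vanishes on invariant lines, and it is not
  identically zero since otherwise the tangent line at every nonsingular point would be
  invariant; so \<open>E\<close> is a constant times the product of the \<open>3d\<close> invariant lines.

  At a singular point \<open>p\<close>, choose \<open>Z\<close> with \<open>Z p = 0\<close> and divide the relation between the four vectors
  \<open>p\<close>, \<open>x\<close>, \<open>Z x\<close>, \<open>DZ x (Z x)\<close> by the product of the lines through \<open>p\<close>. The first-order part at \<open>p\<close> of
  the quotient shows that \<open>DZ p\<close> is invertible modulo \<open>p\<close>, i.e. \<open>p\<close> is non-degenerate. Since \<open>E\<close> vanishes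
  to second order at \<open>p\<close>, at least two invariant lines pass through \<open>p\<close>, and the Camacho-Sad indices
  along them are inverse to each other. The \<open>d + 1\<close> indices along a line sum to 1, so they
  are not all equal to 1.

  In an affine chart with \<open>l\<close> at infinity, the part of top degree of the form defines a homogeneous
  foliation with the same indices along \<open>l\<close>. Its inflection polynomial is the restriction of \<open>E / l\<close>
  to \<open>l\<close>, which vanishes only at points of other invariant lines, hence at singular points;
  therefore the inflection points of the homogeneous foliation lie on its invariant lines.
\<close>

subsection \<open>Homogeneous polynomial functions\<close>

text \<open>The relation can be divided because on an invariant line through \<open>p\<close> the
  vectors \<open>p\<close>, \<open>x\<close>, \<open>Z x\<close> and \<open>DZ x (Z x)\<close> lie
  in one plane, so each of its four coefficients vanishes there. The count \<open>3d\<close> is used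
  at full strength: \<open>E\<close> is a product of pairwise distinct lines, so once those through
  \<open>p\<close> are divided out, the coefficient of \<open>p\<close> no longer vanishes at
  \<open>p\<close>. A repeated line would destroy this. The choice \<open>Z p = 0\<close> is free,
  since \<open>Z\<close> matters only modulo the radial field. Two invariant lines through a
  non-degenerate \<open>p\<close> make the linear part diagonal in their directions, and the two
  indices are the quotients of the eigenvalues in opposite orders. Polynomials are treated as
  functions. Two facts stand in for factorization theory: a homogeneous polynomial vanishing on the
  kernel of a linear form is divisible by that form, and a nonzero factor can be cancelled from an
  identity, which is seen by restricting to affine lines.\<close>

text \<open>Zero has every degree, so sums that cancel stay homogeneous without a case distinction.
  The inductive form provides the structural induction behind scaling, substitution, division by
  linear forms and gradients.\<close>

inductive hpoly :: "nat \<Rightarrow> (complex^'n::finite \<Rightarrow> complex) \<Rightarrow> bool" where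
  hpoly_zero: "hpoly n (\<lambda>x. 0)"
| hpoly_const: "hpoly 0 (\<lambda>x. c)"
| hpoly_coord: "hpoly 1 (\<lambda>x. x $ i)"
| hpoly_add: "hpoly n f \<Longrightarrow> hpoly n g \<Longrightarrow> hpoly n (\<lambda>x. f x + g x)"
| hpoly_mult: "hpoly m f \<Longrightarrow> hpoly n g \<Longrightarrow> hpoly (m + n) (\<lambda>x. f x * g x)"

lemma hpoly_cmult: "hpoly n f \<Longrightarrow> hpoly n (\<lambda>x. c * f x)"
  using hpoly_mult[OF hpoly_const, of n f c] by simp

lemma hpoly_uminus: "hpoly n f \<Longrightarrow> hpoly n (\<lambda>x. - f x)"
  using hpoly_cmult[of n f "-1"] by simp

lemma hpoly_diff: "hpoly n f \<Longrightarrow> hpoly n g \<Longrightarrow> hpoly n (\<lambda>x. f x - g x)"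
  using hpoly_add[OF _ hpoly_uminus, of n f g] by simp

lemma hpoly_sum: "(\<And>i. i \<in> S \<Longrightarrow> hpoly n (f i)) \<Longrightarrow> hpoly n (\<lambda>x. \<Sum>i\<in>S. f i x)"
  by (induction S rule: infinite_finite_induct) (auto intro: hpoly_zero hpoly_add)

lemma hpoly_prod: "finite S \<Longrightarrow> (\<And>i. i \<in> S \<Longrightarrow> hpoly (d i) (f i)) \<Longrightarrow> hpoly (\<Sum>i\<in>S. d i) (\<lambda>x. \<Prod>i\<in>S. f i x)"
  by (induction S rule: finite_induct) (auto intro: hpoly_const hpoly_mult)

lemma hpoly_power: "hpoly n f \<Longrightarrow> hpoly (k * n) (\<lambda>x. f x ^ k)"
  by (induction k) (auto intro: hpoly_const hpoly_mult)

lemma hpoly_mult': "hpoly m f \<Longrightarrow> hpoly n g \<Longrightarrow> k = m + n \<Longrightarrow> hpoly k (\<lambda>x. f x * g x)"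
  using hpoly_mult by auto

lemma hpoly_linear: "hpoly 1 (\<lambda>x. \<Sum>i\<in>UNIV. a $ i * x $ i)"
  by (intro hpoly_sum hpoly_cmult hpoly_coord)

lemma hpoly_scale: "hpoly n f \<Longrightarrow> f (c *s x) = c ^ n * f x"
  by (induction n f rule: hpoly.induct) (auto simp: algebra_simps power_add)

lemma hpoly_subst:
  assumes "hpoly n f" "\<And>i. hpoly 1 (\<lambda>x. \<phi> x $ i)"
  shows "hpoly n (\<lambda>x. f (\<phi> x))"
  using assms(1)
  by (induction n f rule: hpoly.induct) (auto intro: hpoly.intros assms(2)[unfolded One_nat_def])

lemma hpoly_degree_0:
  assumes "hpoly n f" "n = 0" shows "f x = f y"
  using assms by (induction n f rule: hpoly.induct) auto

text \<open>A property shared by homogeneous and inhomogeneous polynomials that is just strong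
  enough for the one thing wanted of it: a product of two nonzero functions of this kind is
  nonzero.\<close>

definition linepoly :: "(complex^'n::finite \<Rightarrow> complex) \<Rightarrow> bool" where
  "linepoly f \<longleftrightarrow> (\<forall>x w. \<exists>P. \<forall>t. f (x + t *s w) = poly P t)"

lemma linepoly_const: "linepoly (\<lambda>x. c)"
  unfolding linepoly_def by (intro allI exI[of _ "[:c:]"]) simp

lemma linepoly_coord: "linepoly (\<lambda>x. x $ i)"
  unfolding linepoly_def
proof (intro allI)
  fix x w :: "complex^'a"
  show "\<exists>P. \<forall>t. (x + t *s w) $ i = poly P t"
    by (intro exI[of _ "[:x $ i, w $ i:]"]) simp
qed

lemma linepoly_add: "linepoly f \<Longrightarrow> linepoly g \<Longrightarrow> linepoly (\<lambda>x. f x + g x)"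
  unfolding linepoly_def by (metis poly_add)

lemma linepoly_diff: "linepoly f \<Longrightarrow> linepoly g \<Longrightarrow> linepoly (\<lambda>x. f x - g x)"
  unfolding linepoly_def by (metis poly_diff)

lemma linepoly_mult: "linepoly f \<Longrightarrow> linepoly g \<Longrightarrow> linepoly (\<lambda>x. f x * g x)"
  unfolding linepoly_def by (metis poly_mult)

lemma linepoly_sum: "(\<And>i. i \<in> S \<Longrightarrow> linepoly (f i)) \<Longrightarrow> linepoly (\<lambda>x. \<Sum>i\<in>S. f i x)"
  by (induction S rule: infinite_finite_induct) (auto intro: linepoly_const linepoly_add)

lemma linepoly_prod: "(\<And>i. i \<in> S \<Longrightarrow> linepoly (f i)) \<Longrightarrow> linepoly (\<lambda>x. \<Prod>i\<in>S. f i x)"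
  by (induction S rule: infinite_finite_induct) (auto intro: linepoly_const linepoly_mult)

lemma linepoly_power: "linepoly f \<Longrightarrow> linepoly (\<lambda>x. f x ^ k)"
  by (induction k) (auto intro: linepoly_const linepoly_mult)

lemma linepoly_hpoly: "hpoly n f \<Longrightarrow> linepoly f"
  by (induction n f rule: hpoly.induct)
     (auto intro: linepoly_const linepoly_coord linepoly_add linepoly_mult)

lemma linepoly_monomial: "linepoly (monomial_fun \<alpha>)"
  unfolding monomial_fun_def by (intro linepoly_prod linepoly_power linepoly_coord)

lemma linepoly_polynomial_fun: "polynomial_fun f \<Longrightarrow> linepoly f"
proof -
  assume "polynomial_fun f"
  then obtain N c where "f = (\<lambda>x. \<Sum>\<alpha> | sum \<alpha> UNIV \<le> N. c \<alpha> * monomial_fun \<alpha> x)"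
    unfolding polynomial_fun_def by auto
  then show ?thesis
    by (auto intro!: linepoly_sum linepoly_mult linepoly_const linepoly_monomial)
qed

text \<open>On the line joining \<open>x\<close> and \<open>y\<close> both restrictions are nonzero
  polynomials in one variable, so their product has finitely many roots. The set \<open>S\<close>
  allows the same argument inside a projective line, which is a plane of
  \<open>complex^3\<close>.\<close>

lemma linepoly_common_nonzero:
  assumes f: "linepoly f" and g: "linepoly g"
    and S: "\<And>x y t. x \<in> S \<Longrightarrow> y \<in> S \<Longrightarrow> x + t *s (y - x) \<in> S"
    and xy: "x \<in> S" "f x \<noteq> 0" "y \<in> S" "g y \<noteq> 0"
  obtains z where "z \<in> S" "f z \<noteq> 0" "g z \<noteq> 0"
proof -
  obtain P where P: "f (x + t *s (y - x)) = poly P t" for t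
    using f unfolding linepoly_def by metis
  obtain Q where Q: "g (x + t *s (y - x)) = poly Q t" for t
    using g unfolding linepoly_def by metis
  have "P \<noteq> 0" using P[of 0] xy by auto
  moreover have "Q \<noteq> 0" using Q[of 1] xy by auto
  ultimately have "finite {t. poly (P * Q) t = 0}"
    using poly_roots_finite no_zero_divisors by blast
  then obtain t where "poly (P * Q) t \<noteq> 0"
    by (metis (mono_tags, lifting) Collect_cong UNIV_def infinite_UNIV_char_0 mem_Collect_eq top.extremum_uniqueI subsetI)
  then show thesis
    using P Q S[OF xy(1,3), of t] that by auto
qed

lemma linepoly_prod_nonzero:
  assumes "finite I" "\<And>i. i \<in> I \<Longrightarrow> linepoly (f i)" "\<And>i. i \<in> I \<Longrightarrow> \<exists>x\<in>S. f i x \<noteq> 0" "S \<noteq> {}"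
    and S: "\<And>x y t. x \<in> S \<Longrightarrow> y \<in> S \<Longrightarrow> x + t *s (y - x) \<in> S"
  shows "\<exists>z\<in>S. (\<Prod>i\<in>I. f i z) \<noteq> 0"
  using assms(1-4)
proof (induction I rule: finite_induct)
  case empty
  then show ?case by auto
next
  case (insert i I)
  then obtain z where z: "z \<in> S" "(\<Prod>i\<in>I. f i z) \<noteq> 0" by auto
  obtain x where x: "x \<in> S" "f i x \<noteq> 0" using insert.prems(2)[of i] by auto
  obtain y where "y \<in> S" "f i y \<noteq> 0" "(\<Prod>i\<in>I. f i y) \<noteq> 0"
    using linepoly_common_nonzero[OF insert.prems(1)[of i] linepoly_prod[of I f] S x z] insert.prems(1)
    by blast
  then show ?case using insert by auto
qed

lemma linepoly_cancel:
  assumes "linepoly f" "linepoly g" "\<And>x. f x * g x = 0" "f z \<noteq> 0"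
  shows "g x = 0"
proof (rule ccontr)
  assume "g x \<noteq> 0"
  then obtain y where "f y \<noteq> 0" "g y \<noteq> 0"
    using linepoly_common_nonzero[OF assms(1,2), of UNIV z x] assms(4) by auto
  then show False using assms(3)[of y] by auto
qed

subsection \<open>Agreement with the polynomials of the definitions\<close>

lemma finite_bounded_exponents: "finite {\<alpha>::'n::finite \<Rightarrow> nat. sum \<alpha> UNIV \<le> N}"
proof (rule finite_subset)
  show "{\<alpha>::'n \<Rightarrow> nat. sum \<alpha> UNIV \<le> N} \<subseteq> UNIV \<rightarrow>\<^sub>E {..N}"
  proof safe
    fix \<alpha> :: "'n \<Rightarrow> nat" and i assume "sum \<alpha> UNIV \<le> N"
    then show "\<alpha> i \<le> N" using member_le_sum[of i UNIV \<alpha>] by auto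
  qed auto
qed (auto intro: finite_PiE)

lemma finite_exponents: "finite {\<alpha>::'n::finite \<Rightarrow> nat. sum \<alpha> UNIV = n}"
  by (rule finite_subset[OF _ finite_bounded_exponents[of n]]) auto

lemma monomial_fun_hpoly: "hpoly (sum \<alpha> UNIV) (monomial_fun \<alpha>)"
proof -
  have "hpoly (\<alpha> i) (\<lambda>x::complex^'a. x $ i ^ \<alpha> i)" for i
    using hpoly_power[OF hpoly_coord, of "\<alpha> i" i] by simp
  then show ?thesis
    unfolding monomial_fun_def using hpoly_prod[of UNIV \<alpha> "\<lambda>i x. x $ i ^ \<alpha> i"] by auto
qed

lemma homogeneous_fun_imp_hpoly: "homogeneous_fun n f \<Longrightarrow> hpoly n f"
proof -
  assume "homogeneous_fun n f"
  then obtain c where "f = (\<lambda>x. \<Sum>\<alpha> | sum \<alpha> UNIV = n. c \<alpha> * monomial_fun \<alpha> x)"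
    unfolding homogeneous_fun_def by auto
  then show ?thesis
    using monomial_fun_hpoly by (auto intro!: hpoly_sum hpoly_cmult)
qed

lemma monomial_fun_add: "monomial_fun (\<lambda>i. \<alpha> i + \<beta> i) x = monomial_fun \<alpha> x * monomial_fun \<beta> x"
  by (simp add: monomial_fun_def power_add prod.distrib)

lemma homogeneous_fun_mult:
  assumes "homogeneous_fun m f" "homogeneous_fun n g"
  shows "homogeneous_fun (m + n) (\<lambda>x::complex^'n::finite. f x * g x)"
proof -
  obtain a b where a: "f x = (\<Sum>\<alpha> | sum \<alpha> UNIV = m. a \<alpha> * monomial_fun \<alpha> x)"
    and b: "g x = (\<Sum>\<alpha> | sum \<alpha> UNIV = n. b \<alpha> * monomial_fun \<alpha> x)" for x
    using assms unfolding homogeneous_fun_def by blast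
  let ?A = "\<lambda>n. {\<alpha>::'n \<Rightarrow> nat. sum \<alpha> UNIV = n}"
  let ?P = "\<lambda>p::('n \<Rightarrow> nat) \<times> ('n \<Rightarrow> nat). \<lambda>i. fst p i + snd p i"
  define c where "c \<gamma> = (\<Sum>p | p \<in> ?A m \<times> ?A n \<and> ?P p = \<gamma>. a (fst p) * b (snd p))" for \<gamma>
  have "f x * g x = (\<Sum>\<gamma> | sum \<gamma> UNIV = m + n. c \<gamma> * monomial_fun \<gamma> x)" for x
  proof -
    have "f x * g x = (\<Sum>p\<in>?A m \<times> ?A n. a (fst p) * b (snd p) * monomial_fun (?P p) x)"
      unfolding a b sum_product sum.cartesian_product
      by (intro sum.cong) (auto simp: monomial_fun_add algebra_simps)
    also have "\<dots> = (\<Sum>\<gamma>\<in>?A (m + n). \<Sum>p | p \<in> ?A m \<times> ?A n \<and> ?P p = \<gamma>.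
        a (fst p) * b (snd p) * monomial_fun (?P p) x)"
      by (rule sum.group[symmetric]) (auto simp: finite_exponents sum.distrib)
    also have "\<dots> = (\<Sum>\<gamma>\<in>?A (m + n). c \<gamma> * monomial_fun \<gamma> x)"
      unfolding c_def sum_distrib_right by (intro sum.cong) auto
    finally show ?thesis .
  qed
  then show ?thesis unfolding homogeneous_fun_def by blast
qed

lemma homogeneous_fun_monomial: "homogeneous_fun (sum \<alpha> UNIV) (monomial_fun \<alpha> :: complex^'n::finite \<Rightarrow> complex)"
proof -
  have "monomial_fun \<alpha> x = (\<Sum>\<beta> | sum \<beta> UNIV = sum \<alpha> UNIV. (if \<beta> = \<alpha> then 1 else 0) * monomial_fun \<beta> x)"
    for x :: "complex^'n"
    by (subst sum.remove[OF finite_exponents, of \<alpha>]) (auto intro!: sum.neutral)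
  then show ?thesis unfolding homogeneous_fun_def
    by (intro exI[of _ "\<lambda>\<beta>. if \<beta> = \<alpha> then 1 else 0"] allI)
qed

lemma hpoly_imp_homogeneous_fun: "hpoly n f \<Longrightarrow> homogeneous_fun n f"
proof (induction n f rule: hpoly.induct)
  case (hpoly_zero n)
  show ?case unfolding homogeneous_fun_def by (rule exI[of _ "\<lambda>_. 0"]) simp
next
  case (hpoly_const c)
  have "{\<alpha>::'a \<Rightarrow> nat. sum \<alpha> UNIV = 0} = {\<lambda>_. 0}" by auto
  then show ?case unfolding homogeneous_fun_def
    by (intro exI[of _ "\<lambda>_. c"]) (auto simp: monomial_fun_def)
next
  case (hpoly_coord i)
  have "(\<lambda>x::complex^'a. x $ i) = monomial_fun (\<lambda>j. if j = i then 1 else 0)"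
    by (rule ext) (simp add: monomial_fun_def if_distrib[of "\<lambda>k. _ ^ k"] prod.delta cong: if_cong)
  then show ?case using homogeneous_fun_monomial[of "\<lambda>j. if j = i then 1 else 0"] by simp
next
  case (hpoly_add n f g)
  then obtain a b where "\<forall>x. f x = (\<Sum>\<alpha> | sum \<alpha> UNIV = n. a \<alpha> * monomial_fun \<alpha> x)"
    "\<forall>x. g x = (\<Sum>\<alpha> | sum \<alpha> UNIV = n. b \<alpha> * monomial_fun \<alpha> x)"
    unfolding homogeneous_fun_def by blast
  then show ?case unfolding homogeneous_fun_def
    by (intro exI[of _ "\<lambda>\<alpha>. a \<alpha> + b \<alpha>"]) (simp add: sum.distrib algebra_simps)
next
  case (hpoly_mult m f n g)
  then show ?case using homogeneous_fun_mult by blast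
qed

lemma homogeneous_fun_iff_hpoly: "homogeneous_fun n f \<longleftrightarrow> hpoly n f"
  using homogeneous_fun_imp_hpoly hpoly_imp_homogeneous_fun by blast

lemma hpoly_imp_polynomial_fun: "hpoly n f \<Longrightarrow> polynomial_fun f"
proof -
  assume "hpoly n f"
  then obtain c where c: "f x = (\<Sum>\<alpha> | sum \<alpha> UNIV = n. c \<alpha> * monomial_fun \<alpha> x)" for x
    using hpoly_imp_homogeneous_fun unfolding homogeneous_fun_def by blast
  have "f x = (\<Sum>\<alpha> | sum \<alpha> UNIV \<le> n. (if sum \<alpha> UNIV = n then c \<alpha> else 0) * monomial_fun \<alpha> x)" for x
    unfolding c by (rule sum.mono_neutral_cong_left) (auto simp: finite_bounded_exponents)
  then show ?thesis unfolding polynomial_fun_def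
    by (intro exI[of _ n] exI[of _ "\<lambda>\<alpha>. if sum \<alpha> UNIV = n then c \<alpha> else 0"]) auto
qed

subsection \<open>Division by a linear form\<close>

text \<open>A difference quotient with its product rule. When the linear form takes the value 1 at
  \<open>b\<close>, the second argument of \<open>f\<close> is the projection of \<open>x\<close> to
  the kernel along \<open>b\<close>. The clause for \<open>n = 0\<close> compensates the truncation
  of \<open>n - 1\<close>: in the product case a constant factor contributes the zero function and
  not a quotient of degree 0.\<close>

lemma hpoly_division:
  assumes "hpoly n f"
  shows "\<exists>g. (n = 0 \<longrightarrow> g = (\<lambda>x. 0)) \<and> hpoly (n - 1) g \<and>
     (\<forall>x. f x - f (x - (\<Sum>i\<in>UNIV. a $ i * x $ i) *s b) = (\<Sum>i\<in>UNIV. a $ i * x $ i) * g x)"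
  using assms
proof (induction n f rule: hpoly.induct)
  case (hpoly_zero n)
  show ?case by (rule exI[of _ "\<lambda>x. 0"]) (auto intro: hpoly.hpoly_zero)
next
  case (hpoly_const c)
  show ?case by (rule exI[of _ "\<lambda>x. 0"]) (auto intro: hpoly.hpoly_zero)
next
  case (hpoly_coord i)
  show ?case by (rule exI[of _ "\<lambda>x. b $ i"]) (auto intro: hpoly.hpoly_const)
next
  case (hpoly_add n f g)
  then obtain f' g' where "n = 0 \<longrightarrow> f' = (\<lambda>x. 0)" "hpoly (n - 1) f'"
      "\<And>x. f x - f (x - (\<Sum>i\<in>UNIV. a $ i * x $ i) *s b) = (\<Sum>i\<in>UNIV. a $ i * x $ i) * f' x"
      "n = 0 \<longrightarrow> g' = (\<lambda>x. 0)" "hpoly (n - 1) g'"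
      "\<And>x. g x - g (x - (\<Sum>i\<in>UNIV. a $ i * x $ i) *s b) = (\<Sum>i\<in>UNIV. a $ i * x $ i) * g' x"
    by blast
  note * = this
  show ?case
  proof (intro exI[of _ "\<lambda>x. f' x + g' x"] conjI allI)
    fix x
    let ?l = "\<Sum>i\<in>UNIV. a $ i * x $ i"
    have "f x + g x - (f (x - ?l *s b) + g (x - ?l *s b))
        = (f x - f (x - ?l *s b)) + (g x - g (x - ?l *s b))" by simp
    then show "f x + g x - (f (x - ?l *s b) + g (x - ?l *s b)) = ?l * (f' x + g' x)"
      unfolding *(3,6) by (simp add: distrib_left)
  qed (use * in \<open>auto intro: hpoly.hpoly_add\<close>)
next
  case (hpoly_mult m f n g)
  let ?l = "\<lambda>x. \<Sum>i\<in>UNIV. a $ i * x $ i"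
  let ?p = "\<lambda>x. x - ?l x *s b"
  have hp: "hpoly 1 (\<lambda>x. ?p x $ i)" for i
    using hpoly_diff[OF hpoly_coord hpoly_mult'[OF hpoly_linear hpoly_const], of i a "b $ i"] by simp
  from hpoly_mult obtain f' g' where *: "m = 0 \<longrightarrow> f' = (\<lambda>x. 0)" "hpoly (m - 1) f'"
      "\<And>x. f x - f (?p x) = ?l x * f' x"
      "n = 0 \<longrightarrow> g' = (\<lambda>x. 0)" "hpoly (n - 1) g'"
      "\<And>x. g x - g (?p x) = ?l x * g' x"
    by blast
  have 1: "hpoly (m + n - 1) (\<lambda>x. f' x * g x)"
    using *(1) hpoly_mult.hyps(2) *(2) by (cases m) (auto intro: hpoly.hpoly_mult hpoly.hpoly_zero)
  have 2: "hpoly (m + n - 1) (\<lambda>x. f (?p x) * g' x)"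
    using *(4) hpoly_mult' [OF hpoly_subst[OF hpoly_mult.hyps(1) hp] *(5)]
    by (cases n) (auto intro: hpoly.hpoly_zero)
  have 3: "f x * g x - f (?p x) * g (?p x) = ?l x * (f' x * g x + f (?p x) * g' x)" for x
  proof -
    have "f x * g x - f (?p x) * g (?p x) = (f x - f (?p x)) * g x + f (?p x) * (g x - g (?p x))"
      by (simp add: algebra_simps)
    then show ?thesis unfolding *(3,6) by (simp add: algebra_simps)
  qed
  show ?case
    using hpoly.hpoly_add[OF 1 2] 3 *(1,4) by (intro exI[of _ "\<lambda>x. f' x * g x + f (?p x) * g' x"]) auto
qed

lemma hpoly_divides_linear:
  assumes f: "hpoly n f" and a: "a \<noteq> 0"
    and z: "\<And>x. (\<Sum>i\<in>UNIV. a $ i * x $ i) = 0 \<Longrightarrow> f x = 0"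
  obtains g where "hpoly (n - 1) g" "n = 0 \<Longrightarrow> g = (\<lambda>x. 0)" "\<And>x. f x = (\<Sum>i\<in>UNIV. a $ i * x $ i) * g x"
proof -
  let ?l = "\<lambda>x. \<Sum>i\<in>UNIV. a $ i * x $ i"
  obtain j where j: "a $ j \<noteq> 0" using a by (metis vec_eq_iff zero_index)
  \<comment> \<open>The linear form is 1 at \<open>b\<close>, so the projected point lies in its
    kernel, where \<open>f\<close> vanishes.\<close>
  define b :: "complex^'a" where "b = axis j (1 / a $ j)"
  have lb: "?l b = 1"
    using j by (simp add: b_def axis_def if_distrib[of "\<lambda>t. _ * t"] cong: if_cong)
  obtain g where g: "hpoly (n - 1) g" "n = 0 \<longrightarrow> g = (\<lambda>x. 0)" "\<And>x. f x - f (x - ?l x *s b) = ?l x * g x"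
    using hpoly_division[OF f, of a b] by blast
  have "?l (x - c *s b) = ?l x - c * ?l b" for x c
    by (simp add: algebra_simps sum_subtractf sum_distrib_left)
  then have "?l (x - ?l x *s b) = 0" for x using lb by simp
  then have "f x = ?l x * g x" for x using g(3)[of x] z by simp
  then show thesis using that g by blast
qed

subsection \<open>Directional derivatives\<close>

definition dir_deriv :: "(complex^'n::finite \<Rightarrow> complex) \<Rightarrow> complex^'n \<Rightarrow> complex^'n \<Rightarrow> complex" where
  "dir_deriv f x w = deriv (\<lambda>t. f (x + t *s w)) 0"

lemma bounded_linear_vector_scalar_left: "bounded_linear (\<lambda>h::complex. h *s (w :: complex^'n::finite))"
  unfolding linear_conv_bounded_linear[symmetric]
  by (rule linearI) (auto simp: vec_eq_iff algebra_simps)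

lemma has_derivative_vec_componentwise:
  fixes \<phi> :: "'a::real_normed_vector \<Rightarrow> complex^'n::finite"
  assumes "\<And>i. ((\<lambda>a. \<phi> a $ i) has_derivative (\<lambda>h. \<phi>' h $ i)) F"
  shows "(\<phi> has_derivative \<phi>') F"
proof -
  have *: "x = (\<Sum>i\<in>UNIV. x $ i *s axis i 1)" for x :: "complex^'n"
    by (simp add: vec_eq_iff axis_def if_distrib[of "\<lambda>t. _ * t"] cong: if_cong)
  have "((\<lambda>a. \<Sum>i\<in>UNIV. \<phi> a $ i *s (axis i 1 :: complex^'n)) has_derivative
      (\<lambda>h. \<Sum>i\<in>UNIV. \<phi>' h $ i *s axis i 1)) F"
    by (intro has_derivative_sum bounded_linear.has_derivative[OF bounded_linear_vector_scalar_left] assms)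
  then show ?thesis unfolding *[symmetric] .
qed

text \<open>The partial derivatives are carried along as polynomials. As in
  \<open>hpoly_division\<close>, degree 0 is recorded separately because \<open>n - 1\<close>
  truncates.\<close>

lemma hpoly_gradient:
  fixes f :: "complex^'n::finite \<Rightarrow> complex"
  assumes "hpoly n f"
  shows "\<exists>g. (\<forall>j. (n = 0 \<longrightarrow> g j = (\<lambda>x. 0)) \<and> hpoly (n - 1) (g j)) \<and>
    (\<forall>x. (f has_derivative (\<lambda>h. \<Sum>j\<in>UNIV. g j x * h $ j)) (at x))"
  using assms
proof (induction n f rule: hpoly.induct)
  case (hpoly_zero n)
  show ?case by (rule exI[of _ "\<lambda>j x. 0"]) (auto intro: hpoly.hpoly_zero)
next
  case (hpoly_const c)
  show ?case by (rule exI[of _ "\<lambda>j x. 0"]) (auto intro: hpoly.hpoly_zero)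
next
  case (hpoly_coord i)
  have "((\<lambda>x::complex^'n. x $ i) has_derivative (\<lambda>h. \<Sum>j\<in>UNIV. (if j = i then 1 else 0) * h $ j)) (at x)" for x
  proof -
    have "((\<lambda>x::complex^'n. x $ i) has_derivative (\<lambda>h. h $ i)) (at x)"
      by (rule bounded_linear_imp_has_derivative[OF bounded_linear_vec_nth])
    then show ?thesis by (simp add: if_distrib[of "\<lambda>t. t * _"] cong: if_cong)
  qed
  then show ?case
    by (intro exI[of _ "\<lambda>j x. if j = i then 1 else 0"])
       (auto intro: hpoly.hpoly_const simp: if_distrib[of "hpoly 0"] hpoly.hpoly_zero)
next
  case (hpoly_add n f g)
  then obtain f' g' where *: "\<And>j. n = 0 \<longrightarrow> f' j = (\<lambda>x. 0)" "\<And>j. hpoly (n - 1) (f' j)"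
      "\<And>x. (f has_derivative (\<lambda>h. \<Sum>j\<in>UNIV. f' j x * h $ j)) (at x)"
      "\<And>j. n = 0 \<longrightarrow> g' j = (\<lambda>x. 0)" "\<And>j. hpoly (n - 1) (g' j)"
      "\<And>x. (g has_derivative (\<lambda>h. \<Sum>j\<in>UNIV. g' j x * h $ j)) (at x)"
    by blast
  show ?case
  proof (intro exI[of _ "\<lambda>j x. f' j x + g' j x"] conjI allI)
    fix x
    show "((\<lambda>x. f x + g x) has_derivative (\<lambda>h. \<Sum>j\<in>UNIV. (f' j x + g' j x) * h $ j)) (at x)"
      using has_derivative_add[OF *(3,6)] by (simp add: distrib_right sum.distrib)
  qed (use * in \<open>auto intro: hpoly.hpoly_add\<close>)
next
  case (hpoly_mult m f n g)
  then obtain f' g' where *: "\<And>j. m = 0 \<longrightarrow> f' j = (\<lambda>x. 0)" "\<And>j. hpoly (m - 1) (f' j)"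
      "\<And>x. (f has_derivative (\<lambda>h. \<Sum>j\<in>UNIV. f' j x * h $ j)) (at x)"
      "\<And>j. n = 0 \<longrightarrow> g' j = (\<lambda>x. 0)" "\<And>j. hpoly (n - 1) (g' j)"
      "\<And>x. (g has_derivative (\<lambda>h. \<Sum>j\<in>UNIV. g' j x * h $ j)) (at x)"
    by blast
  have 1: "hpoly (m + n - 1) (\<lambda>x. f x * g' j x)" for j
    using *(4)[of j] hpoly_mult'[OF hpoly_mult.hyps(1) *(5)]
    by (cases n) (auto intro: hpoly.hpoly_zero)
  have 2: "hpoly (m + n - 1) (\<lambda>x. f' j x * g x)" for j
    using *(1)[of j] hpoly_mult'[OF *(2) hpoly_mult.hyps(2)]
    by (cases m) (auto intro: hpoly.hpoly_zero)
  show ?case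
  proof (intro exI[of _ "\<lambda>j x. f x * g' j x + f' j x * g x"] conjI allI)
    fix x
    show "((\<lambda>x. f x * g x) has_derivative (\<lambda>h. \<Sum>j\<in>UNIV. (f x * g' j x + f' j x * g x) * h $ j)) (at x)"
      using has_derivative_mult[OF *(3,6), of x]
      by (simp add: algebra_simps sum.distrib sum_distrib_left)
  qed (use 1 2 *(1,4) in \<open>auto intro: hpoly.hpoly_add\<close>)
qed

lemma has_derivative_affine_line:
  "((\<lambda>t::complex. x + t *s (w::complex^'n::finite)) has_derivative (\<lambda>h. h *s w)) (at t)"
  using has_derivative_add[OF has_derivative_const
    bounded_linear.has_derivative[OF bounded_linear_vector_scalar_left has_derivative_ident], of x]
  by simp

lemma hpoly_dir_deriv_gradient:
  fixes f :: "complex^'n::finite \<Rightarrow> complex"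
  assumes "hpoly n f"
  obtains g where "\<And>j. hpoly (n - 1) (g j)" "\<And>x w. dir_deriv f x w = (\<Sum>j\<in>UNIV. g j x * w $ j)"
    "\<And>x. (f has_derivative dir_deriv f x) (at x)"
proof -
  obtain g where g: "\<And>j. hpoly (n - 1) (g j)"
      "\<And>x. (f has_derivative (\<lambda>h. \<Sum>j\<in>UNIV. g j x * h $ j)) (at x)"
    using hpoly_gradient[OF assms] by blast
  have *: "dir_deriv f x w = (\<Sum>j\<in>UNIV. g j x * w $ j)" for x w
  proof -
    have "((\<lambda>t. f (x + t *s w)) has_derivative (\<lambda>h. \<Sum>j\<in>UNIV. g j x * (h *s w) $ j)) (at 0)"
      using g(2)[of "x + 0 *s w"] has_derivative_compose[OF has_derivative_affine_line[of x w 0]]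
      by (simp only: vector_smult_lzero add_0_right)
    then have "((\<lambda>t. f (x + t *s w)) has_field_derivative (\<Sum>j\<in>UNIV. g j x * w $ j)) (at 0)"
      unfolding has_field_derivative_def
      by (rule has_derivative_eq_rhs) (simp add: fun_eq_iff sum_distrib_left sum_distrib_right algebra_simps)
    then show ?thesis unfolding dir_deriv_def by (rule DERIV_imp_deriv)
  qed
  then have "(\<lambda>h. \<Sum>j\<in>UNIV. g j x * h $ j) = dir_deriv f x" for x by auto
  then show thesis using that[OF g(1) *] g(2) by simp
qed

lemma hpoly_has_derivative: "hpoly n f \<Longrightarrow> (f has_derivative dir_deriv f x) (at x)"
  using hpoly_dir_deriv_gradient[of n f] by metis

lemma hpoly_dir_deriv_add: "hpoly n f \<Longrightarrow> dir_deriv f x (v + w) = dir_deriv f x v + dir_deriv f x w"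
proof -
  assume "hpoly n f"
  then obtain g where "\<And>x w. dir_deriv f x w = (\<Sum>j\<in>UNIV. g j x * w $ j)"
    using hpoly_dir_deriv_gradient by metis
  then show ?thesis by (simp add: distrib_left sum.distrib)
qed

lemma hpoly_dir_deriv_scale: "hpoly n f \<Longrightarrow> dir_deriv f x (c *s w) = c * dir_deriv f x w"
proof -
  assume "hpoly n f"
  then obtain g where "\<And>x w. dir_deriv f x w = (\<Sum>j\<in>UNIV. g j x * w $ j)"
    using hpoly_dir_deriv_gradient by metis
  then show ?thesis by (simp add: sum_distrib_left algebra_simps)
qed

lemma hpoly_dir_deriv_vector:
  assumes f: "hpoly n f" and W: "\<And>j. hpoly m (\<lambda>x. W x $ j)" and k: "k = n - 1 + m"
  shows "hpoly k (\<lambda>x. dir_deriv f x (W x))"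
proof -
  obtain g where g: "\<And>j. hpoly (n - 1) (g j)" "\<And>x w. dir_deriv f x w = (\<Sum>j\<in>UNIV. g j x * w $ j)"
    using hpoly_dir_deriv_gradient[OF f] by metis
  show ?thesis unfolding g(2) k by (intro hpoly_sum hpoly_mult g(1) W)
qed

lemma hpoly_dir_deriv: "hpoly n f \<Longrightarrow> hpoly (n - 1) (\<lambda>x. dir_deriv f x w)"
proof -
  assume "hpoly n f"
  then obtain g where "\<And>j. hpoly (n - 1) (g j)" "\<And>x w. dir_deriv f x w = (\<Sum>j\<in>UNIV. g j x * w $ j)"
    using hpoly_dir_deriv_gradient by metis
  then show ?thesis using hpoly_sum[of UNIV "n - 1" "\<lambda>j x. w $ j * g j x"]
    by (auto intro: hpoly_cmult simp: mult.commute)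
qed

lemma hpoly_chain:
  assumes f: "hpoly n f" and \<phi>: "\<And>i. ((\<lambda>a. \<phi> a $ i) has_derivative (\<lambda>h. \<phi>' h $ i)) (at a)"
  shows "((\<lambda>a. f (\<phi> a)) has_derivative (\<lambda>h. dir_deriv f (\<phi> a) (\<phi>' h))) (at a)"
  using has_derivative_compose[OF has_derivative_vec_componentwise[OF \<phi>] hpoly_has_derivative[OF f]] .

lemma hpoly_chain_field:
  assumes f: "hpoly n f" and \<phi>: "\<And>i. ((\<lambda>t. \<phi> t $ i) has_field_derivative w $ i) (at t)"
  shows "((\<lambda>t. f (\<phi> t)) has_field_derivative dir_deriv f (\<phi> t) w) (at t)"
proof -
  have "((\<lambda>t. f (\<phi> t)) has_derivative (\<lambda>h. dir_deriv f (\<phi> t) (h *s w))) (at t)"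
    by (intro hpoly_chain[OF f] has_derivative_eq_rhs[OF \<phi>[unfolded has_field_derivative_def]])
       (simp add: mult.commute fun_eq_iff)
  then show ?thesis
    unfolding has_field_derivative_def hpoly_dir_deriv_scale[OF f]
    by (rule has_derivative_eq_rhs) (simp add: mult.commute fun_eq_iff)
qed

lemma hpoly_line_derivative:
  assumes f: "hpoly n f"
  shows "((\<lambda>t. f (x + t *s w)) has_field_derivative dir_deriv f (x + t *s w) w) (at t)"
  by (intro hpoly_chain_field[OF f]) (auto intro!: derivative_eq_intros)

lemma dir_deriv_eqI:
  "((\<lambda>t. f (x + t *s w)) has_field_derivative D) (at 0) \<Longrightarrow> dir_deriv f x w = D"
  unfolding dir_deriv_def by (rule DERIV_imp_deriv)

lemma hpoly_line_derivative_0: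
  assumes f: "hpoly n f"
  shows "((\<lambda>t. f (x + t *s w)) has_field_derivative dir_deriv f x w) (at 0)"
  using hpoly_line_derivative[OF f, of x w 0] by simp

lemma hpoly_euler:
  assumes f: "hpoly n f" shows "dir_deriv f x x = of_nat n * f x"
proof (rule dir_deriv_eqI)
  have "f (x + t *s x) = (1 + t) ^ n * f x" for t
    using hpoly_scale[OF f, of "1 + t" x] by (simp add: vector_sadd_rdistrib)
  then show "((\<lambda>t. f (x + t *s x)) has_field_derivative of_nat n * f x) (at 0)"
    by (auto intro!: derivative_eq_intros)
qed

lemma hpoly_dir_deriv_scale_point:
  assumes f: "hpoly n f" and c: "c \<noteq> 0"
  shows "dir_deriv f (c *s x) w = c ^ (n - 1) * dir_deriv f x w"
  using hpoly_scale[OF hpoly_dir_deriv[OF f]] .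

lemma dir_deriv_add: "hpoly n f \<Longrightarrow> hpoly m g \<Longrightarrow> dir_deriv (\<lambda>x. f x + g x) x w = dir_deriv f x w + dir_deriv g x w"
  by (rule dir_deriv_eqI) (auto intro!: derivative_eq_intros hpoly_line_derivative_0)

subsection \<open>Linear algebra in dimension three\<close>

definition det3 :: "complex^3 \<Rightarrow> complex^3 \<Rightarrow> complex^3 \<Rightarrow> complex" where
  "det3 a b c = a$1 * (b$2 * c$3 - b$3 * c$2) - a$2 * (b$1 * c$3 - b$3 * c$1) + a$3 * (b$1 * c$2 - b$2 * c$1)"

text \<open>The division-free Cramer rule, that is, the linear relation between four vectors of a
  three-dimensional space. It expands vectors in a frame and, with polynomial entries, is the
  relation divided at a singular point.\<close>

lemma cramer3:
  "det3 p q r *s x = det3 x q r *s p + det3 p x r *s q + det3 p q x *s r"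
  by (simp add: vec_eq_iff forall_3 det3_def) algebra

lemma det3_add:
  "det3 (a + a') b c = det3 a b c + det3 a' b c"
  "det3 a (b + b') c = det3 a b c + det3 a b' c"
  "det3 a b (c + c') = det3 a b c + det3 a b c'"
  by (simp_all add: det3_def algebra_simps)

lemma det3_diff:
  "det3 (a - a') b c = det3 a b c - det3 a' b c"
  "det3 a (b - b') c = det3 a b c - det3 a b' c"
  "det3 a b (c - c') = det3 a b c - det3 a b c'"
  by (simp_all add: det3_def algebra_simps)

lemma det3_scale:
  "det3 (k *s a) b c = k * det3 a b c"
  "det3 a (k *s b) c = k * det3 a b c"
  "det3 a b (k *s c) = k * det3 a b c"
  by (simp_all add: det3_def algebra_simps)

lemma det3_eq [simp]: "det3 a a b = 0" "det3 a b a = 0" "det3 b a a = 0"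
  by (simp_all add: det3_def algebra_simps)

lemma det3_0 [simp]: "det3 0 a b = 0" "det3 a 0 b = 0" "det3 a b 0 = 0"
  by (simp_all add: det3_def)

lemma det3_swap: "det3 b a c = - det3 a b c" "det3 a c b = - det3 a b c"
  by (simp_all add: det3_def algebra_simps)

lemma det3_cycle: "det3 b c a = det3 a b c"
  by (simp add: det3_def algebra_simps)

lemmas det3_simps = det3_add det3_diff det3_scale

definition cross :: "complex^3 \<Rightarrow> complex^3 \<Rightarrow> complex^3" where
  "cross a b = vector [a$2 * b$3 - a$3 * b$2, a$3 * b$1 - a$1 * b$3, a$1 * b$2 - a$2 * b$1]"

lemma sum_cross: "(\<Sum>i\<in>UNIV. cross a b $ i * x $ i) = det3 a b x"
  by (simp add: cross_def sum_3 det3_def algebra_simps)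

lemma mem_span1: "x \<in> vec.span {p::complex^'n} \<longleftrightarrow> (\<exists>a. x = a *s p)"
  by (auto simp: vec.span_singleton)

lemma mem_span2: "x \<in> vec.span {p::complex^'n, q} \<longleftrightarrow> (\<exists>a b. x = a *s p + b *s q)"
proof -
  have "x \<in> vec.span {p, q} \<longleftrightarrow> (\<exists>a b. x - a *s p = b *s q)"
    by (simp only: vec.span_breakdown_eq[of x p] mem_span1)
  then show ?thesis by (simp add: diff_eq_eq add.commute)
qed

lemma mem_span3: "x \<in> vec.span {p::complex^'n, q, r} \<longleftrightarrow> (\<exists>a b c. x = a *s p + b *s q + c *s r)"
proof -
  have "x \<in> vec.span {p, q, r} \<longleftrightarrow> (\<exists>a b c. x - a *s p = b *s q + c *s r)"
    by (simp only: vec.span_breakdown_eq[of x p] mem_span2)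
  then show ?thesis by (simp add: diff_eq_eq add.assoc add.commute add.left_commute)
qed

lemma det3_expand:
  "det3 (a1 *s p + b1 *s q + c1 *s r) (a2 *s p + b2 *s q + c2 *s r) (a3 *s p + b3 *s q + c3 *s r)
    = (a1 * (b2 * c3 - b3 * c2) - b1 * (a2 * c3 - a3 * c2) + c1 * (a2 * b3 - a3 * b2)) * det3 p q r"
  by (simp add: det3_def) algebra

lemma cross_eq_0_imp: "(\<And>x. det3 p q x = 0) \<Longrightarrow> p \<noteq> 0 \<Longrightarrow> q \<in> vec.span {p}"
proof -
  assume d: "\<And>x. det3 p q x = 0" and "p \<noteq> 0"
  then obtain i where i: "p $ i \<noteq> 0" by (metis vec_eq_iff zero_index)
  have e: "p$2 * q$3 = p$3 * q$2" "p$3 * q$1 = p$1 * q$3" "p$1 * q$2 = p$2 * q$1"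
    using d[of "axis 1 1"] d[of "axis 2 1"] d[of "axis 3 1"] by (simp_all add: det3_def axis_def)
  have "q = (q $ i / p $ i) *s p"
    using i exhaust_3[of i] e by (auto simp: vec_eq_iff forall_3 field_simps)
  then show ?thesis unfolding mem_span1 by blast
qed

lemma span3_iff_det3: "vec.span {p, q, r} = (UNIV :: (complex^3) set) \<longleftrightarrow> det3 p q r \<noteq> 0"
proof
  assume "vec.span {p, q, r} = UNIV"
  then have *: "\<exists>a b c. x = a *s p + b *s q + c *s r" for x :: "complex^3"
    using mem_span3[of x p q r] by auto
  obtain a1 b1 c1 a2 b2 c2 a3 b3 c3 where e:
    "(axis 1 1 :: complex^3) = a1 *s p + b1 *s q + c1 *s r" "(axis 2 1 :: complex^3) = a2 *s p + b2 *s q + c2 *s r"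
    "(axis 3 1 :: complex^3) = a3 *s p + b3 *s q + c3 *s r"
    using *[of "axis 1 1"] *[of "axis 2 1"] *[of "axis 3 1"] by metis
  have "det3 (axis 1 1) (axis 2 1) (axis 3 1) = 1" by (simp add: det3_def axis_def)
  then show "det3 p q r \<noteq> 0" unfolding e det3_expand by auto
next
  assume d: "det3 p q r \<noteq> 0"
  have "x \<in> vec.span {p, q, r}" for x
  proof -
    let ?d = "det3 p q r"
    have "x = (1 / ?d) *s (?d *s x)" using d by simp
    also have "\<dots> = (det3 x q r / ?d) *s p + (det3 p x r / ?d) *s q + (det3 p q x / ?d) *s r"
      unfolding cramer3[of p q r x] by (simp add: vector_add_ldistrib vector_smult_assoc)
    finally show ?thesis unfolding mem_span3 by blast
  qed
  then show "vec.span {p, q, r} = UNIV" by auto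
qed

lemma det3_nonzeroI: "p \<noteq> 0 \<Longrightarrow> q \<notin> vec.span {p} \<Longrightarrow> \<exists>r. det3 p q r = 1"
proof -
  assume "p \<noteq> 0" "q \<notin> vec.span {p}"
  then obtain r where "det3 p q r \<noteq> 0" using cross_eq_0_imp[of p q] by blast
  then have "det3 p q ((1 / det3 p q r) *s r) = 1" by (simp add: det3_scale)
  then show ?thesis by blast
qed

lemma proj_points_iff: "s \<in> proj_points \<longleftrightarrow> (\<exists>p. p \<noteq> 0 \<and> s = vec.span {p})"
proof
  assume "s \<in> proj_points"
  then have s: "vec.subspace s" "vec.dim s = 1" unfolding proj_points_def by auto
  then have "\<not> s \<subseteq> {0}" using vec.dim_subset[of s "{0}"] by auto
  then obtain p where p: "p \<in> s" "p \<noteq> 0" by auto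
  have "vec.span {p} \<subseteq> s" using s(1) p(1) vec.span_minimal[of "{p}" s] by blast
  moreover have "vec.dim (vec.span {p}) = 1" using p(2) by simp
  ultimately have "vec.span {p} = s"
    using s vec.subspace_dim_equal[of "vec.span {p}" s] by simp
  then show "\<exists>p. p \<noteq> 0 \<and> s = vec.span {p}" using p by auto
qed (auto simp: proj_points_def)

lemma proj_point_eq_span: "s \<in> proj_points \<Longrightarrow> p \<in> s \<Longrightarrow> p \<noteq> 0 \<Longrightarrow> s = vec.span {p}"
proof -
  assume "s \<in> proj_points" "p \<in> s" "p \<noteq> 0"
  then obtain p0 a where "s = vec.span {p0}" "p = a *s p0" "a \<noteq> 0"
    unfolding proj_points_iff by (metis mem_span1 vector_smult_lzero)
  moreover have "vec.span {a *s p0} = vec.span {p0}"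
  proof -
    have "k *s p0 = (k / a) *s (a *s p0)" for k using \<open>a \<noteq> 0\<close> by simp
    then show ?thesis unfolding set_eq_iff mem_span1 by (metis vector_smult_assoc)
  qed
  ultimately show ?thesis by simp
qed

lemma span2_proj_line:
  assumes "det3 e1 e2 e3 \<noteq> 0"
  shows "vec.span {e1, e2} \<in> proj_lines" "vec.span {e1, e2} = {x. det3 e1 e2 x = 0}"
proof -
  have "e1 \<noteq> 0" "e2 \<notin> vec.span {e1}" using assms by (auto simp: mem_span1 det3_scale)
  then have "vec.dim (vec.span {e1, e2}) = 2"
    by (simp add: insert_commute[of e1] vec.dim_insert)
  then show "vec.span {e1, e2} \<in> proj_lines" unfolding proj_lines_def by auto
  show "vec.span {e1, e2} = {x. det3 e1 e2 x = 0}"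
  proof (intro equalityI subsetI)
    fix x assume "x \<in> {x. det3 e1 e2 x = 0}"
    then have "det3 e1 e2 e3 *s x = det3 x e2 e3 *s e1 + det3 e1 x e3 *s e2"
      using cramer3[of e1 e2 e3 x] by simp
    then have "(1 / det3 e1 e2 e3) *s (det3 e1 e2 e3 *s x)
        = (1 / det3 e1 e2 e3) *s (det3 x e2 e3 *s e1 + det3 e1 x e3 *s e2)" by (rule arg_cong)
    then have "x = (det3 x e2 e3 / det3 e1 e2 e3) *s e1 + (det3 e1 x e3 / det3 e1 e2 e3) *s e2"
      using assms by (simp add: vector_add_ldistrib vector_smult_assoc)
    then show "x \<in> vec.span {e1, e2}" unfolding mem_span2 by blast
  qed (auto simp: mem_span2 det3_simps)
qed

lemma proj_line_eqI:
  assumes l: "l \<in> proj_lines" "l' \<in> proj_lines" "l \<subseteq> l'" shows "l = l'"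
proof (rule vec.subspace_dim_equal)
  show "vec.subspace l" "vec.subspace l'" "vec.dim l' \<le> vec.dim l"
    using l unfolding proj_lines_def by auto
qed fact

lemma proj_line_frame:
  assumes l: "l \<in> proj_lines" and "p \<in> l" "p \<noteq> 0" "q \<in> l" "q \<notin> vec.span {p}"
  obtains r where "det3 p q r = 1" "l = vec.span {p, q}" "l = {x. det3 p q x = 0}"
proof -
  obtain r where r: "det3 p q r = 1" using det3_nonzeroI assms by blast
  then have s: "vec.span {p, q} \<in> proj_lines" "vec.span {p, q} = {x. det3 p q x = 0}"
    using span2_proj_line[of p q r] by auto
  have "vec.span {p, q} \<subseteq> l"
    by (rule vec.span_minimal) (use l assms(2,4) in \<open>auto simp: proj_lines_def\<close>)
  then have "vec.span {p, q} = l"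
    by (rule proj_line_eqI[OF s(1) l])
  then show thesis using that[OF r] s(2) by metis
qed

lemma proj_line_not_subset_point:
  assumes l: "l \<in> proj_lines" obtains q where "q \<in> l" "q \<notin> vec.span {p}"
proof -
  have "\<not> l \<subseteq> vec.span {p}"
  proof
    assume "l \<subseteq> vec.span {p}"
    then have "vec.dim l \<le> vec.dim (vec.span {p})" by (rule vec.dim_subset)
    then show False using l by (auto simp: proj_lines_def split: if_splits)
  qed
  then show thesis using that by auto
qed

lemma proj_line_basis:
  assumes l: "l \<in> proj_lines"
  obtains e1 e2 e3 where "det3 e1 e2 e3 = 1" "l = vec.span {e1, e2}" "l = {x. det3 e1 e2 x = 0}"
proof -
  obtain p where p: "p \<in> l" "p \<notin> vec.span {0}" using proj_line_not_subset_point[OF l] by blast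
  obtain q where "q \<in> l" "q \<notin> vec.span {p}" using proj_line_not_subset_point[OF l] by blast
  then show thesis using proj_line_frame[OF l p(1), of q] p(2) that by auto
qed

lemma covector_frame:
  assumes "a \<noteq> (0::complex^3)"
  obtains (frame) e1 e2 e3 where "det3 e1 e2 e3 \<noteq> 0" "{x. (\<Sum>i\<in>UNIV. a $ i * x $ i) = 0} = vec.span {e1, e2}"
    "cross e1 e2 = a"
proof -
  have *: thesis if "cross e1 e2 = a" for e1 e2
  proof -
    obtain i where "a $ i \<noteq> 0" using assms by (metis vec_eq_iff zero_index)
    then have "det3 e1 e2 (axis i 1) \<noteq> 0"
      unfolding sum_cross[symmetric] that
      by (simp add: axis_def if_distrib[of "\<lambda>t. _ * t"] cong: if_cong)
    note d = this
    have "{x. (\<Sum>i\<in>UNIV. a $ i * x $ i) = 0} = vec.span {e1, e2}"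
      unfolding span2_proj_line(2)[OF d] that[symmetric] sum_cross ..
    with d show thesis using that frame by blast
  qed
  obtain i where i: "a $ i \<noteq> 0" using assms by (metis vec_eq_iff zero_index)
  consider "a $ 1 \<noteq> 0" | "a $ 2 \<noteq> 0" | "a $ 3 \<noteq> 0" using i exhaust_3[of i] by auto
  then show thesis
  proof cases
    case 1
    then show thesis by (intro *[of "vector [- a$2 / a$1, 1, 0]" "vector [- a$3, 0, a$1]"])
       (simp add: cross_def vec_eq_iff forall_3)
  next
    case 2
    then show thesis by (intro *[of "vector [0, - a$3 / a$2, 1]" "vector [a$2, - a$1, 0]"])
       (simp add: cross_def vec_eq_iff forall_3)
  next
    case 3
    then show thesis by (intro *[of "vector [1, 0, - a$1 / a$3]" "vector [0, a$3, - a$2]"])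
       (simp add: cross_def vec_eq_iff forall_3)
  qed
qed

lemma proj_lines_covector:
  assumes "l \<in> proj_lines" obtains a where "a \<noteq> 0" "l = {x. (\<Sum>i\<in>UNIV. a $ i * x $ i) = 0}"
proof -
  obtain e1 e2 e3 where e: "det3 e1 e2 e3 = 1" "l = {x. det3 e1 e2 x = 0}"
    using proj_line_basis[OF assms] by metis
  have "cross e1 e2 \<noteq> 0" using e(1) sum_cross[of e1 e2 e3] by auto
  then show thesis using that e(2) unfolding sum_cross[symmetric] by blast
qed

subsection \<open>Homogeneous one-forms\<close>

lemma form_app_add: "form_app \<omega> x (v + w) = form_app \<omega> x v + form_app \<omega> x w"
  by (simp add: form_app_def distrib_left sum.distrib)

lemma form_app_scale: "form_app \<omega> x (c *s v) = c * form_app \<omega> x v"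
  by (simp add: form_app_def sum_distrib_left algebra_simps)

definition homogeneous_form :: "nat \<Rightarrow> one_form \<Rightarrow> bool" where
  "homogeneous_form m \<omega> \<longleftrightarrow> (\<forall>i. hpoly m (\<lambda>x. \<omega> x $ i)) \<and> (\<forall>x. form_app \<omega> x x = 0)"

lemma foliation_iff: "foliation \<omega> \<longleftrightarrow> (\<exists>m. homogeneous_form m \<omega>) \<and> finite {s. singular_point \<omega> s}"
  unfolding foliation_def homogeneous_form_def homogeneous_fun_iff_hpoly by blast

section \<open>The linear part of a form at a singular point\<close>

text \<open>At a singular point \<open>p\<close> both \<open>w = p\<close> and \<open>v = p\<close>
  give 0, so this is a bilinear form on the two-dimensional quotient by \<open>p\<close>: the linear
  part of the foliation without a choice of chart.\<close>

definition jac :: "one_form \<Rightarrow> complex^3 \<Rightarrow> complex^3 \<Rightarrow> complex^3 \<Rightarrow> complex" where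
  "jac \<omega> p w v = dir_deriv (\<lambda>x. form_app \<omega> x v) p w"

lemma form_app_zero: "\<omega> x = 0 \<Longrightarrow> form_app \<omega> x v = 0"
  by (simp add: form_app_def)

context
  fixes m :: nat and \<omega> :: one_form
  assumes hom: "homogeneous_form m \<omega>"
begin

lemma hpoly_form_app: "hpoly m (\<lambda>x. form_app \<omega> x v)"
  unfolding form_app_def
  using hom by (intro hpoly_sum) (auto intro!: hpoly_cmult simp: homogeneous_form_def mult.commute[of _ "v $ _"])

lemma form_app_self: "form_app \<omega> x x = 0"
  using hom by (auto simp: homogeneous_form_def)

lemma form_app_scale_point: "form_app \<omega> (c *s x) v = c ^ m * form_app \<omega> x v"
  using hpoly_scale[OF hpoly_form_app] .

lemma jac_add_right: "jac \<omega> p w (v + v') = jac \<omega> p w v + jac \<omega> p w v'"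
  unfolding jac_def form_app_add by (rule dir_deriv_add) (rule hpoly_form_app)+

lemma jac_scale_right: "jac \<omega> p w (c *s v) = c * jac \<omega> p w v"
  unfolding jac_def form_app_scale
  by (rule dir_deriv_eqI) (auto intro!: derivative_eq_intros hpoly_line_derivative_0 hpoly_form_app)

lemma jac_add_left: "jac \<omega> p (w + w') v = jac \<omega> p w v + jac \<omega> p w' v"
  unfolding jac_def by (rule hpoly_dir_deriv_add) (rule hpoly_form_app)

lemma jac_scale_left: "jac \<omega> p (c *s w) v = c * jac \<omega> p w v"
  unfolding jac_def by (rule hpoly_dir_deriv_scale) (rule hpoly_form_app)

lemma jac_euler: "jac \<omega> p p v = of_nat m * form_app \<omega> p v"
  unfolding jac_def by (rule hpoly_euler) (rule hpoly_form_app)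

text \<open>The identity \<open>form_app \<omega> x x = 0\<close>, differentiated along
  \<open>w\<close>.\<close>

lemma jac_radial: "jac \<omega> p w p = - form_app \<omega> p w"
proof -
  have "((\<lambda>t. form_app \<omega> (p + t *s w) p + t * form_app \<omega> (p + t *s w) w)
      has_field_derivative jac \<omega> p w p + form_app \<omega> p w) (at 0)"
    unfolding jac_def
    by (auto intro!: derivative_eq_intros hpoly_line_derivative_0 hpoly_form_app)
  moreover have "form_app \<omega> (p + t *s w) p + t * form_app \<omega> (p + t *s w) w = 0" for t
    using form_app_self[of "p + t *s w"] unfolding form_app_add form_app_scale .
  ultimately have "((\<lambda>t. 0) has_field_derivative jac \<omega> p w p + form_app \<omega> p w) (at 0)" by simp
  then have "jac \<omega> p w p + form_app \<omega> p w = 0" using DERIV_unique DERIV_const by blast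
  then show ?thesis by (simp add: eq_neg_iff_add_eq_0)
qed

lemma jac_scale_point: "c \<noteq> 0 \<Longrightarrow> jac \<omega> (c *s p) w v = c ^ (m - 1) * jac \<omega> p w v"
  unfolding jac_def by (rule hpoly_dir_deriv_scale_point) (rule hpoly_form_app)

lemmas jac_bilinear = jac_add_left jac_add_right jac_scale_left jac_scale_right

lemma singular_point_span:
  assumes "p \<noteq> 0" "\<omega> p = 0" shows "singular_point \<omega> (vec.span {p})"
  unfolding singular_point_def
proof (intro conjI ballI)
  fix x assume "x \<in> vec.span {p}"
  then obtain a where x: "x = a *s p" by (auto simp: mem_span1)
  have "\<omega> (a *s p) $ i = a ^ m * \<omega> p $ i" for i
    using hom hpoly_scale[of m "\<lambda>x. \<omega> x $ i" a p] by (simp add: homogeneous_form_def)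
  then show "\<omega> x = 0" unfolding x using assms(2) by (simp add: vec_eq_iff)
qed (use assms in \<open>auto simp: proj_points_iff\<close>)

lemma form_app_eq_0_imp: "det3 p q r \<noteq> 0 \<Longrightarrow> form_app \<omega> x p = 0 \<Longrightarrow> form_app \<omega> x q = 0 \<Longrightarrow> form_app \<omega> x r = 0 \<Longrightarrow> \<omega> x = 0"
proof -
  assume d: "det3 p q r \<noteq> 0" and *: "form_app \<omega> x p = 0" "form_app \<omega> x q = 0" "form_app \<omega> x r = 0"
  have "form_app \<omega> x v = 0" for v
  proof -
    obtain a b c where "v = a *s p + b *s q + c *s r"
      using d span3_iff_det3[of p q r] mem_span3[of v p q r] by auto
    then show ?thesis using * by (simp add: form_app_add form_app_scale)
  qed
  then have "form_app \<omega> x (axis i 1) = 0" for i by blast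
  then show ?thesis
    by (simp add: form_app_def vec_eq_iff axis_def if_distrib[of "\<lambda>t. _ * t"] cong: if_cong)
qed

lemma jac_line:
  assumes l: "invariant_line \<omega> l" and "p \<in> l" "q \<in> l" "r \<in> l" shows "jac \<omega> p q r = 0"
proof -
  have "form_app \<omega> (p + t *s q) r = 0" for t
    using assms by (auto simp: invariant_line_def proj_lines_def intro!: vec.subspace_add vec.subspace_scale)
  then show ?thesis unfolding jac_def dir_deriv_def by simp
qed

text \<open>In the chart of any frame the derivative of the field is the matrix of the bilinear form
  \<open>jac\<close> on the quotient by \<open>p\<close>, up to order and sign of its entries. Its
  invertibility therefore does not depend on the frame, and rescaling \<open>p\<close> only
  multiplies it by a nonzero power.\<close>

lemma nondegenerate_iff:
  assumes s: "singular_point \<omega> s" and p: "p \<in> s" and d: "det3 p q r \<noteq> 0"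
  shows "nondegenerate \<omega> s \<longleftrightarrow> (\<forall>w. (\<forall>v. jac \<omega> p w v = 0) \<longrightarrow> w \<in> s)"
proof -
  have p0: "p \<noteq> 0" using d by auto
  have sp: "s = vec.span {p}" using proj_point_eq_span s p p0 by (auto simp: singular_point_def)
  have z: "jac \<omega> p' p' v = 0" "jac \<omega> p' w p' = 0" if "p' \<in> s" for p' w v
    using that s by (auto simp: jac_euler jac_radial form_app_zero singular_point_def)
  define L where "L p q r h = (jac \<omega> p (fst h *s q + snd h *s r) r, - jac \<omega> p (fst h *s q + snd h *s r) q)"
    for p q r and h :: "complex \<times> complex"
  have L: "(chart_field \<omega> p q r has_derivative L p q r) (at 0)" for p q r
  proof -
    have comp: "((\<lambda>h. (p + fst h *s q + snd h *s r) $ i) has_derivative (\<lambda>h. (fst h *s q + snd h *s r) $ i)) (at 0)" for i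
      by (auto intro!: derivative_eq_intros)
    have "((\<lambda>h. form_app \<omega> (p + fst h *s q + snd h *s r) v) has_derivative
       (\<lambda>h. jac \<omega> p (fst h *s q + snd h *s r) v)) (at 0)" for v
      using hpoly_chain[OF hpoly_form_app comp, of v] unfolding jac_def by simp
    then have "((\<lambda>h. (form_app \<omega> (p + fst h *s q + snd h *s r) r, - form_app \<omega> (p + fst h *s q + snd h *s r) q))
       has_derivative L p q r) (at 0)"
      unfolding L_def by (intro has_derivative_Pair has_derivative_minus)
    then show ?thesis by (simp add: chart_field_def case_prod_beta' Let_def)
  qed
  have bij: "bij (L p' q' r') \<longleftrightarrow> (\<forall>w. (\<forall>v. jac \<omega> p' w v = 0) \<longrightarrow> w \<in> s)"
    if p': "p' \<in> s" and d': "det3 p' q' r' \<noteq> 0" for p' q' r'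
  proof -
    have "p' \<noteq> 0" using d' by auto
    then have s': "s = vec.span {p'}"
      using proj_point_eq_span[of s p'] s p' by (simp add: singular_point_def)
    have ex: "\<exists>a b c. x = a *s p' + b *s q' + c *s r'" for x
      using d' span3_iff_det3[of p' q' r'] mem_span3[of x p' q' r'] by auto
    have lin: "linear (L p' q' r')"
      using has_derivative_linear[OF L] .
    have "(\<forall>w. (\<forall>v. jac \<omega> p' w v = 0) \<longrightarrow> w \<in> s) \<longleftrightarrow> (\<forall>h. L p' q' r' h = 0 \<longrightarrow> h = 0)"
    proof safe
      fix a b assume H: "\<forall>w. (\<forall>v. jac \<omega> p' w v = 0) \<longrightarrow> w \<in> s" and "L p' q' r' (a, b) = 0"
      then have e: "jac \<omega> p' (a *s q' + b *s r') r' = 0" "jac \<omega> p' (a *s q' + b *s r') q' = 0"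
        by (auto simp: L_def zero_prod_def)
      have "jac \<omega> p' (a *s q' + b *s r') v = 0" for v
        using ex[of v] e z[OF p'] by (auto simp: jac_add_right jac_scale_right)
      then have "a *s q' + b *s r' \<in> s" using H by blast
      then obtain k where k: "a *s q' + b *s r' = k *s p'" unfolding s' mem_span1 by blast
      have "det3 p' (a *s q' + b *s r') r' = a * det3 p' q' r'" "det3 p' q' (a *s q' + b *s r') = b * det3 p' q' r'"
        by (simp_all add: det3_simps)
      then show "(a, b) = 0" unfolding k using d' by (simp add: det3_simps zero_prod_def)
    next
      fix w assume H: "\<forall>h. L p' q' r' h = 0 \<longrightarrow> h = 0" and w: "\<forall>v. jac \<omega> p' w v = 0"
      obtain a b c where abc: "w = a *s p' + b *s q' + c *s r'" using ex by blast
      have "jac \<omega> p' (b *s q' + c *s r') v = 0" for v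
        using w[rule_format, of v] z[OF p'] unfolding abc by (simp add: jac_add_left jac_scale_left)
      then have "L p' q' r' (b, c) = 0" by (simp add: L_def zero_prod_def)
      then have "b = 0" "c = 0" using H by (auto simp: zero_prod_def)
      then show "w \<in> s" unfolding abc s' by (auto simp: mem_span1)
    qed
    also have "\<dots> \<longleftrightarrow> inj (L p' q' r')" using linear_injective_0[OF lin] by metis
    also have "\<dots> \<longleftrightarrow> bij (L p' q' r')"
      using linear_injective_imp_surjective[OF lin] by (auto simp: bij_def)
    finally show ?thesis ..
  qed
  show ?thesis
  proof
    assume "nondegenerate \<omega> s"
    then obtain p' q' r' L' where *: "p' \<in> s" "vec.span {p', q', r'} = UNIV"
        "(chart_field \<omega> p' q' r' has_derivative L') (at 0)" "bij L'"
      unfolding nondegenerate_def by blast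
    then have d': "det3 p' q' r' \<noteq> 0" using span3_iff_det3 by blast
    have "L' = L p' q' r'" using has_derivative_unique[OF *(3) L] .
    then have H: "\<forall>w. (\<forall>v. jac \<omega> p' w v = 0) \<longrightarrow> w \<in> s" using bij[OF *(1) d'] *(4) by simp
    obtain k where "p' = k *s p" using *(1) unfolding sp mem_span1 by blast
    moreover have "k \<noteq> 0" using d' \<open>p' = k *s p\<close> by auto
    ultimately show "\<forall>w. (\<forall>v. jac \<omega> p w v = 0) \<longrightarrow> w \<in> s"
      using H jac_scale_point by auto
  next
    assume "\<forall>w. (\<forall>v. jac \<omega> p w v = 0) \<longrightarrow> w \<in> s"
    then show "nondegenerate \<omega> s"
      unfolding nondegenerate_def using s p d L bij[OF p d] span3_iff_det3 by blast
  qed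
qed

text \<open>The denominator has a simple zero at \<open>u = 0\<close>, with derivative
  \<open>jac \<omega> p q r\<close>, so the residue is a quotient of two entries of the linear
  part.\<close>

lemma camacho_sad_chart:
  assumes s: "singular_point \<omega> s" and p: "p \<in> s" and nz: "jac \<omega> p q r \<noteq> 0" "jac \<omega> p r q \<noteq> 0"
  shows "(let X = chart_field \<omega> p q r in residue (\<lambda>u. deriv (\<lambda>v. snd (X (u, v))) 0 / fst (X (u, 0))) 0)
    = - jac \<omega> p r q / jac \<omega> p q r"
proof -
  let ?N = "\<lambda>u. - jac \<omega> (p + u *s q) r q" and ?D = "\<lambda>u. form_app \<omega> (p + u *s q) r"
  have N: "deriv (\<lambda>v. snd (chart_field \<omega> p q r (u, v))) 0 = ?N u" for u
    unfolding chart_field_def jac_def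
    by (auto simp: Let_def intro!: DERIV_imp_deriv derivative_eq_intros hpoly_line_derivative_0 hpoly_form_app)
  have D: "fst (chart_field \<omega> p q r (u, 0)) = ?D u" for u
    by (simp add: chart_field_def Let_def)
  have Nh: "?N holomorphic_on UNIV"
    unfolding jac_def
    by (intro holomorphic_on_minus)
       (auto simp: holomorphic_on_open intro!: exI hpoly_line_derivative[OF hpoly_dir_deriv[OF hpoly_form_app]])
  have Dh: "?D holomorphic_on UNIV"
    by (auto simp: holomorphic_on_open intro!: exI hpoly_line_derivative[OF hpoly_form_app])
  have "residue (\<lambda>u. ?N u / ?D u) 0 = ?N 0 / jac \<omega> p q r"
  proof (rule residue_simple_pole_deriv[OF Nh Dh])
    show "(?D has_field_derivative jac \<omega> p q r) (at 0)"
      unfolding jac_def by (rule hpoly_line_derivative_0[OF hpoly_form_app])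
  qed (use nz s p in \<open>auto simp: singular_point_def form_app_zero\<close>)
  then show ?thesis by (simp add: Let_def N D)
qed

text \<open>The definition selects its frame by \<open>SOME\<close>. Passing to another admissible
  frame multiplies numerator and denominator by the same factor \<open>k ^ (m - 1) * a * c\<close>;
  the remaining terms vanish because \<open>jac \<omega> p q q = 0\<close> by invariance of
  \<open>l\<close>.\<close>

lemma camacho_sad_eq:
  assumes l: "invariant_line \<omega> l" and s: "singular_point \<omega> s" and sl: "s \<subseteq> l"
    and p: "p \<in> s" "p \<noteq> 0" and q: "q \<in> l" "q \<notin> s" and r: "r \<notin> l"
    and nz: "jac \<omega> p q r \<noteq> 0" "jac \<omega> p r q \<noteq> 0"
  shows "camacho_sad \<omega> l s = - jac \<omega> p r q / jac \<omega> p q r"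
proof -
  define P where "P = (\<lambda>(p, q, r). p \<in> s \<and> p \<noteq> 0 \<and> q \<in> l \<and> q \<notin> s \<and> r \<notin> l)"
  obtain p1 q1 r1 where e: "(SOME x. P x) = (p1, q1, r1)" by (metis surj_pair)
  have "P (SOME x. P x)" by (rule someI[of P "(p, q, r)"]) (use assms in \<open>auto simp: P_def\<close>)
  then have P1: "p1 \<in> s" "p1 \<noteq> 0" "q1 \<in> l" "q1 \<notin> s" "r1 \<notin> l" unfolding e by (auto simp: P_def)
  have sp: "s = vec.span {p}" using proj_point_eq_span s p by (auto simp: singular_point_def)
  have "l \<in> proj_lines" using l by (auto simp: invariant_line_def)
  then have lf: "l = vec.span {p, q}" "l = {x. det3 p q x = 0}"
    using proj_line_frame[of l p q] p q sl sp by blast+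
  have "det3 p q r \<noteq> 0" using lf(2) r by auto
  then obtain a' b' c where r1: "r1 = a' *s p + b' *s q + c *s r"
    using span3_iff_det3[of p q r] mem_span3[of r1 p q r] by auto
  obtain k where k: "p1 = k *s p" using P1(1) unfolding sp mem_span1 by blast
  obtain b a where q1: "q1 = b *s p + a *s q" using P1(3) unfolding lf(1) mem_span2 by blast
  have k0: "k \<noteq> 0" using k P1(2) by auto
  have a0: "a \<noteq> 0" using P1(4) q1 by (auto simp: sp mem_span1)
  have c0: "c \<noteq> 0" using P1(5) r1 by (auto simp: lf(2) det3_simps)
  have z: "jac \<omega> p p v = 0" "jac \<omega> p w p = 0" for w v
    using p s by (auto simp: jac_euler jac_radial form_app_zero singular_point_def)
  have qq: "jac \<omega> p q q = 0" using jac_line[OF l] p sl q by blast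
  have 1: "jac \<omega> p1 q1 r1 = k ^ (m - 1) * (a * c * jac \<omega> p q r)"
    unfolding k jac_scale_point[OF k0] unfolding q1 r1 by (simp add: jac_bilinear z qq algebra_simps)
  have 2: "jac \<omega> p1 r1 q1 = k ^ (m - 1) * (a * c * jac \<omega> p r q)"
    unfolding k jac_scale_point[OF k0] unfolding q1 r1 by (simp add: jac_bilinear z qq algebra_simps)
  have "camacho_sad \<omega> l s = - jac \<omega> p1 r1 q1 / jac \<omega> p1 q1 r1"
    using camacho_sad_chart[OF s P1(1), of q1 r1] nz k0 a0 c0 e
    unfolding camacho_sad_def P_def by (simp add: 1 2)
  then show ?thesis using k0 a0 c0 by (simp add: 1 2)
qed

text \<open>Since \<open>jac \<omega> p q q = 0\<close>, the matrix of the linear part in the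
  directions \<open>q\<close>, \<open>r\<close> is triangular up to order, and its determinant is
  minus the product of the two entries in the conclusion.\<close>

lemma nondegenerate_jac_nonzero:
  assumes l: "invariant_line \<omega> l" and s: "nondegenerate \<omega> s" and sl: "s \<subseteq> l"
    and p: "p \<in> s" "p \<noteq> 0" and q: "q \<in> l" "q \<notin> s" and r: "r \<notin> l"
  shows "jac \<omega> p q r \<noteq> 0" "jac \<omega> p r q \<noteq> 0"
proof -
  have ss: "singular_point \<omega> s" using s by (simp add: nondegenerate_def)
  have sp: "s = vec.span {p}" using proj_point_eq_span ss p by (auto simp: singular_point_def)
  have "l \<in> proj_lines" using l by (auto simp: invariant_line_def)
  then have lf: "l = vec.span {p, q}" "l = {x. det3 p q x = 0}"
    using proj_line_frame[of l p q] p q sl sp by blast+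
  have d: "det3 p q r \<noteq> 0" using lf(2) r by auto
  have H: "\<forall>w. (\<forall>v. jac \<omega> p w v = 0) \<longrightarrow> w \<in> s" using nondegenerate_iff[OF ss p(1) d] s by simp
  have z: "jac \<omega> p p v = 0" "jac \<omega> p w p = 0" for w v
    using p ss by (auto simp: jac_euler jac_radial form_app_zero singular_point_def)
  have qq: "jac \<omega> p q q = 0" using jac_line[OF l] p sl q by blast
  have ex: "\<exists>a b c. x = a *s p + b *s q + c *s r" for x
    using d span3_iff_det3[of p q r] mem_span3[of x p q r] by auto
  show qr: "jac \<omega> p q r \<noteq> 0"
  proof
    assume "jac \<omega> p q r = 0"
    then have "jac \<omega> p q v = 0" for v using ex[of v] by (auto simp: jac_bilinear z qq)
    then show False using H q by blast
  qed
  show "jac \<omega> p r q \<noteq> 0"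
  proof
    assume rq: "jac \<omega> p r q = 0"
    \<comment> \<open>With this \<open>k\<close> the vector \<open>?w\<close> is annihilated against
      both \<open>q\<close> and \<open>r\<close>, hence lies in the kernel; its
      \<open>r\<close>-component \<open>k\<close> is nonzero, so it lies outside
      \<open>l\<close>.\<close>
    define k where "k = - jac \<omega> p q r"
    let ?w = "jac \<omega> p r r *s q + k *s r"
    have "jac \<omega> p ?w v = 0" for v
      using ex[of v] by (auto simp: jac_bilinear z qq rq) (simp add: k_def)
    then have "?w \<in> s" using H by blast
    then have "?w \<in> l" using sl by blast
    then show False using qr d by (simp add: lf(2) det3_simps k_def)
  qed
qed

end

subsection \<open>Linear differential equations and leaves in invariant lines\<close>

text \<open>Compare orders of vanishing: if \<open>f\<close> had a zero of exact order
  \<open>n > 0\<close> at \<open>t0\<close>, then \<open>u * deriv f\<close> would vanish to order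
  \<open>n - 1\<close> and \<open>k * f\<close> to order at least \<open>n\<close>. The factor
  \<open>u\<close> is allowed to vanish away from \<open>t0\<close>; the identity theorem spreads
  the conclusion over \<open>D\<close>.\<close>

lemma linear_ode_zero:
  assumes D: "open D" "connected D" and f: "f holomorphic_on D" and t0: "t0 \<in> D" "f t0 = 0"
    and u: "continuous_on D u" "u t0 \<noteq> 0" and k: "continuous_on D k"
    and ode: "\<And>t. t \<in> D \<Longrightarrow> u t * deriv f t = k t * f t"
    and t: "t \<in> D"
  shows "f t = (0::complex)"
proof (cases "f constant_on D")
  case True
  then show ?thesis using t0 t unfolding constant_on_def by metis
next
  case False
  obtain g r n where g: "0 < n" "0 < r" "ball t0 r \<subseteq> D" "g holomorphic_on ball t0 r"
      "\<And>w. w \<in> ball t0 r \<Longrightarrow> f w = (w - t0)^n * g w" "\<And>w. w \<in> ball t0 r \<Longrightarrow> g w \<noteq> 0"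
    by (rule holomorphic_factor_zero_nonconstant[OF f D t0 False]) (rule that)
  have df: "deriv f w = (w - t0)^(n - 1) * (of_nat n * g w + (w - t0) * deriv g w)"
    if w: "w \<in> ball t0 r" for w
  proof -
    have dg: "(g has_field_derivative deriv g w) (at w)"
      using g(4) w holomorphic_derivI open_ball by blast
    have dp: "((\<lambda>w. (w - t0)^n) has_field_derivative of_nat n * (w - t0)^(n - 1)) (at w)"
      by (auto intro!: derivative_eq_intros)
    have e: "(w - t0)^n = (w - t0)^(n - 1) * (w - t0)" by (rule power_minus_mult[OF g(1), symmetric])
    have "((\<lambda>w. (w - t0)^n * g w) has_field_derivative
        (w - t0)^(n - 1) * (of_nat n * g w + (w - t0) * deriv g w)) (at w)"
      by (rule DERIV_cong[OF DERIV_mult[OF dp dg]], unfold e) (simp add: algebra_simps)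
    then have "(f has_field_derivative (w - t0)^(n - 1) * (of_nat n * g w + (w - t0) * deriv g w)) (at w)"
      by (rule has_field_derivative_transform_within_open[OF _ open_ball w]) (simp add: g(5))
    then show ?thesis by (rule DERIV_imp_deriv)
  qed
  \<comment> \<open>This is \<open>u * deriv f - k * f\<close> divided by the power
    \<open>n - 1\<close> of \<open>w - t0\<close>. It is zero off \<open>t0\<close>, hence at
    \<open>t0\<close> by continuity, where its value is \<open>n * u t0 * g t0\<close>.\<close>
  define h where "h w = u w * (of_nat n * g w + (w - t0) * deriv g w) - k w * ((w - t0) * g w)" for w
  have cont: "continuous_on (ball t0 r) u" "continuous_on (ball t0 r) k"
    "continuous_on (ball t0 r) g" "continuous_on (ball t0 r) (deriv g)"
    using continuous_on_subset[OF u(1) g(3)] continuous_on_subset[OF k g(3)]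
      holomorphic_on_imp_continuous_on[OF g(4)]
      holomorphic_on_imp_continuous_on[OF holomorphic_deriv[OF g(4) open_ball]] by auto
  have "continuous_on (ball t0 r) h"
    unfolding h_def by (intro continuous_on_diff continuous_on_mult continuous_on_add
        continuous_on_const continuous_on_id cont)
  then have "isCont h t0"
    by (rule continuous_on_interior) (simp add: g(2))
  then have "h \<midarrow>t0\<rightarrow> h t0" by (simp add: isCont_def)
  moreover have "eventually (\<lambda>w. h w = 0) (at t0)"
    unfolding eventually_at
  proof (intro exI[of _ r] conjI ballI impI)
    fix w assume w: "w \<noteq> t0 \<and> dist w t0 < r"
    then have wb: "w \<in> ball t0 r" by (simp add: dist_commute)
    have "(w - t0)^(n - 1) * h w = u w * deriv f w - k w * f w"
      unfolding df[OF wb] g(5)[OF wb] h_def using g(1) by (cases n) (auto simp: algebra_simps)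
    also have "\<dots> = 0" using ode wb g(3) by auto
    finally show "h w = 0" using w by simp
  qed fact
  then have "h \<midarrow>t0\<rightarrow> 0" by (rule tendsto_eventually)
  ultimately have "h t0 = 0" using LIM_unique by blast
  then show ?thesis using u(2) g(1,2) g(6)[of t0] by (simp add: h_def)
qed

lemma frame_expand:
  "det3 e1 e2 e3 = 1 \<Longrightarrow> x = det3 x e2 e3 *s e1 + det3 e1 x e3 *s e2 + det3 e1 e2 x *s e3"
  using cramer3[of e1 e2 e3 x] by simp

lemma hpoly_det3:
  assumes "\<And>i. hpoly a (\<lambda>x. A x $ i)" "\<And>i. hpoly b (\<lambda>x. B x $ i)" "\<And>i. hpoly c (\<lambda>x. C x $ i)"
    and "k = a + b + c"
  shows "hpoly k (\<lambda>x. det3 (A x) (B x) (C x))"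
  unfolding det3_def
  by (intro hpoly_add hpoly_diff hpoly_mult'[OF assms(1)] hpoly_mult'[OF assms(2,3)])
     (simp_all add: assms(4))

lemma hpoly_const_vec: "hpoly 0 (\<lambda>x. v $ i)"
  by (rule hpoly_const)

lemma hpoly_coord': "hpoly (Suc 0) (\<lambda>x. x $ i)"
  using hpoly_coord by simp

lemmas hpoly_det3_args = hpoly_const_vec hpoly_coord'

lemma hpoly_det3_linear:
  "hpoly 1 (\<lambda>x. det3 a b x)" "hpoly 1 (\<lambda>x. det3 a x b)" "hpoly 1 (\<lambda>x. det3 x a b)"
  by (rule hpoly_det3 hpoly_det3_args | simp)+

text \<open>By invariance the values on \<open>e1\<close> and \<open>e2\<close> vanish along
  \<open>l\<close>, hence are divisible by its equation. The value on \<open>e3\<close> is then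
  forced by annihilation of the radial field.\<close>

lemma homogeneous_form_line_components:
  assumes hom: "homogeneous_form (Suc d) \<omega>" and l: "invariant_line \<omega> l"
    and e: "det3 e1 e2 e3 = 1" "e1 \<in> l" "e2 \<in> l" "l = {x. det3 e1 e2 x = 0}"
  obtains A B where "hpoly d A" "hpoly d B"
    "\<And>x v. form_app \<omega> x v = det3 e1 e2 x * (A x * det3 v e2 e3 + B x * det3 e1 v e3)
        - (A x * det3 x e2 e3 + B x * det3 e1 x e3) * det3 e1 e2 v"
proof -
  have a0: "cross e1 e2 \<noteq> 0" using e(1) sum_cross[of e1 e2 e3] by auto
  have ex: "\<exists>A. hpoly d A \<and> (\<forall>x. form_app \<omega> x v = det3 e1 e2 x * A x)" if v: "v \<in> l" for v
  proof -
    have "form_app \<omega> x v = 0" if "(\<Sum>i\<in>UNIV. cross e1 e2 $ i * x $ i) = 0" for x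
      using that l v unfolding sum_cross e(4) invariant_line_def by auto
    then obtain g where "hpoly (Suc d - 1) g" "\<And>x. form_app \<omega> x v = (\<Sum>i\<in>UNIV. cross e1 e2 $ i * x $ i) * g x"
      using hpoly_divides_linear[OF hpoly_form_app[OF hom] a0, of v] by blast
    then show ?thesis unfolding sum_cross by auto
  qed
  obtain A where A: "hpoly d A" "\<And>x. form_app \<omega> x e1 = det3 e1 e2 x * A x" using ex[OF e(2)] by blast
  obtain B where B: "hpoly d B" "\<And>x. form_app \<omega> x e2 = det3 e1 e2 x * B x" using ex[OF e(3)] by blast
  let ?C = "\<lambda>x. A x * det3 x e2 e3 + B x * det3 e1 x e3"
  have "hpoly (Suc d) (\<lambda>x. ?C x + form_app \<omega> x e3)"
    by (intro hpoly_add hpoly_mult'[OF A(1) hpoly_det3_linear(3)] hpoly_mult'[OF B(1) hpoly_det3_linear(2)]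
        hpoly_form_app[OF hom]) simp_all
  then have lp: "linepoly (\<lambda>x. ?C x + form_app \<omega> x e3)" by (rule linepoly_hpoly)
  have prod: "det3 e1 e2 x * (?C x + form_app \<omega> x e3) = 0" for x
  proof -
    have "0 = form_app \<omega> x (det3 x e2 e3 *s e1 + det3 e1 x e3 *s e2 + det3 e1 e2 x *s e3)"
      using form_app_self[OF hom, of x] frame_expand[OF e(1), of x] by simp
    also have "\<dots> = det3 e1 e2 x * (?C x + form_app \<omega> x e3)"
      by (simp only: form_app_add form_app_scale A(2) B(2)) (simp add: algebra_simps)
    finally show ?thesis by simp
  qed
  \<comment> \<open>The equation of the line is cancelled from \<open>prod\<close>, which gives the
    identity on the line as well.\<close>
  have C: "?C x + form_app \<omega> x e3 = 0" for x
    by (rule linepoly_cancel[OF linepoly_hpoly[OF hpoly_det3_linear(1)] lp prod, of e3]) (simp add: e(1))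
  have "form_app \<omega> x v = det3 e1 e2 x * (A x * det3 v e2 e3 + B x * det3 e1 v e3) - ?C x * det3 e1 e2 v" for x v
  proof -
    have "form_app \<omega> x v = form_app \<omega> x (det3 v e2 e3 *s e1 + det3 e1 v e3 *s e2 + det3 e1 e2 v *s e3)"
      using frame_expand[OF e(1), of v] by simp
    also have "\<dots> = det3 e1 e2 x * (A x * det3 v e2 e3 + B x * det3 e1 v e3) + form_app \<omega> x e3 * det3 e1 e2 v"
      by (simp only: form_app_add form_app_scale A(2) B(2)) (simp add: algebra_simps)
    also have "form_app \<omega> x e3 = - ?C x" using C[of x] by (metis add.commute eq_neg_iff_add_eq_0)
    finally show ?thesis by (simp add: algebra_simps)
  qed
  then show thesis using that A(1) B(1) by blast
qed

lemma hpoly_curve_holomorphic: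
  assumes "hpoly n f" "\<And>i. (\<lambda>z. \<gamma> z $ i) holomorphic_on D"
  shows "(\<lambda>z. f (\<gamma> z)) holomorphic_on D"
  using assms(1)
  by (induction n f rule: hpoly.induct) (auto intro!: holomorphic_intros assms(2))

lemma curve_deriv_derivative:
  assumes "open D" "\<And>i. (\<lambda>z. \<gamma> z $ i) holomorphic_on D" "t \<in> D"
  shows "((\<lambda>z. \<gamma> z $ i) has_field_derivative curve_deriv \<gamma> t $ i) (at t)"
  using holomorphic_derivI[OF assms(2,1,3), of i] by (simp add: curve_deriv_def)

lemma curve_deriv_holomorphic:
  assumes "open D" "\<And>i. (\<lambda>z. \<gamma> z $ i) holomorphic_on D"
  shows "(\<lambda>z. curve_deriv \<gamma> z $ i) holomorphic_on D"
  using holomorphic_deriv[OF assms(2,1)] by (simp add: curve_deriv_def)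

text \<open>The coordinate transverse to \<open>l\<close> satisfies a linear differential equation
  along the curve. Its leading coefficient is nonzero at \<open>t0\<close> because an integral curve
  avoids the singular points.\<close>

lemma integral_curve_in_line:
  assumes hom: "homogeneous_form m \<omega>" and l: "invariant_line \<omega> l" and \<gamma>: "integral_curve \<omega> D \<gamma>"
    and t0: "t0 \<in> D" "\<gamma> t0 \<in> l" and t: "t \<in> D"
  shows "\<gamma> t \<in> l"
proof -
  obtain e1 e2 e3 where e: "det3 e1 e2 e3 = 1" "l = vec.span {e1, e2}" "l = {x. det3 e1 e2 x = 0}"
    using proj_line_basis l unfolding invariant_line_def by metis
  have el: "e1 \<in> l" "e2 \<in> l" unfolding e(3) by simp_all
  have D: "open D" "connected D" and h: "\<And>i. (\<lambda>z. \<gamma> z $ i) holomorphic_on D"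
    and I: "\<And>t. t \<in> D \<Longrightarrow> \<omega> (\<gamma> t) \<noteq> 0 \<and> form_app \<omega> (\<gamma> t) (curve_deriv \<gamma> t) = 0"
    using \<gamma> unfolding integral_curve_def by auto
  \<comment> \<open>A form with constant coefficients that kills the radial field is zero, which a
    curve through nonsingular points excludes.\<close>
  have "m \<noteq> 0"
  proof
    assume "m = 0"
    then have "form_app \<omega> x v = form_app \<omega> v v" for x v
      using hpoly_degree_0[OF hpoly_form_app[OF hom]] by blast
    then have "form_app \<omega> x v = 0" for x v using form_app_self[OF hom] by simp
    then show False using I[OF t0(1)] form_app_eq_0_imp[OF hom, of e1 e2 e3] e(1) by simp
  qed
  then obtain d where "m = Suc d" by (cases m) auto
  then obtain A B where AB: "hpoly d A" "hpoly d B" and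
    F: "\<And>x v. form_app \<omega> x v = det3 e1 e2 x * (A x * det3 v e2 e3 + B x * det3 e1 v e3)
        - (A x * det3 x e2 e3 + B x * det3 e1 x e3) * det3 e1 e2 v"
    using homogeneous_form_line_components[of d \<omega> l e1 e2 e3] hom l e(1,3) el by metis
  let ?C = "\<lambda>x. A x * det3 x e2 e3 + B x * det3 e1 x e3"
  have Chp: "hpoly (Suc d) ?C"
    by (intro hpoly_add hpoly_mult'[OF AB(1) hpoly_det3_linear(3)] hpoly_mult'[OF AB(2) hpoly_det3_linear(2)]) simp_all
  let ?f = "\<lambda>t. det3 e1 e2 (\<gamma> t)"
  let ?k = "\<lambda>t. A (\<gamma> t) * det3 (curve_deriv \<gamma> t) e2 e3 + B (\<gamma> t) * det3 e1 (curve_deriv \<gamma> t) e3"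
  have hf: "?f holomorphic_on D"
    by (rule hpoly_curve_holomorphic[OF hpoly_det3_linear(1) h])
  have df: "deriv ?f t = det3 e1 e2 (curve_deriv \<gamma> t)" if "t \<in> D" for t
    unfolding det3_def
    by (rule DERIV_imp_deriv) (auto intro!: derivative_eq_intros curve_deriv_derivative[OF D(1) h that] simp: mult.commute)
  have "?f t = 0"
  proof (rule linear_ode_zero[OF D hf t0(1) _ _ _ _ _ t])
    show "?f t0 = 0" using t0(2) unfolding e(3) by simp
    show "continuous_on D (\<lambda>t. ?C (\<gamma> t))"
      by (intro holomorphic_on_imp_continuous_on hpoly_curve_holomorphic[OF Chp h])
    show "continuous_on D ?k"
      by (intro holomorphic_on_imp_continuous_on holomorphic_intros
          hpoly_curve_holomorphic[OF AB(1) h] hpoly_curve_holomorphic[OF AB(2) h]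
          hpoly_curve_holomorphic[OF hpoly_det3_linear(3) curve_deriv_holomorphic[OF D(1) h]]
          hpoly_curve_holomorphic[OF hpoly_det3_linear(2) curve_deriv_holomorphic[OF D(1) h]])
    show "?C (\<gamma> t0) \<noteq> 0"
    proof
      assume "?C (\<gamma> t0) = 0"
      then have "form_app \<omega> (\<gamma> t0) v = 0" for v using F[of "\<gamma> t0" v] t0(2) unfolding e(3) by simp
      then show False using I[OF t0(1)] form_app_eq_0_imp[OF hom, of e1 e2 e3] e(1) by simp
    qed
    show "?C (\<gamma> t) * deriv ?f t = ?k t * ?f t" if "t \<in> D" for t
      using I[OF that] F[of "\<gamma> t" "curve_deriv \<gamma> t"] unfolding df[OF that] by (simp add: mult.commute)
  qed
  then show ?thesis unfolding e(3) by simp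
qed

lemma straight_leafI:
  assumes hom: "homogeneous_form m \<omega>" and l: "invariant_line \<omega> l" and s: "s \<subseteq> l"
  shows "straight_leaf \<omega> s"
proof -
  have sub: "vec.subspace l" using l by (simp add: invariant_line_def proj_lines_def)
  have "s' \<subseteq> l" if "(joined \<omega>)\<^sup>*\<^sup>* s s'" for s'
    using that
  proof (induction rule: rtranclp_induct)
    case base
    show ?case by (rule s)
  next
    case (step s' s'')
    then obtain D \<gamma> t t' where *: "integral_curve \<omega> D \<gamma>" "t \<in> D" "t' \<in> D"
        "s' = vec.span {\<gamma> t}" "s'' = vec.span {\<gamma> t'}"
      unfolding joined_def by blast
    have "\<gamma> t \<in> l" using step.IH *(4) vec.span_base[of "\<gamma> t" "{\<gamma> t}"] by auto
    then have "\<gamma> t' \<in> l" using integral_curve_in_line[OF hom l *(1,2) _ *(3)] by blast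
    then show ?case unfolding *(5) by (intro vec.span_minimal sub) simp
  qed
  then show ?thesis using l unfolding straight_leaf_def leaf_def invariant_line_def by auto
qed

lemma jac_eq_sum:
  assumes hom: "homogeneous_form m \<omega>"
  shows "jac \<omega> p w v = (\<Sum>i\<in>UNIV. dir_deriv (\<lambda>x. \<omega> x $ i) p w * v $ i)"
proof -
  have "\<And>i. hpoly m (\<lambda>x. \<omega> x $ i)" using hom by (simp add: homogeneous_form_def)
  from hpoly_line_derivative_0[OF this] show ?thesis
    unfolding jac_def form_app_def
    by (intro dir_deriv_eqI DERIV_sum DERIV_cmult_right)
qed

text \<open>Differentiating the tangency condition along the curve gives
  \<open>jac \<omega> \<gamma> \<gamma>' \<gamma>'\<close> plus the value of the form on the second
  derivative. At an inflection point the latter is 0, since the form kills both the position and the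
  tangent vector.\<close>

lemma inflection_pointE:
  assumes hom: "homogeneous_form m \<omega>" and "inflection_point \<omega> s"
  obtains x w where "s = vec.span {x}" "x \<noteq> 0" "w \<notin> vec.span {x}" "form_app \<omega> x w = 0" "jac \<omega> x w w = 0"
proof -
  from assms(2) obtain D \<gamma> t where *: "integral_curve \<omega> D \<gamma>" "t \<in> D" "s = vec.span {\<gamma> t}"
      "curve_deriv (curve_deriv \<gamma>) t \<in> vec.span {\<gamma> t, curve_deriv \<gamma> t}"
    unfolding inflection_point_def by blast
  let ?w = "curve_deriv \<gamma> t" and ?v = "curve_deriv (curve_deriv \<gamma>) t"
  have D: "open D" and h: "\<And>i. (\<lambda>z. \<gamma> z $ i) holomorphic_on D"
    and I: "\<And>t. t \<in> D \<Longrightarrow> \<gamma> t \<noteq> 0 \<and> curve_deriv \<gamma> t \<notin> vec.span {\<gamma> t} \<and> form_app \<omega> (\<gamma> t) (curve_deriv \<gamma> t) = 0"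
    using *(1) unfolding integral_curve_def by auto
  have h': "(\<lambda>z. curve_deriv \<gamma> z $ i) holomorphic_on D" for i
    by (rule curve_deriv_holomorphic[OF D h])
  have hp: "hpoly m (\<lambda>x. \<omega> x $ i)" for i using hom by (simp add: homogeneous_form_def)
  have "((\<lambda>z. form_app \<omega> (\<gamma> z) (curve_deriv \<gamma> z)) has_field_derivative
      (\<Sum>i\<in>UNIV. dir_deriv (\<lambda>x. \<omega> x $ i) (\<gamma> t) ?w * ?w $ i + ?v $ i * \<omega> (\<gamma> t) $ i)) (at t)"
    unfolding form_app_def
    by (intro DERIV_sum DERIV_mult hpoly_chain_field[OF hp] curve_deriv_derivative[OF D] h h' *(2))
  then have "((\<lambda>z. 0) has_field_derivative
      (\<Sum>i\<in>UNIV. dir_deriv (\<lambda>x. \<omega> x $ i) (\<gamma> t) ?w * ?w $ i + ?v $ i * \<omega> (\<gamma> t) $ i)) (at t)"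
    by (rule has_field_derivative_transform_within_open[OF _ D *(2)]) (use I in auto)
  then have "(\<Sum>i\<in>UNIV. dir_deriv (\<lambda>x. \<omega> x $ i) (\<gamma> t) ?w * ?w $ i + ?v $ i * \<omega> (\<gamma> t) $ i) = 0"
    using DERIV_unique DERIV_const by blast
  then have "jac \<omega> (\<gamma> t) ?w ?w + form_app \<omega> (\<gamma> t) ?v = 0"
    unfolding jac_eq_sum[OF hom] form_app_def by (simp add: sum.distrib mult.commute)
  moreover have "form_app \<omega> (\<gamma> t) ?v = 0"
    using *(4) I[OF *(2)] form_app_self[OF hom] unfolding mem_span2 by (auto simp: form_app_add form_app_scale)
  ultimately show thesis using that[of "\<gamma> t" ?w] I[OF *(2)] *(3) by auto
qed

subsection \<open>The inflection polynomial\<close>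

definition vec_deriv :: "(complex^3 \<Rightarrow> complex^3) \<Rightarrow> complex^3 \<Rightarrow> complex^3 \<Rightarrow> complex^3" where
  "vec_deriv Z x w = (\<chi> j. dir_deriv (\<lambda>x. Z x $ j) x w)"

text \<open>The form is the contraction of the volume form with the radial field and
  \<open>Z\<close>. Adding to \<open>Z\<close> a multiple of \<open>x\<close> by a homogeneous
  polynomial of degree \<open>d - 1\<close> gives the same form.\<close>

definition tangent_field :: "nat \<Rightarrow> one_form \<Rightarrow> (complex^3 \<Rightarrow> complex^3) \<Rightarrow> bool" where
  "tangent_field d \<omega> Z \<longleftrightarrow> (\<forall>j. hpoly d (\<lambda>x. Z x $ j)) \<and> (\<forall>x v. form_app \<omega> x v = det3 x (Z x) v)"

text \<open>The second derivative of a solution of \<open>x' = Z x\<close>. The determinant of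
  \<open>x\<close>, \<open>x'\<close>, \<open>x''\<close> tests for inflection.\<close>

definition accel :: "(complex^3 \<Rightarrow> complex^3) \<Rightarrow> complex^3 \<Rightarrow> complex^3" where
  "accel Z x = vec_deriv Z x (Z x)"

definition inflection_poly :: "(complex^3 \<Rightarrow> complex^3) \<Rightarrow> complex^3 \<Rightarrow> complex" where
  "inflection_poly Z x = det3 x (Z x) (accel Z x)"

lemma hpoly_zero_by_continuity:
  assumes f: "hpoly n f" and z: "\<And>s. s \<noteq> 0 \<Longrightarrow> f (x + s *s w) = 0"
  shows "f x = 0"
proof -
  obtain P where P: "\<And>t. f (x + t *s w) = poly P t"
    using linepoly_hpoly[OF f] unfolding linepoly_def by metis
  have "infinite (UNIV - {0::complex})"
    using infinite_UNIV_char_0 by (rule infinite_remove)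
  moreover have "UNIV - {0} \<subseteq> {t. poly P t = 0}" using z P by auto
  ultimately have "infinite {t. poly P t = 0}" using finite_subset by blast
  then have "P = 0" using poly_roots_finite by blast
  then show ?thesis using P[of 0] by simp
qed

context
  fixes d :: nat and Z :: "complex^3 \<Rightarrow> complex^3"
  assumes Z: "\<And>j. hpoly d (\<lambda>x. Z x $ j)"
begin

lemma vec_deriv_add: "vec_deriv Z x (v + w) = vec_deriv Z x v + vec_deriv Z x w"
  by (simp add: vec_deriv_def vec_eq_iff hpoly_dir_deriv_add[OF Z])

lemma vec_deriv_scale: "vec_deriv Z x (c *s w) = c *s vec_deriv Z x w"
  by (simp add: vec_deriv_def vec_eq_iff hpoly_dir_deriv_scale[OF Z])

lemma vec_deriv_zero: "vec_deriv Z x 0 = 0"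
  using vec_deriv_scale[of x 0 0] by simp

lemma vec_deriv_euler: "vec_deriv Z x x = of_nat d *s Z x"
  by (simp add: vec_deriv_def vec_eq_iff hpoly_euler[OF Z])

lemma field_line_derivative:
  "((\<lambda>t. Z (x + t *s w) $ j) has_field_derivative vec_deriv Z (x + t *s w) w $ j) (at t)"
  unfolding vec_deriv_def by (simp add: hpoly_line_derivative[OF Z])

lemma field_line_derivative_0:
  "((\<lambda>t. Z (x + t *s w) $ j) has_field_derivative vec_deriv Z x w $ j) (at 0)"
  using field_line_derivative[of x w j 0] by simp

lemma hpoly_vec_deriv: "hpoly (d - 1) (\<lambda>x. vec_deriv Z x w $ j)"
  unfolding vec_deriv_def vec_lambda_beta by (rule hpoly_dir_deriv[OF Z])

lemma hpoly_accel: "hpoly (d - 1 + d) (\<lambda>x. accel Z x $ j)"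
  unfolding vec_deriv_def accel_def by (simp add: hpoly_dir_deriv_vector[OF Z Z])

lemma hpoly_inflection_poly: "d > 0 \<Longrightarrow> hpoly (3 * d) (inflection_poly Z)"
  unfolding inflection_poly_def by (rule hpoly_det3[OF hpoly_coord' Z hpoly_accel]) simp

lemma field_scale: "Z (c *s x) = c ^ d *s Z x"
  by (simp add: vec_eq_iff hpoly_scale[OF Z])

lemma det3_field_line_derivative:
  "((\<lambda>t. det3 a b (Z (x + t *s w))) has_field_derivative det3 a b (vec_deriv Z (x + t *s w) w)) (at t)"
  unfolding det3_def
  by (auto intro!: derivative_eq_intros field_line_derivative simp: algebra_simps)

text \<open>The second derivatives of \<open>Z\<close> are multiplied by \<open>Z p = 0\<close>, so
  the derivative at \<open>p\<close> is the square of \<open>vec_deriv Z p\<close>.\<close>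

lemma accel_derivative:
  assumes "Z p = 0"
  shows "dir_deriv (\<lambda>x. accel Z x $ j) p w = vec_deriv Z p (vec_deriv Z p w) $ j"
proof -
  obtain g where g: "\<And>k. hpoly (d - 1) (g k)"
      "\<And>x w. dir_deriv (\<lambda>x. Z x $ j) x w = (\<Sum>k\<in>UNIV. g k x * w $ k)"
    using hpoly_dir_deriv_gradient[OF Z[of j]] by metis
  have "((\<lambda>t. \<Sum>k\<in>UNIV. g k (p + t *s w) * Z (p + t *s w) $ k) has_field_derivative
      (\<Sum>k\<in>UNIV. dir_deriv (g k) p w * Z (p + 0 *s w) $ k + vec_deriv Z p w $ k * g k (p + 0 *s w))) (at 0)"
    by (intro DERIV_sum DERIV_mult hpoly_line_derivative_0[OF g(1)] field_line_derivative_0)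
  then have "((\<lambda>t. accel Z (p + t *s w) $ j) has_field_derivative
      (\<Sum>k\<in>UNIV. g k p * vec_deriv Z p w $ k)) (at 0)"
    by (simp add: accel_def vec_deriv_def g(2) assms mult.commute)
  then show ?thesis by (subst dir_deriv_eqI) (simp_all add: vec_deriv_def g(2))
qed

end

lemma det3_in_plane:
  assumes n: "det3 p q r \<noteq> 0" and "det3 p q x = 0" "det3 p q y = 0" "det3 p q z = 0"
  shows "det3 x y z = 0"
proof -
  have "\<exists>a b. v = a *s p + b *s q" if "det3 p q v = 0" for v
    using that span2_proj_line(2)[OF n] mem_span2[of v p q] by blast
  then obtain a b a' b' a'' b'' where "x = a *s p + b *s q" "y = a' *s p + b' *s q" "z = a'' *s p + b'' *s q"
    using assms(2-4) by metis
  then show ?thesis by (simp add: det3_simps det3_swap[of p q])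
qed

lemma tangent_field_line:
  assumes T: "tangent_field d \<omega> Z" and d: "d > 0" and l: "invariant_line \<omega> l"
    and e: "det3 e1 e2 e3 = 1" "l = {x. det3 e1 e2 x = 0}" and x: "x \<in> l"
  shows "Z x \<in> l"
proof (cases "x = 0")
  case True
  have Z: "\<And>j. hpoly d (\<lambda>x. Z x $ j)" using T by (simp add: tangent_field_def)
  show ?thesis using field_scale[OF Z, of 0 0] d unfolding e(2) True by (simp add: power_0_left)
next
  case False
  obtain a b where xe: "x = a *s e1 + b *s e2"
    using frame_expand[OF e(1), of x] x unfolding e(2) by auto
  have "e1 \<in> l" "e2 \<in> l" unfolding e(2) by simp_all
  then have "det3 x (Z x) e1 = 0" "det3 x (Z x) e2 = 0"
    using l x T unfolding invariant_line_def tangent_field_def by metis+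
  moreover have "det3 x z e1 = b * det3 e2 z e1" "det3 x z e2 = a * det3 e1 z e2" for z
    by (simp_all add: xe det3_simps)
  ultimately have "b * det3 e1 e2 (Z x) = 0" "a * det3 e1 e2 (Z x) = 0"
    using det3_cycle[of e2 "Z x" e1] det3_swap(2)[of e1 "Z x" e2] by auto
  moreover have "a \<noteq> 0 \<or> b \<noteq> 0" using xe False by force
  ultimately show ?thesis unfolding e(2) by auto
qed

text \<open>The field maps \<open>l\<close> into itself, so its derivative along a direction of
  \<open>l\<close> stays in \<open>l\<close>; this puts \<open>accel Z x\<close> there, and any
  three vectors of the plane \<open>l\<close> are dependent.\<close>

lemma tangent_field_line_vanish:
  assumes T: "tangent_field d \<omega> Z" and d: "d > 0" and l: "invariant_line \<omega> l" and x: "x \<in> l"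
  shows "Z x \<in> l" "accel Z x \<in> l" "\<And>u v w. u \<in> l \<Longrightarrow> v \<in> l \<Longrightarrow> w \<in> l \<Longrightarrow> det3 u v w = 0"
proof -
  have "l \<in> proj_lines" using l by (simp add: invariant_line_def)
  then obtain e1 e2 e3 where e: "det3 e1 e2 e3 = 1" "l = {x. det3 e1 e2 x = 0}"
    using proj_line_basis by metis
  note Zl = tangent_field_line[OF T d l e]
  have Z: "\<And>j. hpoly d (\<lambda>x. Z x $ j)" using T by (simp add: tangent_field_def)
  show Zx: "Z x \<in> l" using Zl[OF x] .
  have "x + t *s Z x \<in> l" for t using x Zx unfolding e(2) by (simp add: det3_simps)
  then have "det3 e1 e2 (Z (x + t *s Z x)) = 0" for t using Zl unfolding e(2) by simp
  then have "((\<lambda>t. 0) has_field_derivative det3 e1 e2 (accel Z x)) (at 0)"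
    using det3_field_line_derivative[OF Z, of e1 e2 x "Z x" 0] by (simp add: accel_def)
  then have "det3 e1 e2 (accel Z x) = 0" using DERIV_unique DERIV_const by blast
  then show "accel Z x \<in> l" unfolding e(2) by simp
  show "det3 u v w = 0" if "u \<in> l" "v \<in> l" "w \<in> l" for u v w
    using det3_in_plane[of e1 e2 e3 u v w] that e by simp
qed

lemma hpoly_continuous_line: "hpoly n f \<Longrightarrow> continuous_on UNIV (\<lambda>t. f (x + t *s w))"
  using hpoly_line_derivative[of n f x w] by (meson DERIV_continuous continuous_at_imp_continuous_on)

text \<open>If the inflection polynomial vanishes identically, the transverse component \<open>h\<close> of the field
  along the tangent line through \<open>x\<close> solves a linear differential equation with \<open>h 0 = 0\<close>.\<close>

lemma tangent_line_invariant:
  assumes T: "tangent_field d \<omega> Z" and d: "d > 0" and E: "\<And>x. inflection_poly Z x = 0"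
    and x: "x \<noteq> 0" "Z x \<notin> vec.span {x}"
  shows "invariant_line \<omega> (vec.span {x, Z x})"
proof -
  have Z: "\<And>j. hpoly d (\<lambda>x. Z x $ j)" using T by (simp add: tangent_field_def)
  define w where "w = Z x"
  obtain n where n: "det3 x w n = 1" using det3_nonzeroI x unfolding w_def by blast
  define y where "y t = x + t *s w" for t
  define \<alpha> where "\<alpha> t = det3 (Z (y t)) w n" for t
  define \<beta> where "\<beta> t = det3 x (Z (y t)) n" for t
  define h where "h t = det3 x w (Z (y t))" for t
  define \<kappa> where "\<kappa> t = of_nat d * \<alpha> t + det3 x w (vec_deriv Z (y t) n)" for t
  define v where "v t = accel Z (y t)" for t
  have h': "(h has_field_derivative det3 x w (vec_deriv Z (y t) w)) (at t)" for t
    unfolding h_def y_def by (rule det3_field_line_derivative[OF Z])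
  have Zy: "Z (y t) = \<alpha> t *s x + \<beta> t *s w + h t *s n" for t
    unfolding \<alpha>_def \<beta>_def h_def by (rule frame_expand[OF n])
  \<comment> \<open>Euler's relation at \<open>y t\<close> trades the derivative along
    \<open>x\<close> for \<open>Z\<close> itself and the derivative along \<open>w\<close>, whose
    transverse component is the derivative of \<open>h\<close>.\<close>
  have vd: "vec_deriv Z (y t) x = of_nat d *s Z (y t) - t *s vec_deriv Z (y t) w" for t
  proof -
    have "of_nat d *s Z (y t) = vec_deriv Z (y t) (x + t *s w)"
      using vec_deriv_euler[OF Z, of "y t"] unfolding y_def by simp
    then show ?thesis by (simp add: vec_deriv_add[OF Z] vec_deriv_scale[OF Z])
  qed
  have vt: "det3 x w (v t) = (\<beta> t - t * \<alpha> t) * deriv h t + h t * \<kappa> t" for t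
  proof -
    have vt: "v t = \<alpha> t *s vec_deriv Z (y t) x + \<beta> t *s vec_deriv Z (y t) w + h t *s vec_deriv Z (y t) n"
      by (simp only: v_def accel_def Zy vec_deriv_add[OF Z] vec_deriv_scale[OF Z])
    have 1: "det3 x w (vec_deriv Z (y t) x) = of_nat d * h t - t * deriv h t"
      unfolding vd DERIV_imp_deriv[OF h'] by (simp add: det3_simps h_def)
    have "det3 x w (v t) = \<alpha> t * det3 x w (vec_deriv Z (y t) x)
        + \<beta> t * deriv h t + h t * det3 x w (vec_deriv Z (y t) n)"
      unfolding vt DERIV_imp_deriv[OF h'] by (simp only: det3_simps)
    then show ?thesis unfolding 1 \<kappa>_def by (simp add: algebra_simps)
  qed
  \<comment> \<open>One factor \<open>\<beta> t - t * \<alpha> t\<close> comes from expanding the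
    determinant at \<open>y t\<close>, the other from \<open>vt\<close>, hence the square. Its value
    at \<open>t = 0\<close> is 1, which is all that \<open>linear_ode_zero\<close> asks of
    it.\<close>
  have "(\<beta> t - t * \<alpha> t)\<^sup>2 * deriv h t
      = ((det3 x (v t) n - t * det3 (v t) w n) - (\<beta> t - t * \<alpha> t) * \<kappa> t) * h t" for t
  proof -
    have "0 = det3 (1 *s x + t *s w + 0 *s n) (\<alpha> t *s x + \<beta> t *s w + h t *s n)
        (det3 (v t) w n *s x + det3 x (v t) n *s w + det3 x w (v t) *s n)"
      using E[of "y t"] frame_expand[OF n, of "v t"] Zy[of t] unfolding inflection_poly_def v_def y_def by simp
    also have "\<dots> = (\<beta> t - t * \<alpha> t) * det3 x w (v t) - h t * (det3 x (v t) n - t * det3 (v t) w n)"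
      unfolding det3_expand by (simp add: n algebra_simps)
    finally show ?thesis unfolding vt by (simp add: power2_eq_square algebra_simps)
  qed
  note ode = this
  have hp3: "hpoly d (\<lambda>z. det3 (Z z) w n)" "hpoly d (\<lambda>z. det3 x (Z z) n)"
    "hpoly (d - 1) (\<lambda>z. det3 x w (vec_deriv Z z n))"
    "hpoly (d - 1 + d) (\<lambda>z. det3 x (accel Z z) n)" "hpoly (d - 1 + d) (\<lambda>z. det3 (accel Z z) w n)"
    by (rule hpoly_det3, (rule Z hpoly_vec_deriv[OF Z] hpoly_accel[OF Z] hpoly_const_vec)+, simp)+
  have cont: "continuous_on UNIV \<alpha>" "continuous_on UNIV \<beta>" "continuous_on UNIV \<kappa>"
    "continuous_on UNIV (\<lambda>t. det3 x (v t) n)" "continuous_on UNIV (\<lambda>t. det3 (v t) w n)"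
    unfolding \<alpha>_def \<beta>_def \<kappa>_def v_def y_def
    by (intro continuous_on_add continuous_on_mult continuous_on_const hpoly_continuous_line[OF hp3(1)]
        hpoly_continuous_line[OF hp3(2)] hpoly_continuous_line[OF hp3(3)]
        hpoly_continuous_line[OF hp3(4)] hpoly_continuous_line[OF hp3(5)])+
  have y0: "y 0 = x" by (simp add: y_def)
  have h0: "h t = 0" for t
  proof (rule linear_ode_zero[OF open_UNIV connected_UNIV _ UNIV_I[of 0] _ _ _ _ ode UNIV_I])
    show "h holomorphic_on UNIV" using h' by (auto simp: holomorphic_on_open)
    show "h 0 = 0" by (simp add: h_def y0 w_def)
    show "continuous_on UNIV (\<lambda>t. (\<beta> t - t * \<alpha> t)\<^sup>2)"
      by (intro continuous_intros cont)
    show "(\<beta> 0 - 0 * \<alpha> 0)\<^sup>2 \<noteq> 0" using n by (simp add: \<beta>_def y0 w_def)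
    show "continuous_on UNIV (\<lambda>t. (det3 x (v t) n - t * det3 (v t) w n) - (\<beta> t - t * \<alpha> t) * \<kappa> t)"
      by (intro continuous_intros cont)
  qed
  have nz: "det3 x w n \<noteq> 0" using n by simp
  have hp: "hpoly d (\<lambda>z. det3 x w (Z z))"
    by (rule hpoly_det3[OF hpoly_const_vec hpoly_const_vec Z]) simp
  have 1: "det3 x w (Z (a *s x + b *s w)) = 0" if "a \<noteq> 0" for a b
  proof -
    have "a *s x + b *s w = a *s y (b / a)" using that by (simp add: y_def vector_add_ldistrib vector_smult_assoc)
    then show ?thesis using h0[of "b / a"] by (simp add: field_scale[OF Z] det3_simps h_def)
  qed
  \<comment> \<open>The multiples of \<open>w\<close> form the point at infinity of the
    parametrization \<open>y\<close>, reached by continuity.\<close>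
  have 2: "det3 x w (Z (a *s x + b *s w)) = 0" for a b
  proof (cases "a = 0")
    case True
    have "det3 x w (Z (b *s w)) = 0"
      by (rule hpoly_zero_by_continuity[OF hp, of _ x]) (use 1 in \<open>simp add: add.commute\<close>)
    then show ?thesis using True by simp
  qed (use 1 in simp)
  show ?thesis unfolding invariant_line_def w_def[symmetric]
  proof (intro conjI ballI)
    show "vec.span {x, w} \<in> proj_lines" using span2_proj_line(1)[OF nz] .
    fix u v assume "u \<in> vec.span {x, w}" "v \<in> vec.span {x, w}"
    then have "det3 x w u = 0" "det3 x w v = 0" "det3 x w (Z u) = 0"
      unfolding mem_span2 using 2 by (auto simp: det3_simps)
    then have "det3 u (Z u) v = 0" using det3_in_plane[OF nz] by blast
    then show "form_app \<omega> u v = 0" using T by (simp add: tangent_field_def)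
  qed
qed

lemma infinite_proj_points: "infinite (proj_points :: (complex^3) set set)"
proof
  assume fin: "finite (proj_points :: (complex^3) set set)"
  let ?f = "\<lambda>t::complex. vec.span {vector [1, t, 0] :: complex^3}"
  have nz: "(vector [1, t, 0] :: complex^3) \<noteq> 0" for t :: complex
    by (simp add: vec_eq_iff forall_3)
  have "inj ?f"
  proof (rule injI)
    fix s t assume "?f s = ?f t"
    then have "(vector [1, s, 0] :: complex^3) \<in> ?f t" using vec.span_base by blast
    then obtain a where "(vector [1, s, 0] :: complex^3) = a *s vector [1, t, 0]" by (auto simp: mem_span1)
    then show "s = t" by (simp add: vec_eq_iff forall_3)
  qed
  moreover have "range ?f \<subseteq> proj_points" unfolding image_subset_iff proj_points_iff using nz by blast
  ultimately show False
    using fin infinite_UNIV_char_0 by (metis finite_imageD finite_subset)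
qed

lemma foliation_nonzero:
  assumes "finite {s. singular_point \<omega> s}" shows "\<exists>x i. \<omega> x $ i \<noteq> 0"
proof (rule ccontr)
  assume "\<not> ?thesis"
  then have "\<omega> x = 0" for x by (simp add: vec_eq_iff)
  then have "{s. singular_point \<omega> s} = proj_points" by (auto simp: singular_point_def)
  then show False using assms infinite_proj_points by simp
qed

subsection \<open>Products of lines\<close>

definition covector :: "(complex^3) set \<Rightarrow> complex^3" where
  "covector l = (SOME a. a \<noteq> 0 \<and> l = {x. (\<Sum>i\<in>UNIV. a $ i * x $ i) = 0})"

definition line_eq :: "(complex^3) set \<Rightarrow> complex^3 \<Rightarrow> complex" where
  "line_eq l x = (\<Sum>i\<in>UNIV. covector l $ i * x $ i)"

lemma covector: "l \<in> proj_lines \<Longrightarrow> covector l \<noteq> 0 \<and> l = {x. line_eq l x = 0}"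
  unfolding line_eq_def covector_def by (rule someI_ex) (blast elim: proj_lines_covector)

lemma line_eq_iff: "l \<in> proj_lines \<Longrightarrow> line_eq l x = 0 \<longleftrightarrow> x \<in> l"
  using covector by blast

lemma hpoly_line_eq: "hpoly 1 (line_eq l)"
  unfolding line_eq_def by (rule hpoly_linear)

lemma line_eq_add: "line_eq l (x + y) = line_eq l x + line_eq l y"
  by (simp add: line_eq_def distrib_left sum.distrib)

lemma line_eq_scale: "line_eq l (c *s x) = c * line_eq l x"
  by (simp add: line_eq_def sum_distrib_left algebra_simps)

lemma proj_line_pencil:
  "l \<in> proj_lines \<Longrightarrow> x \<in> l \<Longrightarrow> y \<in> l \<Longrightarrow> x + t *s (y - x) \<in> l"
  by (auto simp: proj_lines_def intro!: vec.subspace_add vec.subspace_scale vec.subspace_diff)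

text \<open>One line is divided out at a time. The quotient still vanishes on the next line
  \<open>l\<close>, because the factors already removed belong to other lines and their product is
  not identically zero on \<open>l\<close>. The clause \<open>n < card S\<close> again guards
  against truncated subtraction.\<close>

lemma hpoly_divides_lines:
  assumes "finite S" "S \<subseteq> proj_lines" "hpoly n f" "\<And>l x. l \<in> S \<Longrightarrow> x \<in> l \<Longrightarrow> f x = 0"
  shows "\<exists>g. hpoly (n - card S) g \<and> (n < card S \<longrightarrow> g = (\<lambda>x. 0)) \<and> (\<forall>x. f x = (\<Prod>l\<in>S. line_eq l x) * g x)"
  using assms
proof (induction S rule: finite_induct)
  case empty
  then show ?case by auto
next
  case (insert l S)
  then obtain g where g: "hpoly (n - card S) g" "n < card S \<longrightarrow> g = (\<lambda>x. 0)"
      "\<And>x. f x = (\<Prod>l\<in>S. line_eq l x) * g x"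
    by auto
  have l: "l \<in> proj_lines" using insert.prems by auto
  have gl: "g x = 0" if xl: "x \<in> l" for x
  proof (rule ccontr)
    assume gx: "g x \<noteq> 0"
    have "\<exists>z\<in>l. (\<Prod>l\<in>S. line_eq l z) \<noteq> 0"
    proof (rule linepoly_prod_nonzero[OF insert.hyps(1)])
      fix l' assume l': "l' \<in> S"
      then have "l \<noteq> l'" "l' \<in> proj_lines" using insert by auto
      then show "\<exists>x\<in>l. line_eq l' x \<noteq> 0"
        using proj_line_eqI[OF l, of l'] line_eq_iff[of l'] by blast
    next
      show "l \<noteq> {}" using xl by blast
      fix x y t assume "x \<in> l" "y \<in> l"
      then show "x + t *s (y - x) \<in> l" by (rule proj_line_pencil[OF l])
    qed (rule linepoly_hpoly[OF hpoly_line_eq])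
    then obtain z where z: "z \<in> l" "(\<Prod>l\<in>S. line_eq l z) \<noteq> 0" by blast
    obtain y where "y \<in> l" "(\<Prod>l\<in>S. line_eq l y) \<noteq> 0" "g y \<noteq> 0"
      using linepoly_common_nonzero[OF linepoly_prod[of S line_eq] linepoly_hpoly[OF g(1)] _ z xl gx]
        proj_line_pencil[OF l] linepoly_hpoly[OF hpoly_line_eq] by blast
    then show False using insert.prems(3)[of l y] g(3)[of y] by auto
  qed
  obtain h where h: "hpoly (n - card S - 1) h" "n - card S = 0 \<Longrightarrow> h = (\<lambda>x. 0)"
      "\<And>x. g x = line_eq l x * h x"
    using hpoly_divides_linear[OF g(1), of "covector l"] covector[OF l] gl
    unfolding line_eq_def by blast
  show ?case
    using h g insert.hyps by (intro exI[of _ h]) (auto simp: mult_ac)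
qed

lemma prod_line_eq_nonzero:
  assumes "finite S" "S \<subseteq> proj_lines" shows "\<exists>x. (\<Prod>l\<in>S. line_eq l x) \<noteq> 0"
proof -
  have "\<exists>z\<in>UNIV. (\<Prod>l\<in>S. line_eq l z) \<noteq> 0"
  proof (rule linepoly_prod_nonzero[OF assms(1)])
    fix l assume "l \<in> S"
    then have l: "l \<in> proj_lines" using assms by auto
    then obtain e1 e2 e3 where "det3 e1 e2 e3 = 1" "l = {x. det3 e1 e2 x = 0}"
      using proj_line_basis by metis
    then have "e3 \<notin> l" by simp
    then show "\<exists>x\<in>UNIV. line_eq l x \<noteq> 0" using line_eq_iff[OF l] by blast
  qed (auto intro: linepoly_hpoly[OF hpoly_line_eq])
  then show ?thesis by blast
qed

text \<open>Dividing a polynomial of degree \<open>3d\<close> by \<open>3d\<close> lines leaves a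
  constant. If it were 0, a nonsingular point off all invariant lines would have an invariant
  tangent line through it.\<close>

lemma inflection_poly_product:
  assumes T: "tangent_field d \<omega> Z" and d: "d > 0" and fin: "finite {s. singular_point \<omega> s}"
    and card: "card {l. invariant_line \<omega> l} = 3 * d"
  obtains c where "c \<noteq> 0" "\<And>x. inflection_poly Z x = c * (\<Prod>l | invariant_line \<omega> l. line_eq l x)"
proof -
  have Z: "\<And>j. hpoly d (\<lambda>x. Z x $ j)" using T by (simp add: tangent_field_def)
  let ?S = "{l. invariant_line \<omega> l}"
  have S: "finite ?S" "?S \<subseteq> proj_lines" using card d by (auto simp: invariant_line_def intro: card_ge_0_finite)
  have "inflection_poly Z x = 0" if "l \<in> ?S" "x \<in> l" for l x
    using tangent_field_line_vanish[OF T d, of l] that unfolding inflection_poly_def by auto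
  then obtain g where g: "hpoly (3 * d - card ?S) g" "\<And>x. inflection_poly Z x = (\<Prod>l\<in>?S. line_eq l x) * g x"
    using hpoly_divides_lines[OF S hpoly_inflection_poly[OF Z d]] by blast
  have gc: "g x = g 0" for x using hpoly_degree_0[OF g(1)] card by simp
  have "g 0 \<noteq> 0"
  proof
    assume "g 0 = 0"
    then have E: "inflection_poly Z x = 0" for x using g(2)[of x] gc[of x] by simp
    obtain x0 i where x0: "\<omega> x0 $ i \<noteq> 0" using foliation_nonzero[OF fin] by blast
    have "\<omega> x $ i = form_app \<omega> x (axis i 1)" for x
      by (simp add: form_app_def axis_def if_distrib[of "\<lambda>t. _ * t"] cong: if_cong)
    then have wi: "\<omega> x $ i = det3 x (Z x) (axis i 1)" for x using T by (simp add: tangent_field_def)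
    have "hpoly (1 + d + 0) (\<lambda>x. \<omega> x $ i)"
      unfolding wi by (rule hpoly_det3[OF _ Z hpoly_const_vec refl]) (rule hpoly_coord)
    then have lp: "linepoly (\<lambda>x. \<omega> x $ i)" by (rule linepoly_hpoly)
    obtain x1 where "(\<Prod>l\<in>?S. line_eq l x1) \<noteq> 0" using prod_line_eq_nonzero[OF S] by blast
    then obtain x where x: "(\<Prod>l\<in>?S. line_eq l x) \<noteq> 0" "\<omega> x $ i \<noteq> 0"
      using linepoly_common_nonzero[OF linepoly_prod[of ?S line_eq] lp, of UNIV x1 x0] x0
        linepoly_hpoly[OF hpoly_line_eq] by auto
    have "x \<noteq> 0" "Z x \<notin> vec.span {x}" using x(2) unfolding wi by (auto simp: mem_span1 det3_simps)
    then have "invariant_line \<omega> (vec.span {x, Z x})" using tangent_line_invariant[OF T d E] by blast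
    then have "vec.span {x, Z x} \<in> ?S" "line_eq (vec.span {x, Z x}) x = 0"
      using line_eq_iff[of "vec.span {x, Z x}" x] vec.span_base[of x] by (auto simp: invariant_line_def)
    then show False using x(1) S(1) by (metis prod_zero_iff)
  qed
  then show thesis using that[of "g 0"] g(2) gc by (metis mult.commute)
qed

section \<open>Coordinates adapted to an invariant line\<close>

text \<open>In the coordinates \<open>x, y, z\<close> dual to \<open>e1, e2, e3\<close>, whose values are the determinants below, the form is
  \<open>z (A dx + B dy) - (x A + y B) dz\<close>. Its degeneration replaces \<open>A\<close>, \<open>B\<close> by their values at \<open>z = 0\<close>.\<close>

locale line_adapted_form =
  fixes d :: nat and \<omega> :: one_form and e1 e2 e3 :: "complex^3" and A B :: "complex^3 \<Rightarrow> complex"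
  assumes frame: "det3 e1 e2 e3 = 1"
    and A: "hpoly d A" and B: "hpoly d B"
    and form: "form_app \<omega> x v = det3 e1 e2 x * (A x * det3 v e2 e3 + B x * det3 e1 v e3)
        - (A x * det3 x e2 e3 + B x * det3 e1 x e3) * det3 e1 e2 v"
begin

lemma homogeneous_form: "homogeneous_form (Suc d) \<omega>"
  unfolding homogeneous_form_def
proof (intro conjI allI)
  fix i
  have "\<omega> x $ i = form_app \<omega> x (axis i 1)" for x
    by (simp add: form_app_def axis_def if_distrib[of "\<lambda>t. _ * t"] cong: if_cong)
  moreover have "hpoly (Suc d) (\<lambda>x. form_app \<omega> x v)" for v
    unfolding form
    by (intro hpoly_diff hpoly_mult'[OF hpoly_det3_linear(1)] hpoly_mult'[OF _ hpoly_const] hpoly_add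
        hpoly_mult'[OF A hpoly_const] hpoly_mult'[OF B hpoly_const]
        hpoly_mult'[OF A hpoly_det3_linear(3)] hpoly_mult'[OF B hpoly_det3_linear(2)] refl) simp_all
  ultimately show "hpoly (Suc d) (\<lambda>x. \<omega> x $ i)" by simp
qed (simp add: form algebra_simps)

lemma line: "vec.span {e1, e2} \<in> proj_lines" "vec.span {e1, e2} = {x. det3 e1 e2 x = 0}"
  using span2_proj_line[of e1 e2 e3] frame by auto

lemma invariant: "invariant_line \<omega> (vec.span {e1, e2})"
  unfolding invariant_line_def using line by (auto simp: form)

text \<open>Along the line only the factor \<open>det3 e1 e2\<close> has to be differentiated. The
  result involves just the values of \<open>A\<close> and \<open>B\<close> on the line, which is why
  indices survive the degeneration.\<close>

lemma jac_on_line: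
  assumes "det3 e1 e2 x = 0" "det3 e1 e2 v = 0"
  shows "jac \<omega> x w v = det3 e1 e2 w * (A x * det3 v e2 e3 + B x * det3 e1 v e3)"
  unfolding jac_def
proof (rule dir_deriv_eqI)
  have "((\<lambda>t. t * det3 e1 e2 w * (A (x + t *s w) * det3 v e2 e3 + B (x + t *s w) * det3 e1 v e3)) has_field_derivative
     det3 e1 e2 w * (A x * det3 v e2 e3 + B x * det3 e1 v e3)) (at 0)"
    by (auto intro!: derivative_eq_intros hpoly_line_derivative_0[OF A] hpoly_line_derivative_0[OF B])
  then show "((\<lambda>t. form_app \<omega> (x + t *s w) v) has_field_derivative
     det3 e1 e2 w * (A x * det3 v e2 e3 + B x * det3 e1 v e3)) (at 0)"
    unfolding form by (simp add: assms det3_simps)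
qed

text \<open>In the affine chart with the line at infinity this is the vector field with components
  \<open>B\<close> and \<open>- A\<close>. The zero summand puts it in the shape that
  \<open>det3_expand\<close> matches.\<close>

definition field :: "complex^3 \<Rightarrow> complex^3" where
  "field x = B x *s e1 + (- A x) *s e2 + 0 *s e3"

lemma tangent_field: "tangent_field d \<omega> field"
proof -
  have "form_app \<omega> x v = det3 x (field x) v" for x v
  proof -
    have "det3 x (field x) v = det3 (det3 x e2 e3 *s e1 + det3 e1 x e3 *s e2 + det3 e1 e2 x *s e3) (field x)
       (det3 v e2 e3 *s e1 + det3 e1 v e3 *s e2 + det3 e1 e2 v *s e3)"
      using frame_expand[OF frame, of x] frame_expand[OF frame, of v] by simp
    also have "\<dots> = form_app \<omega> x v"
      unfolding field_def det3_expand form by (simp add: frame algebra_simps)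
    finally show ?thesis ..
  qed
  moreover have "hpoly d (\<lambda>x. field x $ j)" for j
  proof -
    have "hpoly d (\<lambda>x. e1 $ j * B x - e2 $ j * A x)"
      by (intro hpoly_diff hpoly_cmult A B)
    then show ?thesis by (simp add: field_def mult.commute)
  qed
  ultimately show ?thesis unfolding tangent_field_def by blast
qed

end

lemma invariant_line_adapted:
  assumes hom: "homogeneous_form (Suc d) \<omega>" and l: "invariant_line \<omega> l"
  obtains e1 e2 e3 A B where "line_adapted_form d \<omega> e1 e2 e3 A B" "l = vec.span {e1, e2}"
proof -
  have pl: "l \<in> proj_lines" using l by (simp add: invariant_line_def)
  obtain e1 e2 e3 where e: "det3 e1 e2 e3 = 1" "l = vec.span {e1, e2}" "l = {x. det3 e1 e2 x = 0}"
    by (rule proj_line_basis[OF pl])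
  have el: "e1 \<in> l" "e2 \<in> l" unfolding e(3) by simp_all
  obtain A B where AB: "hpoly d A" "hpoly d B" and form:
    "\<And>x v. form_app \<omega> x v = det3 e1 e2 x * (A x * det3 v e2 e3 + B x * det3 e1 v e3)
        - (A x * det3 x e2 e3 + B x * det3 e1 x e3) * det3 e1 e2 v"
    by (rule homogeneous_form_line_components[OF hom l e(1) el e(3)]) (rule that)
  have "line_adapted_form d \<omega> e1 e2 e3 A B"
    by unfold_locales (rule e(1) AB form)+
  then show thesis using that e(2) by blast
qed

lemma tangent_field_exists:
  assumes "homogeneous_form (Suc d) \<omega>" "invariant_line \<omega> l"
  shows "\<exists>Z. tangent_field d \<omega> Z"
proof -
  obtain e1 e2 e3 A B where "line_adapted_form d \<omega> e1 e2 e3 A B" "l = vec.span {e1, e2}"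
    by (rule invariant_line_adapted[OF assms])
  then show ?thesis using line_adapted_form.tangent_field by blast
qed

subsection \<open>Singular points of reduced convex foliations\<close>

lemma singular_point_two_lines:
  assumes T: "tangent_field d \<omega> Z" and d: "d > 0" and fin: "finite {s. singular_point \<omega> s}"
    and card: "card {l. invariant_line \<omega> l} = 3 * d"
    and p: "p \<noteq> 0" "Z p = 0"
  shows "vec_deriv Z p w \<in> vec.span {p} \<Longrightarrow> w \<in> vec.span {p}"
    and "\<exists>l'. l' \<noteq> l \<and> invariant_line \<omega> l' \<and> p \<in> l'"
proof -
  have Z: "\<And>j. hpoly d (\<lambda>x. Z x $ j)" using T by (simp add: tangent_field_def)
  let ?V = "accel Z"
  have Vp: "?V p = 0" by (simp add: accel_def p(2) vec_deriv_zero[OF Z])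
  obtain c where c: "c \<noteq> 0" "\<And>x. inflection_poly Z x = c * (\<Prod>l | invariant_line \<omega> l. line_eq l x)"
    using inflection_poly_product[OF T d fin card] by blast
  define S where "S = {l. invariant_line \<omega> l \<and> p \<in> l}"
  define S' where "S' = {l. invariant_line \<omega> l \<and> p \<notin> l}"
  have finI: "finite {l. invariant_line \<omega> l}" using card d by (auto intro: card_ge_0_finite)
  have fS: "finite S" "finite S'" "S \<subseteq> proj_lines" "S' \<subseteq> proj_lines"
    using finI finite_subset[of S "{l. invariant_line \<omega> l}"] finite_subset[of S' "{l. invariant_line \<omega> l}"]
    unfolding S_def S'_def by (auto simp: invariant_line_def)
  define Q where "Q x = (\<Prod>l\<in>S. line_eq l x)" for x
  define G where "G x = c * (\<Prod>l\<in>S'. line_eq l x)" for x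
  have "{l. invariant_line \<omega> l} = S \<union> S'" "S \<inter> S' = {}" unfolding S_def S'_def by auto
  then have E: "inflection_poly Z x = Q x * G x" for x
    unfolding c(2) Q_def G_def using prod.union_disjoint[OF fS(1,2), of "\<lambda>l. line_eq l x"] by simp
  \<comment> \<open>All lines through \<open>p\<close> have gone into \<open>Q\<close>, each to the
    first power.\<close>
  have Gp: "G p \<noteq> 0"
    using c(1) fS line_eq_iff unfolding G_def S'_def by (auto simp: prod_zero_iff)
  have Ghp: "hpoly (0 + (\<Sum>l\<in>S'. 1)) G"
    unfolding G_def by (intro hpoly_mult hpoly_const hpoly_prod fS hpoly_line_eq)
  have Qhp: "hpoly (\<Sum>l\<in>S. 1) Q"
    unfolding Q_def by (intro hpoly_prod fS hpoly_line_eq)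
  have plane: "det3 u v w = 0" if "l \<in> S" "u \<in> {p, x, Z x, ?V x}" "v \<in> {p, x, Z x, ?V x}" "w \<in> {p, x, Z x, ?V x}" "x \<in> l"
    for l u v w x
    using that tangent_field_line_vanish[OF T d, of l x] unfolding S_def by blast
  have div: "\<exists>n g. hpoly n g \<and> (\<forall>x. f x = Q x * g x)" if "hpoly n f" "\<And>l x. l \<in> S \<Longrightarrow> x \<in> l \<Longrightarrow> f x = 0" for f n
    using hpoly_divides_lines[OF fS(1,3) that(1)] that(2) unfolding Q_def by blast
  obtain nK K where K: "hpoly nK K" "\<And>x. det3 p x (Z x) = Q x * K x"
    using div[OF hpoly_det3[OF hpoly_const_vec hpoly_coord' Z refl]] plane by blast
  obtain nS R where R: "hpoly nS R" "\<And>x. det3 p x (?V x) = Q x * R x"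
    using div[OF hpoly_det3[OF hpoly_const_vec hpoly_coord' hpoly_accel[OF Z] refl]] plane by blast
  obtain nD D where D: "hpoly nD D" "\<And>x. det3 p (Z x) (?V x) = Q x * D x"
    using div[OF hpoly_det3[OF hpoly_const_vec Z hpoly_accel[OF Z] refl]] plane by blast
  obtain x0 where x0: "Q x0 \<noteq> 0" using prod_line_eq_nonzero[OF fS(1,3)] unfolding Q_def by blast
  \<comment> \<open>Cramer's relation for \<open>p\<close> against \<open>x\<close>,
    \<open>Z x\<close>, \<open>?V x\<close>, divided by \<open>Q\<close>. Cancellation makes it
    valid also where \<open>Q\<close> vanishes, in particular at \<open>p\<close>.\<close>
  have id: "G x * p $ i = D x * x $ i - R x * Z x $ i + K x * ?V x $ i" for x i
  proof -
    have lp: "linepoly (\<lambda>x. G x * p $ i - (D x * x $ i - R x * Z x $ i + K x * ?V x $ i))"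
      by (intro linepoly_diff linepoly_mult linepoly_add linepoly_const linepoly_coord
          linepoly_hpoly[OF D(1)] linepoly_hpoly[OF R(1)] linepoly_hpoly[OF K(1)] linepoly_hpoly[OF Ghp]
          linepoly_hpoly[OF Z] linepoly_hpoly[OF hpoly_accel[OF Z]])
    have "Q x * (G x * p $ i - (D x * x $ i - R x * Z x $ i + K x * ?V x $ i)) = 0" for x
    proof -
      have "(det3 x (Z x) (?V x) *s p) $ i
          = (det3 p (Z x) (?V x) *s x + det3 x p (?V x) *s Z x + det3 x (Z x) p *s ?V x) $ i"
        unfolding cramer3[of x "Z x" "?V x" p] ..
      moreover have "det3 x p (?V x) = - (Q x * R x)" "det3 x (Z x) p = Q x * K x"
        using R(2)[of x] det3_swap(1)[of x p "?V x"] K(2)[of x] det3_cycle[of x "Z x" p] by simp_all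
      ultimately show ?thesis
        using E[of x] unfolding inflection_poly_def by (simp add: D(2) algebra_simps)
    qed
    from linepoly_cancel[OF linepoly_hpoly[OF Qhp] lp this x0, of x] show ?thesis by simp
  qed
  obtain i where i: "p $ i \<noteq> 0" using p(1) by (metis vec_eq_iff zero_index)
  have "G p * p $ i = D p * p $ i" using id[of p i] by (simp add: p(2) Vp)
  then have Dp: "D p \<noteq> 0" using Gp i by simp
  show "w \<in> vec.span {p}" if M: "vec_deriv Z p w \<in> vec.span {p}"
  proof -
    obtain a where a: "vec_deriv Z p w = a *s p" using M unfolding mem_span1 by blast
    \<comment> \<open>Euler's relation gives \<open>vec_deriv Z p p = d Z p = 0\<close>. Thus
      \<open>?V\<close> vanishes to second order in the direction \<open>w\<close>, the term with
      \<open>K\<close> drops out of the derivative of \<open>id\<close>, and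
      \<open>D p \<noteq> 0\<close> lets the rest be solved for \<open>w\<close>.\<close>
    have MM: "vec_deriv Z p (vec_deriv Z p w) = 0"
      unfolding a vec_deriv_scale[OF Z] vec_deriv_euler[OF Z] by (simp add: p(2))
    have Vd: "((\<lambda>t. ?V (p + t *s w) $ j) has_field_derivative 0) (at 0)" for j
      using hpoly_line_derivative_0[OF hpoly_accel[OF Z, of j], of p w]
      unfolding accel_derivative[OF Z p(2)] MM by simp
    have w: "dir_deriv G p w * p $ j = dir_deriv D p w * p $ j + D p * w $ j - R p * (a * p $ j)" for j
    proof -
      have "((\<lambda>t. G (p + t *s w) * p $ j) has_field_derivative dir_deriv G p w * p $ j) (at 0)"
        by (auto intro!: derivative_eq_intros hpoly_line_derivative_0[OF Ghp])
      moreover have "((\<lambda>t. D (p + t *s w) * (p + t *s w) $ j - R (p + t *s w) * Z (p + t *s w) $ j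
          + K (p + t *s w) * ?V (p + t *s w) $ j) has_field_derivative
           dir_deriv D p w * p $ j + D p * w $ j - R p * (a * p $ j)) (at 0)"
        by (rule derivative_eq_intros hpoly_line_derivative_0[OF D(1)] hpoly_line_derivative_0[OF R(1)]
            hpoly_line_derivative_0[OF K(1)] field_line_derivative_0[OF Z] Vd refl | 
            simp add: p(2) Vp a)+
      ultimately show ?thesis unfolding id by (rule DERIV_unique)
    qed
    have "w = ((dir_deriv G p w - dir_deriv D p w + R p * a) / D p) *s p"
      unfolding vec_eq_iff
    proof
      fix j
      have "D p * w $ j = (dir_deriv G p w - dir_deriv D p w + R p * a) * p $ j"
        using w[of j] by (simp add: algebra_simps)
      then show "w $ j = (((dir_deriv G p w - dir_deriv D p w + R p * a) / D p) *s p) $ j"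
        using Dp by (simp add: field_simps)
    qed
    then show ?thesis unfolding mem_span1 by blast
  qed
  show "\<exists>l'. l' \<noteq> l \<and> invariant_line \<omega> l' \<and> p \<in> l'"
  proof (rule ccontr)
    assume "\<not> ?thesis"
    then have "S \<subseteq> {l}" unfolding S_def by auto
    moreover have "S \<noteq> {}"
    proof
      assume "S = {}"
      then have "inflection_poly Z p = G p" unfolding E Q_def by simp
      then show False using Gp by (simp add: inflection_poly_def p(2))
    qed
    ultimately have S: "S = {l}" by auto
    then have E': "inflection_poly Z x = line_eq l x * G x" for x unfolding E Q_def by simp
    have l: "l \<in> proj_lines" "p \<in> l" using S unfolding S_def by (auto simp: invariant_line_def)
    obtain e1 e2 w where "det3 e1 e2 w = 1" "l = {x. det3 e1 e2 x = 0}"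
      by (rule proj_line_basis[OF l(1)])
    then have w: "w \<notin> l" by simp
    have lep: "line_eq l p = 0" "line_eq l w \<noteq> 0" using line_eq_iff[OF l(1)] l(2) w by auto
    have Vc: "\<And>j. hpoly (d - 1 + d) (\<lambda>x. ?V x $ j)" using hpoly_accel[OF Z] .
    \<comment> \<open>Two of the three columns vanish at \<open>p\<close>, so the first derivative
      is 0. A single line through \<open>p\<close> would instead give
      \<open>line_eq l w * G p\<close>.\<close>
    have "((\<lambda>t. inflection_poly Z (p + t *s w)) has_field_derivative 0) (at 0)"
      unfolding inflection_poly_def det3_def
      by (auto intro!: derivative_eq_intros field_line_derivative_0[OF Z] hpoly_line_derivative_0[OF Vc] simp: p(2) Vp)
    moreover have "((\<lambda>t. line_eq l (p + t *s w) * G (p + t *s w)) has_field_derivative line_eq l w * G p) (at 0)"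
      unfolding line_eq_add line_eq_scale
      by (auto intro!: derivative_eq_intros hpoly_line_derivative_0[OF Ghp] simp: lep)
    ultimately have "line_eq l w * G p = 0" unfolding E' by (metis DERIV_unique)
    then show False using lep Gp by simp
  qed
qed

text \<open>At a singular point \<open>Z p\<close> is a multiple \<open>\<mu>\<close> of
  \<open>p\<close>. It is removed by a multiple of the radial field, with the power
  \<open>d - 1\<close> of a linear form equal to 1 at \<open>p\<close> as factor to keep the
  degree.\<close>

lemma tangent_field_vanishing_at:
  assumes T: "tangent_field d \<omega> Z" and d: "d > 0" and p: "p \<noteq> 0" "\<omega> p = 0"
  shows "\<exists>Z. tangent_field d \<omega> Z \<and> Z p = 0"
proof -
  have Z: "\<And>j. hpoly d (\<lambda>x. Z x $ j)" and TZ: "\<And>x v. form_app \<omega> x v = det3 x (Z x) v"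
    using T by (auto simp: tangent_field_def)
  have "det3 p (Z p) v = 0" for v using TZ[of p v] p(2) by (simp add: form_app_zero)
  then obtain \<mu> where \<mu>: "Z p = \<mu> *s p" using cross_eq_0_imp[of p "Z p"] p(1) by (auto simp: mem_span1)
  obtain q where q: "q \<notin> vec.span {p}"
  proof -
    have "det3 (axis 1 1) (axis 2 1) (axis 3 1) = 1" by (simp add: det3_def axis_def)
    moreover have "det3 x y z = 0" if "x \<in> vec.span {p}" "y \<in> vec.span {p}" for x y z
      using that by (auto simp: mem_span1 det3_scale)
    ultimately show thesis using that by (metis zero_neq_one)
  qed
  obtain r where r: "det3 p q r = 1" using det3_nonzeroI[OF p(1) q] by blast
  define Z' where "Z' x = Z x - (\<mu> * det3 x q r ^ (d - 1)) *s x" for x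
  have "hpoly (d - 1) (\<lambda>x. det3 x q r ^ (d - 1))"
    using hpoly_power[OF hpoly_det3_linear(3), of "d - 1" q r] by simp
  then have "hpoly d (\<lambda>x. (\<mu> * det3 x q r ^ (d - 1)) * x $ j)" for j
    using d by (intro hpoly_mult'[OF hpoly_cmult hpoly_coord]) auto
  then have "hpoly d (\<lambda>x. Z' x $ j)" for j
    using hpoly_diff[OF Z[of j]] by (simp add: Z'_def)
  moreover have "form_app \<omega> x v = det3 x (Z' x) v" for x v
    by (simp add: TZ Z'_def det3_simps)
  moreover have "Z' p = 0" by (simp add: Z'_def \<mu> r)
  ultimately show ?thesis unfolding tangent_field_def by blast
qed

text \<open>The line \<open>l\<close> is arbitrary: applied to an invariant line through
  \<open>s\<close>, the second claim supplies another one.\<close>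

lemma reduced_convex_singular_point:
  assumes hom: "homogeneous_form (Suc d) \<omega>" and d: "d > 0" and fin: "finite {s. singular_point \<omega> s}"
    and card: "card {l. invariant_line \<omega> l} = 3 * d" and s: "singular_point \<omega> s"
  shows "nondegenerate \<omega> s" and "\<exists>l'. l' \<noteq> l \<and> invariant_line \<omega> l' \<and> s \<subseteq> l'"
proof -
  obtain p where p: "p \<noteq> 0" "s = vec.span {p}" using s unfolding singular_point_def proj_points_iff by blast
  have ps: "p \<in> s" unfolding p(2) by (simp add: vec.span_base)
  have wp: "\<omega> p = 0" using s ps by (simp add: singular_point_def)
  have "{l. invariant_line \<omega> l} \<noteq> {}" using card d by (metis card.empty mult_is_0 not_less0 zero_neq_numeral)
  then obtain l0 where "invariant_line \<omega> l0" by auto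
  then obtain Z where T: "tangent_field d \<omega> Z" "Z p = 0"
    using tangent_field_exists[OF hom] tangent_field_vanishing_at[where \<omega> = \<omega>, OF _ d p(1) wp] by metis
  have Z: "\<And>j. hpoly d (\<lambda>x. Z x $ j)" and TZ: "\<And>x v. form_app \<omega> x v = det3 x (Z x) v"
    using T by (auto simp: tangent_field_def)
  note core = singular_point_two_lines[OF T(1) d fin card p(1) T(2)]
  obtain l' where l': "l' \<noteq> l" "invariant_line \<omega> l'" "p \<in> l'" using core(2) by blast
  then have "s \<subseteq> l'" unfolding p(2)
    by (intro vec.span_minimal) (auto simp: invariant_line_def proj_lines_def)
  with l' show "\<exists>l'. l' \<noteq> l \<and> invariant_line \<omega> l' \<and> s \<subseteq> l'" by blast
  \<comment> \<open>As \<open>Z p = 0\<close>, only the derivative of \<open>Z\<close> contributes.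
    The kernel of \<open>jac\<close> therefore consists of the \<open>w\<close> that
    \<open>vec_deriv Z p\<close> sends into the span of \<open>p\<close>.\<close>
  have jac: "jac \<omega> p w v = det3 p (vec_deriv Z p w) v" for w v
    unfolding jac_def TZ det3_def
    by (rule dir_deriv_eqI)
       (auto intro!: derivative_eq_intros field_line_derivative_0[OF Z] simp: T(2) algebra_simps)
  have "l' \<in> proj_lines" using l' by (simp add: invariant_line_def)
  then obtain q where "q \<in> l'" "q \<notin> vec.span {p}" using proj_line_not_subset_point by blast
  then obtain r where r: "det3 p q r = 1" using det3_nonzeroI[OF p(1)] by blast
  have "w \<in> s" if "\<forall>v. jac \<omega> p w v = 0" for w
    using that core(1)[of w] cross_eq_0_imp[of p "vec_deriv Z p w"] p unfolding jac by blast
  then show "nondegenerate \<omega> s"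
    using nondegenerate_iff[OF hom s ps, of q r] r by simp
qed

subsection \<open>Tangencies with lines\<close>

text \<open>If the polynomial on the affine line \<open>?e1 + t *s ?e2\<close> has no root, it is a
  constant \<open>c\<close>. Then \<open>G\<close> agrees with \<open>c\<close> times a positive
  power of the first coordinate, and \<open>?e2\<close>, the point at infinity, is a zero.\<close>

lemma binary_form_zero:
  fixes G :: "complex^2 \<Rightarrow> complex"
  assumes G: "hpoly (Suc k) G"
  obtains v where "v \<noteq> 0" "G v = 0"
proof -
  let ?e1 = "vector [1, 0] :: complex^2" and ?e2 = "vector [0, 1] :: complex^2"
  obtain P where P: "\<And>t. G (?e1 + t *s ?e2) = poly P t"
    using linepoly_hpoly[OF G] unfolding linepoly_def by metis
  show thesis
  proof (cases "\<exists>t. poly P t = 0")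
    case True
    then obtain t where "G (?e1 + t *s ?e2) = 0" using P by metis
    moreover have "?e1 + t *s ?e2 \<noteq> 0" by (simp add: vec_eq_iff forall_2)
    ultimately show thesis using that by blast
  next
    case False
    then obtain b where "P = [:b:]" using fundamental_theorem_of_algebra_alt[of P] by blast
    then have c: "poly P t = poly P 0" for t by simp
    let ?F = "\<lambda>x. G x - poly P 0 * x $ 1 ^ Suc k"
    have "hpoly (Suc k) (\<lambda>x. poly P 0 * x $ 1 ^ Suc k)"
      using hpoly_cmult[OF hpoly_power[OF hpoly_coord, of "Suc k" 1]] by simp
    then have F: "hpoly (Suc k) ?F" by (rule hpoly_diff[OF G])
    have "?F ?e2 = 0"
    proof (rule hpoly_zero_by_continuity[OF F, of _ ?e1])
      fix s :: complex assume s: "s \<noteq> 0"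
      have "?e2 + s *s ?e1 = s *s (?e1 + (1 / s) *s ?e2)"
        using s by (simp add: vec_eq_iff forall_2)
      then have "G (?e2 + s *s ?e1) = s ^ Suc k * poly P 0"
        using hpoly_scale[OF G] P c by metis
      then show "?F (?e2 + s *s ?e1) = 0" by simp
    qed
    then have "G ?e2 = 0" by simp
    moreover have "?e2 \<noteq> 0" by (simp add: vec_eq_iff forall_2)
    ultimately show thesis using that by blast
  qed
qed

lemma binary_form_splits:
  fixes G :: "complex^2 \<Rightarrow> complex"
  assumes "hpoly k G" "G z \<noteq> 0"
  shows "\<exists>c (v :: nat \<Rightarrow> complex^2). c \<noteq> 0 \<and> (\<forall>i<k. v i \<noteq> 0) \<and> (\<forall>u. G u = c * (\<Prod>i<k. v i $ 1 * u $ 2 - v i $ 2 * u $ 1))"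
  using assms
proof (induction k arbitrary: G)
  case 0
  then have "G u = G z" for u using hpoly_degree_0 by blast
  then show ?case using 0 by (intro exI[of _ "G z"]) auto
next
  case (Suc k)
  obtain w where w: "w \<noteq> 0" "G w = 0" using binary_form_zero[OF Suc.prems(1)] .
  define a :: "complex^2" where "a = vector [- w $ 2, w $ 1]"
  have av: "(\<Sum>i\<in>UNIV. a $ i * u $ i) = w $ 1 * u $ 2 - w $ 2 * u $ 1" for u
    by (simp add: a_def sum_2)
  have a0: "a \<noteq> 0" using w(1) by (auto simp: a_def vec_eq_iff forall_2)
  have "G u = 0" if "(\<Sum>i\<in>UNIV. a $ i * u $ i) = 0" for u
  proof -
    obtain j where j: "w $ j \<noteq> 0" using w(1) by (metis vec_eq_iff zero_index)
    have "u = (u $ j / w $ j) *s w"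
      using that j exhaust_2[of j] unfolding av by (auto simp: vec_eq_iff forall_2 field_simps)
    then show ?thesis using hpoly_scale[OF Suc.prems(1), of "u $ j / w $ j" w] w(2) by simp
  qed
  then obtain H where H: "hpoly k H" "\<And>u. G u = (w $ 1 * u $ 2 - w $ 2 * u $ 1) * H u"
    using hpoly_divides_linear[OF Suc.prems(1) a0] unfolding av by (metis diff_Suc_1)
  have Hz: "H z \<noteq> 0" using H(2)[of z] Suc.prems(2) by auto
  from Suc.IH[OF H(1) Hz] obtain c and v :: "nat \<Rightarrow> complex^2" where cv: "c \<noteq> 0" "\<forall>i<k. v i \<noteq> 0"
      "\<forall>u. H u = c * (\<Prod>i<k. v i $ 1 * u $ 2 - v i $ 2 * u $ 1)"
    by (elim exE conjE)
  show ?case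
  proof (intro exI[of _ c] exI[of _ "v(k := w)"] conjI allI impI)
    fix u :: "complex^2"
    have "(\<Prod>i<k. (v(k := w)) i $ 1 * u $ 2 - (v(k := w)) i $ 2 * u $ 1)
        = (\<Prod>i<k. v i $ 1 * u $ 2 - v i $ 2 * u $ 1)"
      by (intro prod.cong) auto
    then show "G u = c * (\<Prod>i<Suc k. (v(k := w)) i $ 1 * u $ 2 - (v(k := w)) i $ 2 * u $ 1)"
      unfolding H(2) cv(3)[rule_format] prod.lessThan_Suc by (simp add: mult_ac)
  qed (use cv w in auto)
qed

lemma zorder_prod_linear:
  assumes "finite I" "c \<noteq> 0" "\<And>i. i \<in> I \<Longrightarrow> a i \<noteq> 0 \<or> b i \<noteq> (0::complex)"
  shows "zorder (\<lambda>t. c * (\<Prod>i\<in>I. a i + t * b i)) 0 = int (card {i\<in>I. a i = 0})"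
proof (rule zorder_eqI[OF open_UNIV UNIV_I])
  let ?J = "{i\<in>I. a i = 0}"
  let ?g = "\<lambda>t. c * (\<Prod>i\<in>?J. b i) * (\<Prod>i\<in>I - ?J. a i + t * b i)"
  show "?g holomorphic_on UNIV" by (intro holomorphic_intros)
  show "?g 0 \<noteq> 0" using assms by (auto simp: prod_zero_iff)
  fix w :: complex
  have "(\<Prod>i\<in>I. a i + w * b i) = (\<Prod>i\<in>I - ?J. a i + w * b i) * (\<Prod>i\<in>?J. a i + w * b i)"
    by (rule prod.subset_diff) (use assms in auto)
  also have "(\<Prod>i\<in>?J. a i + w * b i) = (\<Prod>i\<in>?J. w * b i)" by (intro prod.cong) auto
  also have "\<dots> = w ^ card ?J * (\<Prod>i\<in>?J. b i)" by (simp add: prod.distrib)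
  finally show "c * (\<Prod>i\<in>I. a i + w * b i) = ?g w * (w - 0) powi int (card ?J)"
    by simp
qed

text \<open>In two variables a form killing the radial field is a multiple of
  \<open>u1 du2 - u2 du1\<close>, and the multiplier has degree one less.\<close>

lemma homogeneous_form_line_binary:
  assumes hom: "homogeneous_form (Suc k) \<omega>" 
  obtains G :: "complex^2 \<Rightarrow> complex" where "hpoly k G"
    "\<And>u v. form_app \<omega> (u $ 1 *s e1 + u $ 2 *s e2) (v $ 1 *s e1 + v $ 2 *s e2) = G u * (u $ 1 * v $ 2 - u $ 2 * v $ 1)"
proof -
  let ?\<phi> = "\<lambda>u::complex^2. u $ 1 *s e1 + u $ 2 *s e2"
  have \<phi>: "hpoly 1 (\<lambda>u. ?\<phi> u $ i)" for i
    using hpoly_add[OF hpoly_mult'[OF hpoly_coord hpoly_const] hpoly_mult'[OF hpoly_coord hpoly_const], of 1 "1::2" "e1 $ i" 2 "e2 $ i"]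
    by simp
  have hp: "hpoly (Suc k) (\<lambda>u. form_app \<omega> (?\<phi> u) v)" for v
    by (rule hpoly_subst[OF hpoly_form_app[OF hom] \<phi>])
  have rel: "u $ 1 * form_app \<omega> (?\<phi> u) e1 + u $ 2 * form_app \<omega> (?\<phi> u) e2 = 0" for u
    using form_app_self[OF hom, of "?\<phi> u"] by (simp add: form_app_add form_app_scale)
  have ax: "(\<Sum>i\<in>UNIV. axis 1 1 $ i * u $ i) = u $ 1" for u :: "complex^2"
    by (simp add: sum_2 axis_def)
  have "form_app \<omega> (?\<phi> u) e2 = 0" if "u $ 1 = 0" for u
  proof (cases "u $ 2 = 0")
    case True
    then show ?thesis using that form_app_scale_point[OF hom, of 0 0 e2] by simp
  qed (use rel[of u] that in simp)
  then obtain G where G: "hpoly k G" "\<And>u. form_app \<omega> (?\<phi> u) e2 = u $ 1 * G u"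
    using hpoly_divides_linear[OF hp[of e2], of "axis 1 1"] unfolding ax
    by (metis axis_eq_0_iff diff_Suc_1 zero_neq_one)
  have G1: "form_app \<omega> (?\<phi> u) e1 + u $ 2 * G u = 0" for u
  proof (rule linepoly_cancel[OF linepoly_coord[of 1]])
    show "linepoly (\<lambda>u. form_app \<omega> (?\<phi> u) e1 + u $ 2 * G u)"
      by (intro linepoly_add linepoly_mult linepoly_coord linepoly_hpoly[OF G(1)] linepoly_hpoly[OF hp])
    show "u $ 1 * (form_app \<omega> (?\<phi> u) e1 + u $ 2 * G u) = 0" for u
      using rel[of u] unfolding G(2) by (simp add: algebra_simps)
    show "(axis 1 1 :: complex^2) $ 1 \<noteq> 0" by simp
  qed
  then have G1: "form_app \<omega> (?\<phi> u) e1 = - (u $ 2 * G u)" for u by (simp add: eq_neg_iff_add_eq_0)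
  show thesis
    by (rule that[OF G(1)]) (simp add: form_app_add form_app_scale G1 G(2) algebra_simps)
qed

text \<open>The tangencies are the roots, with multiplicity, of the binary form of degree
  \<open>k\<close> that the one-form induces on the line. Every non-invariant line thus gives the
  same number.\<close>

lemma number_of_tangencies_eq:
  assumes hom: "homogeneous_form (Suc k) \<omega>" and l: "l \<in> proj_lines" and ni: "\<not> invariant_line \<omega> l"
  shows "number_of_tangencies \<omega> l = int k"
proof -
  obtain e1 e2 e3 where e: "det3 e1 e2 e3 = 1" "l = vec.span {e1, e2}" "l = {x. det3 e1 e2 x = 0}"
    using proj_line_basis[OF l] by metis
  define \<phi> where "\<phi> u = u $ 1 *s e1 + u $ 2 *s e2" for u :: "complex^2"
  obtain G :: "complex^2 \<Rightarrow> complex" where G: "hpoly k G"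
    "\<And>u v. form_app \<omega> (\<phi> u) (\<phi> v) = G u * (u $ 1 * v $ 2 - u $ 2 * v $ 1)"
    using homogeneous_form_line_binary[OF hom, of e1 e2] unfolding \<phi>_def by metis
  have surj: "\<exists>u. x = \<phi> u" if "x \<in> l" for x
  proof -
    obtain a b where "x = a *s e1 + b *s e2" using \<open>x \<in> l\<close> unfolding e(2) mem_span2 by blast
    then have "x = \<phi> (vector [a, b])" by (simp add: \<phi>_def)
    then show ?thesis ..
  qed
  have \<phi>l: "\<phi> u \<in> l" for u unfolding e(2) mem_span2 \<phi>_def by blast
  have \<phi>add: "\<phi> (u + v) = \<phi> u + \<phi> v" and \<phi>scale: "\<phi> (c *s u) = c *s \<phi> u" for u v c
    by (simp_all add: \<phi>_def vec_eq_iff algebra_simps)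
  have coord: "det3 (\<phi> u) e2 e3 = u $ 1" "det3 e1 (\<phi> u) e3 = u $ 2" for u
    by (simp_all add: \<phi>_def det3_simps e(1))
  have \<phi>inj: "\<phi> u = \<phi> v \<longleftrightarrow> u = v" for u v
  proof
    assume "\<phi> u = \<phi> v"
    then have "u $ 1 = v $ 1" "u $ 2 = v $ 2" using coord[of u] coord[of v] by simp_all
    then show "u = v" by (simp add: vec_eq_iff forall_2)
  qed simp
  have \<phi>0: "\<phi> u = 0 \<longleftrightarrow> u = 0" for u using \<phi>inj[of u 0] by (simp add: \<phi>_def)
  have par: "\<phi> v \<in> vec.span {\<phi> u} \<longleftrightarrow> u $ 1 * v $ 2 - u $ 2 * v $ 1 = 0" if u0: "u \<noteq> 0" for u v
  proof
    assume "\<phi> v \<in> vec.span {\<phi> u}"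
    then obtain c where "\<phi> v = \<phi> (c *s u)" by (auto simp: mem_span1 \<phi>scale)
    then have "v = c *s u" by (simp only: \<phi>inj)
    then show "u $ 1 * v $ 2 - u $ 2 * v $ 1 = 0" by simp
  next
    assume d: "u $ 1 * v $ 2 - u $ 2 * v $ 1 = 0"
    obtain j where j: "u $ j \<noteq> 0" using u0 by (metis vec_eq_iff zero_index)
    have "v = (v $ j / u $ j) *s u"
      using d j exhaust_2[of j] by (auto simp: vec_eq_iff forall_2 field_simps)
    then show "\<phi> v \<in> vec.span {\<phi> u}" unfolding mem_span1 using \<phi>scale by metis
  qed
  obtain z where "G z \<noteq> 0"
  proof -
    have "\<exists>z. G z \<noteq> 0"
    proof (rule ccontr)
      assume "\<not> ?thesis"
      then have "form_app \<omega> x v = 0" if "x \<in> l" "v \<in> l" for x v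
        using surj[OF that(1)] surj[OF that(2)] G(2) by auto
      then show False using ni l by (simp add: invariant_line_def)
    qed
    then show thesis using that by blast
  qed
  then have "\<exists>c (v :: nat \<Rightarrow> complex^2). c \<noteq> 0 \<and> (\<forall>i<k. v i \<noteq> 0) \<and> (\<forall>u. G u = c * (\<Prod>i<k. v i $ 1 * u $ 2 - v i $ 2 * u $ 1))"
    by (rule binary_form_splits[OF G(1)])
  then obtain c and v :: "nat \<Rightarrow> complex^2" where cv': "c \<noteq> 0" "\<forall>i<k. v i \<noteq> 0"
      "\<forall>u. G u = c * (\<Prod>i<k. v i $ 1 * u $ 2 - v i $ 2 * u $ 1)"
    by (elim exE conjE)
  note cv = cv'(1) cv'(2,3)[rule_format]
  define pt where "pt i = vec.span {\<phi> (v i)}" for i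
  \<comment> \<open>For any choice of \<open>p\<close> and \<open>q\<close> the restriction is a
    product of linear factors \<open>?a i + t * ?b i\<close>, and \<open>?a i = 0\<close> exactly
    when the root \<open>pt i\<close> is the point \<open>s\<close>.\<close>
  have ord: "tangency_order \<omega> l s = int (card {i\<in>{..<k}. pt i = s})" if s: "s \<in> proj_points" "s \<subseteq> l" for s
  proof -
    define P where "P = (\<lambda>(p, q). p \<in> s \<and> p \<noteq> 0 \<and> q \<in> l \<and> q \<notin> s)"
    obtain p q where pq: "(SOME x. P x) = (p, q)" by (metis surj_pair)
    obtain p0 where p0: "p0 \<noteq> 0" "s = vec.span {p0}" using s(1) proj_points_iff by blast
    obtain q0 where q0: "q0 \<in> l" "q0 \<notin> vec.span {p0}" using proj_line_not_subset_point[OF l] by blast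
    have "P (p0, q0)" using p0 q0 by (simp add: P_def vec.span_base)
    then have "P (SOME x. P x)" by (rule someI)
    then have *: "p \<in> s" "p \<noteq> 0" "q \<in> l" "q \<notin> s" unfolding pq by (auto simp: P_def)
    obtain u where u: "p = \<phi> u" using surj * s by blast
    obtain w where w: "q = \<phi> w" using surj * s by blast
    have sp: "s = vec.span {\<phi> u}" using proj_point_eq_span[OF s(1)] *(1,2) u by blast
    have u0: "u \<noteq> 0" using *(2) u \<phi>0 by simp
    have D: "u $ 1 * w $ 2 - u $ 2 * w $ 1 \<noteq> 0" (is "?D \<noteq> 0") using par[OF u0] *(4) sp w by simp
    let ?a = "\<lambda>i. v i $ 1 * u $ 2 - v i $ 2 * u $ 1" and ?b = "\<lambda>i. v i $ 1 * w $ 2 - v i $ 2 * w $ 1"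
    have "form_app \<omega> (p + t *s q) q = (?D * c) * (\<Prod>i<k. ?a i + t * ?b i)" for t
    proof -
      have "form_app \<omega> (p + t *s q) q = form_app \<omega> (\<phi> (u + t *s w)) (\<phi> w)"
        by (simp add: u w \<phi>add \<phi>scale)
      also have "\<dots> = G (u + t *s w) * ?D" unfolding G(2) by (simp add: algebra_simps)
      also have "G (u + t *s w) = c * (\<Prod>i<k. ?a i + t * ?b i)"
        unfolding cv(3) by (intro arg_cong[of _ _ "\<lambda>x. c * x"] prod.cong) (simp_all add: algebra_simps)
      finally show ?thesis by simp
    qed
    moreover have "?a i \<noteq> 0 \<or> ?b i \<noteq> 0" if "i \<in> {..<k}" for i
    proof (rule ccontr)
      assume "\<not> ?thesis"
      then have "\<phi> u \<in> pt i" "\<phi> w \<in> pt i" "pt i \<in> proj_points"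
        using par[of "v i"] cv(2)[of i] that \<phi>0 unfolding pt_def proj_points_iff by auto
      then have "\<phi> w \<in> s" using proj_point_eq_span[of "pt i" "\<phi> u"] u0 \<phi>0 sp by auto
      then show False using * w by simp
    qed
    ultimately have "zorder (\<lambda>t. form_app \<omega> (p + t *s q) q) 0 = int (card {i\<in>{..<k}. ?a i = 0})"
      using zorder_prod_linear[of "{..<k}" "?D * c" ?a ?b] D cv(1) by simp
    also have "{i\<in>{..<k}. ?a i = 0} = {i\<in>{..<k}. pt i = s}"
    proof (intro Collect_cong conj_cong refl)
      fix i assume "i \<in> {..<k}"
      then have v0: "v i \<noteq> 0" using cv(2) by simp
      then have "pt i \<in> proj_points" using \<phi>0 unfolding pt_def proj_points_iff by blast
      then have "\<phi> u \<in> pt i \<longleftrightarrow> pt i = s"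
        using proj_point_eq_span[of "pt i" "\<phi> u"] u0 \<phi>0 sp vec.span_base[of "\<phi> u" "{\<phi> u}"] by auto
      then show "?a i = 0 \<longleftrightarrow> pt i = s" unfolding pt_def using par[OF v0] by simp
    qed
    finally show ?thesis unfolding tangency_order_def using pq by (simp add: P_def)
  qed
  have "{s. s \<in> proj_points \<and> s \<subseteq> l \<and> tangency_order \<omega> l s \<noteq> 0} = pt ` {..<k}"
  proof (intro equalityI subsetI)
    fix s assume "s \<in> {s. s \<in> proj_points \<and> s \<subseteq> l \<and> tangency_order \<omega> l s \<noteq> 0}"
    then have "card {i\<in>{..<k}. pt i = s} \<noteq> 0" using ord[of s] by auto
    then have "{i\<in>{..<k}. pt i = s} \<noteq> {}" by (metis card.empty)
    then show "s \<in> pt ` {..<k}" by auto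
  next
    fix s assume "s \<in> pt ` {..<k}"
    then obtain i where i: "i < k" "s = pt i" by auto
    have s: "s \<in> proj_points" using cv(2)[OF i(1)] \<phi>0 unfolding i pt_def proj_points_iff by blast
    have "s \<subseteq> l" unfolding i pt_def
      by (rule vec.span_minimal) (use \<phi>l l in \<open>auto simp: proj_lines_def\<close>)
    moreover have "card {j\<in>{..<k}. pt j = s} \<noteq> 0" using i by auto
    ultimately show "s \<in> {s. s \<in> proj_points \<and> s \<subseteq> l \<and> tangency_order \<omega> l s \<noteq> 0}"
      using s ord by simp
  qed
  note set = this
  have "number_of_tangencies \<omega> l = (\<Sum>s\<in>pt ` {..<k}. int (card {i\<in>{..<k}. pt i = s}))"
    unfolding number_of_tangencies_def set
    by (intro sum.cong refl ord) (use set in blast)+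
  also have "\<dots> = (\<Sum>s\<in>pt ` {..<k}. \<Sum>i | i \<in> {..<k} \<and> pt i = s. 1)" by simp
  also have "\<dots> = (\<Sum>i<k. 1)" by (rule sum.image_gen[symmetric]) simp
  finally show ?thesis by simp
qed

lemma homogeneous_form_degree_pos:
  assumes "homogeneous_form m \<omega>" "\<omega> x \<noteq> 0"
  shows "m > 0"
proof (rule ccontr)
  assume "\<not> m > 0"
  then have "m = 0" by simp
  then have "form_app \<omega> x v = form_app \<omega> v v" for v
    using hpoly_degree_0[OF hpoly_form_app[OF assms(1)]] by blast
  then have "form_app \<omega> x v = 0" for v using form_app_self[OF assms(1)] by simp
  moreover have "det3 (axis 1 1) (axis 2 1) (axis 3 1) \<noteq> 0" by (simp add: det3_def axis_def)
  ultimately show False using form_app_eq_0_imp[OF assms(1)] assms(2) by blast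
qed

lemma covector_line:
  assumes "a \<noteq> (0::complex^3)" shows "{x. (\<Sum>i\<in>UNIV. a $ i * x $ i) = 0} \<in> proj_lines"
proof -
  obtain e1 e2 e3 where "det3 e1 e2 e3 \<noteq> 0" "{x. (\<Sum>i\<in>UNIV. a $ i * x $ i) = 0} = vec.span {e1, e2}"
    by (rule covector_frame[OF assms])
  then show ?thesis using span2_proj_line(1) by simp
qed

text \<open>The line \<open>a\<^sup>\<bottom>\<close> contains the points \<open>a \<times> c\<close>, which makes non-invariance an algebraic condition on \<open>a\<close>.\<close>

lemma generic_number_of_tangencies:
  assumes hom: "homogeneous_form (Suc k) \<omega>" and nz: "\<omega> x0 \<noteq> 0"
  obtains n g a0 where "hpoly n g" "g a0 \<noteq> 0" "g 0 = 0"
    "\<And>a. g a \<noteq> 0 \<Longrightarrow> number_of_tangencies \<omega> {x. (\<Sum>i\<in>UNIV. a $ i * x $ i) = 0} = int k"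
proof -
  obtain i where "\<omega> x0 $ i \<noteq> 0" using nz by (metis vec_eq_iff zero_index)
  then have fv: "form_app \<omega> x0 (axis i 1) \<noteq> 0"
    by (simp add: form_app_def axis_def if_distrib[of "\<lambda>t. _ * t"] cong: if_cong)
  define v :: "complex^3" where "v = axis i 1"
  have "x0 \<noteq> 0" using form_app_scale_point[OF hom, of 0 0 v] fv by (auto simp: v_def)
  moreover have "v \<notin> vec.span {x0}"
    using fv form_app_self[OF hom, of x0] by (auto simp: mem_span1 v_def[symmetric] form_app_scale)
  ultimately obtain r where r: "det3 x0 v r = 1" using det3_nonzeroI by blast
  define g where "g a = form_app \<omega> (cross a (cross x0 r)) (cross a (cross v r))" for a
  have cr: "hpoly 1 (\<lambda>a. cross a c $ j)" for c j
  proof -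
    have "hpoly 1 (\<lambda>a::complex^3. a $ i' * c $ j' - a $ i'' * c $ j'')" for i' j' i'' j''
      by (intro hpoly_diff hpoly_mult'[OF hpoly_coord hpoly_const]) simp_all
    then show ?thesis using exhaust_3[of j] by (auto simp: cross_def)
  qed
  have "hpoly (Suc k + 1) g"
    unfolding g_def form_app_def
    using hom by (intro hpoly_sum hpoly_mult hpoly_subst[OF _ cr] cr) (auto simp: homogeneous_form_def)
  \<comment> \<open>For this \<open>a\<close> the two test points on the line are \<open>x0\<close>
    and \<open>v\<close> themselves, as \<open>det3 x0 v r = 1\<close>.\<close>
  moreover have "g (cross x0 v) \<noteq> 0"
  proof -
    have "cross (cross x0 v) (cross x0 r) = det3 x0 v r *s x0" "cross (cross x0 v) (cross v r) = det3 x0 v r *s v"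
      by (simp_all add: cross_def det3_def vec_eq_iff forall_3 algebra_simps)
    then show ?thesis using fv r by (simp add: g_def v_def)
  qed
  moreover have g0: "g 0 = 0"
  proof -
    have "cross 0 c = 0" for c by (simp add: cross_def vec_eq_iff forall_3)
    then show ?thesis by (simp add: g_def form_app_def)
  qed
  moreover have "number_of_tangencies \<omega> {x. (\<Sum>i\<in>UNIV. a $ i * x $ i) = 0} = int k" if "g a \<noteq> 0" for a
  proof -
    let ?l = "{x. (\<Sum>i\<in>UNIV. a $ i * x $ i) = 0}"
    have "a \<noteq> 0" using that g0 by auto
    then have l: "?l \<in> proj_lines" by (rule covector_line)
    have "cross a c \<in> ?l" for c by (simp add: cross_def sum_3 algebra_simps)
    then have "\<not> invariant_line \<omega> ?l" using that unfolding g_def invariant_line_def by blast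
    then show ?thesis using number_of_tangencies_eq[OF hom l] by blast
  qed
  ultimately show thesis using that by blast
qed

text \<open>The polynomial of the definition and that of \<open>generic_number_of_tangencies\<close>
  are nonzero at a common \<open>a\<close>, where the two counts must agree.\<close>

lemma foliation_degree_iff:
  assumes hom: "homogeneous_form m \<omega>" and fin: "finite {s. singular_point \<omega> s}"
  shows "foliation_degree \<omega> d \<longleftrightarrow> m = Suc d"
proof -
  obtain x0 where x0: "\<omega> x0 \<noteq> 0" using foliation_nonzero[OF fin] by (metis zero_index)
  obtain k where k: "m = Suc k" using homogeneous_form_degree_pos[OF hom x0] by (cases m) auto
  obtain n g a0 where g: "hpoly n g" "g a0 \<noteq> 0" "g 0 = 0"
    "\<And>a. g a \<noteq> 0 \<Longrightarrow> number_of_tangencies \<omega> {x. (\<Sum>i\<in>UNIV. a $ i * x $ i) = 0} = int k"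
    by (rule generic_number_of_tangencies[OF hom[unfolded k] x0]) (rule that)
  show ?thesis
  proof
    assume "foliation_degree \<omega> d"
    then obtain h a1 where h: "polynomial_fun h" "h a1 \<noteq> 0"
      "\<And>a. a \<noteq> 0 \<Longrightarrow> h a \<noteq> 0 \<Longrightarrow> number_of_tangencies \<omega> {x. (\<Sum>i\<in>UNIV. a $ i * x $ i) = 0} = int d"
      unfolding foliation_degree_def by blast
    obtain a where "g a \<noteq> 0" "h a \<noteq> 0"
      using linepoly_common_nonzero[OF linepoly_hpoly[OF g(1)] linepoly_polynomial_fun[OF h(1)], of UNIV a0 a1]
        g(2) h(2) by auto
    then have "int k = int d" using g(4)[of a] h(3)[of a] g(3) by auto
    then show "m = Suc d" using k by simp
  next
    assume "m = Suc d"
    then show "foliation_degree \<omega> d"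
      unfolding foliation_degree_def using g hpoly_imp_polynomial_fun[OF g(1)] k by blast
  qed
qed

text \<open>A common divisor \<open>h\<close> has no zero off the origin. Two independent vectors
  are joined by a line missing the origin, on which \<open>h\<close> is a polynomial without roots,
  hence constant. The value at the origin follows by restricting to a line through it.\<close>

lemma poly_coprimeI:
  fixes A B :: "complex^2 \<Rightarrow> complex"
  assumes nz: "\<And>u. u \<noteq> 0 \<Longrightarrow> A u \<noteq> 0 \<or> B u \<noteq> 0"
  shows "poly_coprime A B"
  unfolding poly_coprime_def
proof (intro allI impI, elim conjE)
  fix h assume h: "polynomial_fun h" and d: "poly_divides h A" "poly_divides h B"
  have lp: "linepoly h" using linepoly_polynomial_fun[OF h] .
  have hn: "h u \<noteq> 0" if "u \<noteq> 0" for u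
    using nz[OF that] d unfolding poly_divides_def by (metis mult_zero_left)
  have indep: "h x = h y" if "x $ 1 * y $ 2 - x $ 2 * y $ 1 \<noteq> 0" for x y
  proof -
    obtain P where P: "\<And>t. h (x + t *s (y - x)) = poly P t" using lp unfolding linepoly_def by metis
    have "x + t *s (y - x) \<noteq> 0" for t
    proof
      assume "x + t *s (y - x) = 0"
      then have "x $ 1 + t * (y $ 1 - x $ 1) = 0" "x $ 2 + t * (y $ 2 - x $ 2) = 0"
        by (simp_all add: vec_eq_iff forall_2 algebra_simps)
      then have "x $ 1 * y $ 2 - x $ 2 * y $ 1 = 0" by algebra
      then show False using that by simp
    qed
    then have "poly P t \<noteq> 0" for t using P[of t] hn by metis
    then obtain b where "P = [:b:]" using fundamental_theorem_of_algebra_alt[of P] by blast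
    then have "poly P 0 = poly P 1" by simp
    then show ?thesis using P[of 0] P[of 1] by simp
  qed
  let ?e1 = "vector [1, 0] :: complex^2" and ?e2 = "vector [0, 1] :: complex^2"
  have e12: "h ?e1 = h ?e2" by (rule indep) simp
  have const: "h u = h ?e1" if "u \<noteq> 0" for u
  proof (cases "u $ 2 = 0")
    case True
    then have "u $ 1 \<noteq> 0" using that by (auto simp: vec_eq_iff forall_2)
    then have "h u = h ?e2" by (intro indep) simp
    then show ?thesis using e12 by simp
  qed (intro indep, simp)
  have "h 0 = h ?e1"
  proof -
    obtain P where P: "\<And>t. h (0 + t *s ?e1) = poly P t" using lp unfolding linepoly_def by metis
    have "t *s ?e1 \<noteq> 0" if "t \<noteq> 0" for t using that by (simp add: vec_eq_iff forall_2)
    then have "poly (P - [:h ?e1:]) t = 0" if "t \<noteq> 0" for t using const[of "t *s ?e1"] P[of t] that by simp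
    then have "UNIV - {0} \<subseteq> {t. poly (P - [:h ?e1:]) t = 0}" by auto
    moreover have "infinite (UNIV - {0::complex})" using infinite_UNIV_char_0 by (rule infinite_remove)
    ultimately have "P - [:h ?e1:] = 0" using poly_roots_finite finite_subset by blast
    then show ?thesis using P[of 0] by simp
  qed
  then have "\<forall>x. h x = h ?e1" using const by metis
  moreover have "h ?e1 \<noteq> 0" by (rule hn) (simp add: vec_eq_iff forall_2)
  ultimately show "\<exists>c. c \<noteq> 0 \<and> (\<forall>x. h x = c)" by blast
qed

subsection \<open>Degeneration along an invariant line\<close>

text \<open>The form at \<open>p\<close> vanishes on two distinct planes, which together span the
  space.\<close>

lemma invariant_lines_meet_singular:
  assumes hom: "homogeneous_form m \<omega>" and l: "invariant_line \<omega> l" "invariant_line \<omega> l'" "l \<noteq> l'"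
    and p: "p \<in> l" "p \<in> l'" "p \<noteq> 0"
  shows "\<omega> p = 0"
proof -
  have pl: "l \<in> proj_lines" "l' \<in> proj_lines" using l by (auto simp: invariant_line_def)
  obtain q where q: "q \<in> l" "q \<notin> vec.span {p}" using proj_line_not_subset_point[OF pl(1)] .
  have lf: "l = {x. det3 p q x = 0}" using proj_line_frame[OF pl(1) p(1,3) q] by metis
  obtain r where r: "r \<in> l'" "r \<notin> l" using proj_line_eqI[OF pl(2,1)] l(3) by blast
  have "det3 p q r \<noteq> 0" using r(2) unfolding lf by simp
  moreover have "form_app \<omega> p p = 0" "form_app \<omega> p q = 0" "form_app \<omega> p r = 0"
    using l p q(1) r(1) unfolding invariant_line_def by blast+
  ultimately show ?thesis by (rule form_app_eq_0_imp[OF hom])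
qed

text \<open>By Euler and \<open>jac_radial\<close> the cross terms are multiples of
  \<open>form_app \<omega> x w\<close>. A tangent vector may thus be moved along \<open>x\<close>
  until it lies in a given line.\<close>

lemma jac_shift:
  assumes hom: "homogeneous_form m \<omega>" and w: "form_app \<omega> x w = 0"
  shows "jac \<omega> x (w + k *s x) (w + k *s x) = jac \<omega> x w w"
proof -
  have "form_app \<omega> x x = 0" by (rule form_app_self[OF hom])
  then show ?thesis
    by (simp add: jac_add_left[OF hom] jac_add_right[OF hom] jac_scale_left[OF hom] jac_scale_right[OF hom]
        jac_euler[OF hom] jac_radial[OF hom] form_app_add form_app_scale w)
qed

text \<open>The frame chosen by \<open>SOME\<close> depends only on \<open>l\<close> and
  \<open>s\<close>, so it is the same for both forms and the two integrands coincide.\<close>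

lemma camacho_sad_cong:
  assumes l: "l \<in> proj_lines" and s: "s \<in> proj_points" "s \<subseteq> l"
    and hom: "homogeneous_form m \<omega>" "homogeneous_form n \<eta>"
    and form: "\<And>x v. x \<in> l \<Longrightarrow> form_app \<omega> x v = form_app \<eta> x v"
    and jac: "\<And>x q r. x \<in> l \<Longrightarrow> q \<in> l \<Longrightarrow> jac \<omega> x r q = jac \<eta> x r q"
  shows "camacho_sad \<omega> l s = camacho_sad \<eta> l s"
proof -
  define P where "P = (\<lambda>(p, q, r). p \<in> s \<and> p \<noteq> 0 \<and> q \<in> l \<and> q \<notin> s \<and> r \<notin> l)"
  obtain p0 where p0: "p0 \<noteq> 0" "s = vec.span {p0}" using s(1) proj_points_iff by blast
  obtain q0 where q0: "q0 \<in> l" "q0 \<notin> s" using proj_line_not_subset_point[OF l] p0(2) by blast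
  obtain e1 e2 r0 where "det3 e1 e2 r0 = 1" "l = {x. det3 e1 e2 x = 0}" by (rule proj_line_basis[OF l])
  then have "r0 \<notin> l" by simp
  then have "P (p0, q0, r0)" using p0 q0 by (simp add: P_def vec.span_base)
  then have "P (SOME x. P x)" by (rule someI)
  moreover obtain p q r where e: "(SOME x. P x) = (p, q, r)" by (metis surj_pair)
  ultimately have *: "p \<in> s" "q \<in> l" by (auto simp: P_def)
  have "p + u *s q \<in> l" for u
    using l s(2) * by (auto simp: proj_lines_def intro!: vec.subspace_add vec.subspace_scale)
  note pl = this
  have d: "deriv (\<lambda>v. snd (chart_field \<theta> p q r (u, v))) 0 = - jac \<theta> (p + u *s q) r q"
    if "homogeneous_form k \<theta>" for k \<theta> u
    unfolding chart_field_def jac_def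
    by (auto simp: Let_def intro!: DERIV_imp_deriv derivative_eq_intros hpoly_line_derivative_0 hpoly_form_app[OF that])
  have "(\<lambda>u. deriv (\<lambda>v. snd (chart_field \<omega> p q r (u, v))) 0 / fst (chart_field \<omega> p q r (u, 0)))
      = (\<lambda>u. deriv (\<lambda>v. snd (chart_field \<eta> p q r (u, v))) 0 / fst (chart_field \<eta> p q r (u, 0)))"
    unfolding d[OF hom(1)] d[OF hom(2)]
    using form[OF pl] jac[OF pl *(2)] by (simp add: chart_field_def Let_def)
  then show ?thesis unfolding camacho_sad_def using e by (simp add: P_def Let_def)
qed

context line_adapted_form
begin

text \<open>The quotient of the inflection polynomial by the equation of the line, written in
  components.\<close>

definition inflection_factor :: "complex^3 \<Rightarrow> complex" where
  "inflection_factor x = A x * dir_deriv B x (field x) - B x * dir_deriv A x (field x)"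

lemma inflection_poly_field: "inflection_poly field x = det3 e1 e2 x * inflection_factor x"
proof -
  have "vec_deriv field x w = dir_deriv B x w *s e1 + (- dir_deriv A x w) *s e2 + 0 *s e3" for x w
  proof -
    have "dir_deriv (\<lambda>x. field x $ j) x w = e1 $ j * dir_deriv B x w - e2 $ j * dir_deriv A x w" for j
      unfolding field_def
      by (rule dir_deriv_eqI)
         (auto intro!: derivative_eq_intros hpoly_line_derivative_0[OF A] hpoly_line_derivative_0[OF B])
    then show ?thesis by (simp add: vec_deriv_def vec_eq_iff mult.commute)
  qed
  then have V: "accel field x = dir_deriv B x (field x) *s e1 + (- dir_deriv A x (field x)) *s e2 + 0 *s e3"
    by (simp add: accel_def)
  have "inflection_poly field x = det3 (det3 x e2 e3 *s e1 + det3 e1 x e3 *s e2 + det3 e1 e2 x *s e3)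
      (B x *s e1 + (- A x) *s e2 + 0 *s e3)
      (dir_deriv B x (field x) *s e1 + (- dir_deriv A x (field x)) *s e2 + 0 *s e3)"
    unfolding inflection_poly_def V using frame_expand[OF frame, of x] by (simp add: field_def)
  also have "\<dots> = det3 e1 e2 x * inflection_factor x"
    unfolding det3_expand inflection_factor_def by (simp add: frame algebra_simps)
  finally show ?thesis .
qed

text \<open>The factor is a constant times the product of the other invariant lines. This is
  obtained by cancelling the equation of the line, so it also holds on the line itself, where it is
  applied.\<close>

lemma inflection_factor_zero:
  assumes d: "d > 0" and fin: "finite {s. singular_point \<omega> s}"
    and card: "card {l. invariant_line \<omega> l} = 3 * d" and x: "inflection_factor x = 0"
  shows "\<exists>l'. l' \<noteq> vec.span {e1, e2} \<and> invariant_line \<omega> l' \<and> x \<in> l'"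
proof -
  let ?l = "vec.span {e1, e2}" and ?S = "{l. invariant_line \<omega> l}"
  obtain c where c: "c \<noteq> 0" "\<And>x. inflection_poly field x = c * (\<Prod>l\<in>?S. line_eq l x)"
    using inflection_poly_product[OF tangent_field d fin card] by blast
  have S: "finite ?S" using card d by (auto intro: card_ge_0_finite)
  define k where "k = line_eq ?l e3"
  have k: "line_eq ?l x = k * det3 e1 e2 x" for x
  proof -
    have "line_eq ?l e1 = 0" "line_eq ?l e2 = 0"
      using line_eq_iff[OF line(1)] by (simp_all add: vec.span_base)
    then show ?thesis
      by (subst frame_expand[OF frame, of x]) (simp add: line_eq_add line_eq_scale k_def)
  qed
  have "k \<noteq> 0" using line_eq_iff[OF line(1), of e3] frame unfolding line(2) k_def by simp
  have split: "(\<Prod>l\<in>?S. line_eq l x) = line_eq ?l x * (\<Prod>l\<in>?S - {?l}. line_eq l x)" for x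
    using invariant by (intro prod.remove[OF S]) simp
  let ?f = "\<lambda>x. inflection_factor x - c * k * (\<Prod>l\<in>?S - {?l}. line_eq l x)"
  have F: "\<And>j. hpoly d (\<lambda>x. field x $ j)" using tangent_field by (simp add: tangent_field_def)
  have "linepoly inflection_factor"
    unfolding inflection_factor_def
    by (intro linepoly_diff linepoly_mult linepoly_hpoly[OF A] linepoly_hpoly[OF B]
        linepoly_hpoly[OF hpoly_dir_deriv_vector[OF A F refl]] linepoly_hpoly[OF hpoly_dir_deriv_vector[OF B F refl]])
  then have lp: "linepoly ?f"
    by (intro linepoly_diff linepoly_mult linepoly_const linepoly_prod linepoly_hpoly[OF hpoly_line_eq])
  have "det3 e1 e2 x * ?f x = 0" for x
    using c(2)[of x] unfolding inflection_poly_field split k by (simp add: algebra_simps)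
  from linepoly_cancel[OF linepoly_hpoly[OF hpoly_det3_linear(1)] lp this, of e3]
  have "?f x = 0" using frame by simp
  then have "(\<Prod>l\<in>?S - {?l}. line_eq l x) = 0" using x c(1) \<open>k \<noteq> 0\<close> by simp
  then obtain l' where l': "l' \<in> ?S - {?l}" "line_eq l' x = 0" using S by (auto simp: prod_zero_iff)
  then have "x \<in> l'" using line_eq_iff[of l' x] by (auto simp: invariant_line_def)
  with l' show ?thesis by blast
qed

text \<open>A common zero on the line would be a singular point with a vanishing off-diagonal entry
  of \<open>jac\<close>, against non-degeneracy. Coprimality and isolated singularities of the
  degeneration rest on this.\<close>

lemma components_nonzero:
  assumes d: "d > 0" and fin: "finite {s. singular_point \<omega> s}"
    and card: "card {l. invariant_line \<omega> l} = 3 * d" and x: "det3 e1 e2 x = 0" "x \<noteq> 0"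
  shows "A x \<noteq> 0 \<or> B x \<noteq> 0"
proof (rule ccontr)
  assume "\<not> ?thesis"
  then have AB: "A x = 0" "B x = 0" by auto
  let ?l = "vec.span {e1, e2}" and ?s = "vec.span {x}"
  have "form_app \<omega> x v = 0" for v unfolding form by (simp add: AB)
  then have "\<omega> x = 0" using form_app_eq_0_imp[OF homogeneous_form, of e1 e2 e3] frame by simp
  then have s: "singular_point \<omega> ?s" by (rule singular_point_span[OF homogeneous_form x(2)])
  have nd: "nondegenerate \<omega> ?s" by (rule reduced_convex_singular_point(1)[OF homogeneous_form d fin card s])
  have sl: "?s \<subseteq> ?l" unfolding line(2) using x(1) by (auto simp: mem_span1 det3_scale)
  have xs: "x \<in> ?s" by (simp add: vec.span_base)
  obtain q where q: "q \<in> ?l" "q \<notin> ?s" using proj_line_not_subset_point[OF line(1)] .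
  have "e3 \<notin> ?l" unfolding line(2) using frame by simp
  then have "jac \<omega> x e3 q \<noteq> 0"
    by (rule nondegenerate_jac_nonzero(2)[OF homogeneous_form invariant nd sl xs x(2) q])
  then show False using jac_on_line[of x q e3] x(1) q(1) AB unfolding line(2) by simp
qed

text \<open>The projection onto the line from the point of \<open>e3\<close>, which is the origin of
  the affine chart.\<close>

definition proj :: "complex^3 \<Rightarrow> complex^3" where
  "proj x = det3 x e2 e3 *s e1 + det3 e1 x e3 *s e2"

lemma hpoly_proj: "hpoly 1 (\<lambda>x. proj x $ i)"
proof -
  have "hpoly 1 (\<lambda>x. e1 $ i * det3 x e2 e3 + e2 $ i * det3 e1 x e3)"
    by (intro hpoly_add hpoly_cmult hpoly_det3_linear)
  then show ?thesis by (simp add: proj_def mult.commute)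
qed

lemma proj_on_line: "det3 e1 e2 x = 0 \<Longrightarrow> proj x = x"
  using frame_expand[OF frame, of x] by (simp add: proj_def)

lemma proj_coords: "det3 e1 e2 (proj x) = 0" "det3 (proj x) e2 e3 = det3 x e2 e3" "det3 e1 (proj x) e3 = det3 e1 x e3"
  by (simp_all add: proj_def det3_simps frame)

lemma proj_decomp: "x = proj x + det3 e1 e2 x *s e3"
  using frame_expand[OF frame, of x] by (simp add: proj_def)

text \<open>As the frame has determinant 1, the cross products are its dual basis, the differentials
  \<open>dx\<close>, \<open>dy\<close>, \<open>dz\<close> in this order.\<close>

definition degeneration :: one_form where
  "degeneration x = det3 e1 e2 x *s (A (proj x) *s cross e2 e3 + B (proj x) *s cross e3 e1)
     - (A (proj x) * det3 x e2 e3 + B (proj x) * det3 e1 x e3) *s cross e1 e2"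

lemma line_adapted_degeneration:
  "line_adapted_form d degeneration e1 e2 e3 (\<lambda>x. A (proj x)) (\<lambda>x. B (proj x))"
proof
  show "hpoly d (\<lambda>x. A (proj x))" "hpoly d (\<lambda>x. B (proj x))"
    by (rule hpoly_subst[OF A hpoly_proj] hpoly_subst[OF B hpoly_proj])+
  have lin: "(\<Sum>i\<in>UNIV. (a *s (b *s u + c *s w) - k *s z) $ i * v $ i)
      = a * (b * (\<Sum>i\<in>UNIV. u $ i * v $ i) + c * (\<Sum>i\<in>UNIV. w $ i * v $ i)) - k * (\<Sum>i\<in>UNIV. z $ i * v $ i)"
    for a b c k and u v w z :: "complex^3"
    by (simp add: sum_3 algebra_simps)
  show "form_app degeneration x v = det3 e1 e2 x * (A (proj x) * det3 v e2 e3 + B (proj x) * det3 e1 v e3)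
        - (A (proj x) * det3 x e2 e3 + B (proj x) * det3 e1 x e3) * det3 e1 e2 v" for x v
    unfolding form_app_def degeneration_def lin sum_cross
    by (simp add: det3_cycle[of e2 e3 v] det3_cycle[of e1 v e3])
qed (rule frame)

end

text \<open>Convexity is the point. An inflection point \<open>x\<close> of \<open>\<eta>\<close>
  projects from \<open>e3\<close> to a point \<open>y\<close> of the line where the inflection
  factor vanishes. Then \<open>y\<close> is singular for \<open>\<omega>\<close>, the line joining
  \<open>e3\<close> and \<open>y\<close> is invariant by \<open>\<eta>\<close>, and \<open>x\<close>
  lies on it.\<close>

lemma reduced_convex_degeneration:
  assumes L: "line_adapted_form d \<omega> e1 e2 e3 A B" and d: "d > 0" and fin: "finite {s. singular_point \<omega> s}"
    and card: "card {l. invariant_line \<omega> l} = 3 * d"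
  obtains \<eta> where "homogeneous_foliation d (vec.span {e1, e2}) \<eta>" "convex_foliation \<eta>"
    "\<And>s. s \<subseteq> vec.span {e1, e2} \<Longrightarrow> singular_point \<omega> s \<Longrightarrow>
       singular_point \<eta> s \<and> camacho_sad \<eta> (vec.span {e1, e2}) s = camacho_sad \<omega> (vec.span {e1, e2}) s"
proof -
  interpret F: line_adapted_form d \<omega> e1 e2 e3 A B by (rule L)
  let ?\<eta> = F.degeneration and ?l = "vec.span {e1, e2}"
  interpret H: line_adapted_form d ?\<eta> e1 e2 e3 "\<lambda>x. A (F.proj x)" "\<lambda>x. B (F.proj x)"
    by (rule F.line_adapted_degeneration)
  have same: "?\<eta> x = \<omega> x" if "det3 e1 e2 x = 0" for x
  proof -
    have "form_app ?\<eta> x v = form_app \<omega> x v" for v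
      unfolding H.form F.form F.proj_on_line[OF that] ..
    then have "form_app (\<lambda>x. ?\<eta> x - \<omega> x) x v = 0" for v
      by (simp add: form_app_def left_diff_distrib sum_subtractf)
    then have "form_app (\<lambda>x. ?\<eta> x - \<omega> x) x (axis i 1) = 0" for i by blast
    then show ?thesis
      by (simp add: form_app_def vec_eq_iff axis_def if_distrib[of "\<lambda>t. _ * t"] cong: if_cong)
  qed
  note nz = F.components_nonzero[OF d fin card]
  \<comment> \<open>Off the line a singular point has \<open>A = B = 0\<close> at its projection, so
    the projection is 0 and the point is the origin of the chart.\<close>
  have sing: "s = vec.span {e3} \<or> singular_point \<omega> s" if s: "singular_point ?\<eta> s" for s
  proof -
    obtain p where p: "p \<noteq> 0" "s = vec.span {p}" using s unfolding singular_point_def proj_points_iff by blast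
    have wp: "?\<eta> p = 0" using s p by (simp add: singular_point_def vec.span_base)
    show ?thesis
    proof (cases "det3 e1 e2 p = 0")
      case True
      then have "\<omega> p = 0" using same wp by simp
      then show ?thesis using singular_point_span[OF F.homogeneous_form p(1)] p(2) by simp
    next
      case False
      have "form_app ?\<eta> p e1 = 0" "form_app ?\<eta> p e2 = 0" using wp by (simp_all add: form_app_zero)
      then have "A (F.proj p) = 0" "B (F.proj p) = 0" using False unfolding H.form by (simp_all add: F.frame)
      then have "F.proj p = 0" using nz[of "F.proj p"] F.proj_coords(1) by blast
      then have "p = det3 e1 e2 p *s e3" using F.proj_decomp[of p] by simp
      then have "p \<in> vec.span {e3}" unfolding mem_span1 by blast
      moreover have "e3 \<noteq> 0" using F.frame by auto
      ultimately have "vec.span {e3} = vec.span {p}"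
        using proj_point_eq_span[of "vec.span {e3}" p] p(1) proj_points_iff by blast
      then show ?thesis using p(2) by simp
    qed
  qed
  have finH: "finite {s. singular_point ?\<eta> s}"
    by (rule finite_subset[of _ "insert (vec.span {e3}) {s. singular_point \<omega> s}"]) (use sing fin in auto)
  have fol: "foliation ?\<eta>" unfolding foliation_iff using H.homogeneous_form finH by blast
  have deg: "foliation_degree ?\<eta> d" using foliation_degree_iff[OF H.homogeneous_form finH] by simp
  define \<phi> where "\<phi> u = u $ 1 *s e1 + u $ 2 *s e2" for u :: "complex^2"
  have \<phi>: "hpoly 1 (\<lambda>u. \<phi> u $ i)" for i
    unfolding \<phi>_def
    using hpoly_add[OF hpoly_mult'[OF hpoly_coord hpoly_const] hpoly_mult'[OF hpoly_coord hpoly_const], of 1 "1::2" "e1 $ i" 2 "e2 $ i"]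
    by simp
  have comps: "homogeneous_fun d (\<lambda>u. A (\<phi> u)) \<and> homogeneous_fun d (\<lambda>u. B (\<phi> u)) \<and>
      poly_coprime (\<lambda>u. A (\<phi> u)) (\<lambda>u. B (\<phi> u)) \<and>
      (\<forall>x y. form_app ?\<eta> (x *s e1 + y *s e2 + e3) e1 = A (\<phi> (vector [x, y])) \<and>
             form_app ?\<eta> (x *s e1 + y *s e2 + e3) e2 = B (\<phi> (vector [x, y])))"
  proof (intro conjI allI)
    show "homogeneous_fun d (\<lambda>u. A (\<phi> u))" "homogeneous_fun d (\<lambda>u. B (\<phi> u))"
      unfolding homogeneous_fun_iff_hpoly by (rule hpoly_subst[OF F.A \<phi>] hpoly_subst[OF F.B \<phi>])+
    show "poly_coprime (\<lambda>u. A (\<phi> u)) (\<lambda>u. B (\<phi> u))"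
    proof (rule poly_coprimeI)
      fix u :: "complex^2" assume u: "u \<noteq> 0"
      have c: "det3 (\<phi> u) e2 e3 = u $ 1" "det3 e1 (\<phi> u) e3 = u $ 2" "det3 e1 e2 (\<phi> u) = 0"
        by (simp_all add: \<phi>_def det3_simps F.frame)
      have "\<phi> u \<noteq> 0"
      proof
        assume "\<phi> u = 0"
        then have "u $ 1 = 0" "u $ 2 = 0" using c(1,2) by simp_all
        then show False using u by (simp add: vec_eq_iff forall_2)
      qed
      then show "A (\<phi> u) \<noteq> 0 \<or> B (\<phi> u) \<noteq> 0" using nz c(3) by blast
    qed
    fix x y
    have "F.proj (x *s e1 + y *s e2 + e3) = \<phi> (vector [x, y])"
      by (simp add: F.proj_def \<phi>_def det3_simps F.frame)
    then show "form_app ?\<eta> (x *s e1 + y *s e2 + e3) e1 = A (\<phi> (vector [x, y]))"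
      "form_app ?\<eta> (x *s e1 + y *s e2 + e3) e2 = B (\<phi> (vector [x, y]))"
      unfolding H.form by (simp_all add: det3_simps F.frame)
  qed
  have "\<exists>A B :: complex^2 \<Rightarrow> complex. homogeneous_fun d A \<and> homogeneous_fun d B \<and> poly_coprime A B \<and>
      (\<forall>x y. form_app ?\<eta> (x *s e1 + y *s e2 + e3) e1 = A (vector [x, y]) \<and>
             form_app ?\<eta> (x *s e1 + y *s e2 + e3) e2 = B (vector [x, y]))"
    by (rule exI[of _ "\<lambda>u. A (\<phi> u)"], rule exI[of _ "\<lambda>u. B (\<phi> u)"]) (rule comps)
  moreover have "vec.span {e1, e2, e3} = UNIV" using F.frame by (simp add: span3_iff_det3)
  ultimately have hom: "homogeneous_foliation d ?l ?\<eta>"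
    unfolding homogeneous_foliation_def using fol deg by blast
  \<comment> \<open>A zero \<open>y\<close> of the tangent cone \<open>x A + y B\<close> spans with
    \<open>e3\<close> an invariant line.\<close>
  have lines: "form_app ?\<eta> u v = 0"
    if y: "det3 e1 e2 y = 0" "A y * det3 y e2 e3 + B y * det3 e1 y e3 = 0"
      and uv: "u \<in> vec.span {e3, y}" "v \<in> vec.span {e3, y}" for u v y
  proof -
    obtain a b a' b' where ab: "u = a *s e3 + b *s y" "v = a' *s e3 + b' *s y"
      using uv unfolding mem_span2 by blast
    have pu: "F.proj u = b *s y"
      using F.proj_on_line[OF y(1)] unfolding ab F.proj_def by (simp add: det3_simps vector_add_ldistrib vector_smult_assoc F.frame) (metis F.proj_def vector_add_ldistrib vector_smult_assoc)
    have "form_app ?\<eta> u v = (a * b' - a' * b) * b ^ d * (A y * det3 y e2 e3 + B y * det3 e1 y e3)"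
      unfolding H.form pu hpoly_scale[OF F.A] hpoly_scale[OF F.B] unfolding ab
      by (simp add: det3_simps F.frame y(1) algebra_simps)
    then show ?thesis using y(2) by simp
  qed
  have conv: "convex_foliation ?\<eta>"
    unfolding convex_foliation_def
  proof (intro ballI impI notI, elim conjE)
    fix s assume s: "s \<in> proj_points" "\<not> singular_point ?\<eta> s" "\<not> straight_leaf ?\<eta> s" "inflection_point ?\<eta> s"
    obtain x w where x: "s = vec.span {x}" "x \<noteq> 0" "w \<notin> vec.span {x}" "form_app ?\<eta> x w = 0" "jac ?\<eta> x w w = 0"
      by (rule inflection_pointE[OF H.homogeneous_form s(4)])
    have x3: "det3 e1 e2 x \<noteq> 0"
    proof
      assume "det3 e1 e2 x = 0"
      then have "s \<subseteq> ?l" unfolding x(1) F.line(2) by (auto simp: mem_span1 det3_scale)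
      then show False using straight_leafI[OF H.homogeneous_form H.invariant] s(3) by blast
    qed
    let ?z = "det3 e1 e2 x"
    define y where "y = F.proj x"
    have xy: "x = y + ?z *s e3" unfolding y_def by (rule F.proj_decomp)
    have y3: "det3 e1 e2 y = 0" unfolding y_def by (rule F.proj_coords(1))
    have yc: "det3 y e2 e3 = det3 x e2 e3" "det3 e1 y e3 = det3 e1 x e3" unfolding y_def by (rule F.proj_coords)+
    have y0: "y \<noteq> 0"
    proof
      assume y: "y = 0"
      have "A 0 = 0" "B 0 = 0"
        using hpoly_scale[OF F.A, of 0 0] hpoly_scale[OF F.B, of 0 0] d by (simp_all add: power_0_left)
      then have "form_app ?\<eta> x v = 0" for v unfolding H.form y_def[symmetric] y by simp
      then have "?\<eta> x = 0" using form_app_eq_0_imp[OF H.homogeneous_form, of e1 e2 e3] F.frame by simp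
      then show False using singular_point_span[OF H.homogeneous_form x(2)] s(2) x(1) by simp
    qed
    \<comment> \<open>Chosen so that \<open>w'\<close> spans the intersection of the tangent line at
      \<open>x\<close> with the line at infinity.\<close>
    define k where "k = - (det3 e1 e2 w / ?z)"
    define w' where "w' = w + k *s x"
    have w'3: "det3 e1 e2 w' = 0" using x3 by (simp add: w'_def k_def det3_simps)
    have w'0: "w' \<noteq> 0"
    proof
      assume "w' = 0"
      then have "w = (- k) *s x" unfolding w'_def by (simp add: eq_neg_iff_add_eq_0 vector_smult_lneg)
      then show False using x(3) unfolding mem_span1 by blast
    qed
    have jw': "jac ?\<eta> x w' w' = 0" unfolding w'_def using jac_shift[OF H.homogeneous_form x(4)] x(5) by simp
    have fw': "form_app ?\<eta> x w' = 0"
      unfolding w'_def form_app_add form_app_scale using x(4) form_app_self[OF H.homogeneous_form] by simp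
    let ?a = "det3 w' e2 e3" and ?b = "det3 e1 w' e3"
    have ab: "A y * ?a + B y * ?b = 0"
      using fw' x3 unfolding H.form y_def[symmetric] w'3 by simp
    \<comment> \<open>The pair of coordinates of \<open>w'\<close> is orthogonal to the nonzero pair
      \<open>A y\<close>, \<open>B y\<close>, hence proportional to \<open>B y\<close>,
      \<open>- A y\<close>.\<close>
    have "\<exists>\<sigma>. ?a = \<sigma> * B y \<and> ?b = - (\<sigma> * A y)"
    proof (cases "A y = 0")
      case True
      then show ?thesis using nz[OF y3 y0] ab by (intro exI[of _ "?a / B y"]) auto
    next
      case False
      then show ?thesis using ab by (intro exI[of _ "- (?b / A y)"]) (auto simp: field_simps eq_neg_iff_add_eq_0)
    qed
    then obtain \<sigma> where \<sigma>: "?a = \<sigma> * B y" "?b = - (\<sigma> * A y)" by blast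
    have w'f: "w' = \<sigma> *s F.field y"
      using frame_expand[OF F.frame, of w'] unfolding \<sigma> w'3 F.field_def
      by (simp add: vector_add_ldistrib vector_smult_assoc vector_smult_lneg)
    have \<sigma>0: "\<sigma> \<noteq> 0" using w'0 w'f by auto
    \<comment> \<open>Moving along \<open>w'\<close> keeps the third coordinate fixed and shifts the
      projection by \<open>t *s w'\<close>, so only \<open>A\<close> and \<open>B\<close> are
      differentiated.\<close>
    have "jac ?\<eta> x w' w' = ?z * (dir_deriv A y w' * ?a + dir_deriv B y w' * ?b)"
      unfolding jac_def
    proof (rule dir_deriv_eqI)
      have p: "F.proj (x + t *s w') = y + t *s w'" for t
        using F.proj_on_line[OF w'3] unfolding y_def F.proj_def
        by (simp add: det3_simps vec_eq_iff algebra_simps) (metis add.commute distrib_left)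
      have z: "det3 e1 e2 (x + t *s w') = ?z" for t by (simp add: det3_simps w'3)
      show "((\<lambda>t. form_app ?\<eta> (x + t *s w') w') has_field_derivative
          ?z * (dir_deriv A y w' * ?a + dir_deriv B y w' * ?b)) (at 0)"
        unfolding H.form p z w'3
        by (auto intro!: derivative_eq_intros hpoly_line_derivative_0[OF F.A] hpoly_line_derivative_0[OF F.B])
    qed
    also have "\<dots> = - (?z * \<sigma>\<^sup>2 * F.inflection_factor y)"
      unfolding \<sigma> unfolding w'f F.inflection_factor_def hpoly_dir_deriv_scale[OF F.A] hpoly_dir_deriv_scale[OF F.B]
      by (simp add: algebra_simps power2_eq_square)
    finally have "F.inflection_factor y = 0" using jw' x3 \<sigma>0 by simp
    then obtain l' where l': "l' \<noteq> ?l" "invariant_line \<omega> l'" "y \<in> l'"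
      using F.inflection_factor_zero[OF d fin card] by blast
    have yl: "y \<in> ?l" unfolding F.line(2) using y3 by simp
    have "\<omega> y = 0"
      using invariant_lines_meet_singular[OF F.homogeneous_form F.invariant l'(2) l'(1)[symmetric] yl l'(3) y0] .
    then have "form_app \<omega> y e3 = 0" by (simp add: form_app_zero)
    then have C: "A y * det3 y e2 e3 + B y * det3 e1 y e3 = 0" unfolding F.form
      by (simp only: y3 F.frame mult_zero_left diff_0 mult_1_right neg_equal_0_iff_equal)
    have "y \<notin> vec.span {e3}"
    proof
      assume "y \<in> vec.span {e3}"
      then obtain c where "y = c *s e3" by (auto simp: mem_span1)
      then show False using y3 y0 F.frame by (simp add: det3_scale)
    qed
    moreover have "e3 \<noteq> 0" using F.frame by auto
    ultimately obtain r where "det3 e3 y r = 1" using det3_nonzeroI by blast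
    then have "vec.span {e3, y} \<in> proj_lines" using span2_proj_line(1)[of e3 y r] by simp
    then have inv: "invariant_line ?\<eta> (vec.span {e3, y})"
      unfolding invariant_line_def using lines[OF y3 C] by blast
    have "x = ?z *s e3 + 1 *s y" using xy by (simp add: add.commute)
    then have "x \<in> vec.span {e3, y}" unfolding mem_span2 by blast
    then have "s \<subseteq> vec.span {e3, y}" unfolding x(1) by (intro vec.span_minimal) auto
    then show False using straight_leafI[OF H.homogeneous_form inv] s(3) by blast
  qed
  have "singular_point ?\<eta> s \<and> camacho_sad ?\<eta> ?l s = camacho_sad \<omega> ?l s"
    if s: "s \<subseteq> ?l" "singular_point \<omega> s" for s
  proof
    have on: "det3 e1 e2 x = 0" if "x \<in> ?l" for x using that unfolding F.line(2) by simp
    show "singular_point ?\<eta> s" using s same on by (auto simp: singular_point_def)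
    show "camacho_sad ?\<eta> ?l s = camacho_sad \<omega> ?l s"
    proof (rule camacho_sad_cong[OF F.line(1) _ s(1) H.homogeneous_form F.homogeneous_form])
      show "s \<in> proj_points" using s by (simp add: singular_point_def)
      show "form_app ?\<eta> x v = form_app \<omega> x v" if "x \<in> ?l" for x v
        using same[OF on[OF that]] by (simp add: form_app_def)
      show "jac ?\<eta> x r q = jac \<omega> x r q" if "x \<in> ?l" "q \<in> ?l" for x q r
        unfolding H.jac_on_line[OF on[OF that(1)] on[OF that(2)]] F.jac_on_line[OF on[OF that(1)] on[OF that(2)]]
          F.proj_on_line[OF on[OF that(1)]] ..
    qed
  qed
  then show thesis using that hom conv by blast
qed

section \<open>Camacho-Sad indices along an invariant line\<close>

text \<open>The coefficient of degree \<open>n\<close> is the value at the direction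
  \<open>w\<close>, the point at infinity of the parametrized line; it may be 0.\<close>

lemma hpoly_line_poly:
  assumes "hpoly n f"
  shows "\<exists>P. degree P \<le> n \<and> coeff P n = f w \<and> (\<forall>t. f (x + t *s w) = poly P t)"
  using assms
proof (induction n f rule: hpoly.induct)
  case (hpoly_zero n)
  show ?case by (rule exI[of _ 0]) simp
next
  case (hpoly_const c)
  show ?case by (rule exI[of _ "[:c:]"]) simp
next
  case (hpoly_coord i)
  show ?case by (rule exI[of _ "[:x $ i, w $ i:]"]) simp
next
  case (hpoly_add n f g)
  then obtain P Q where "degree P \<le> n" "coeff P n = f w" "\<And>t. f (x + t *s w) = poly P t"
    "degree Q \<le> n" "coeff Q n = g w" "\<And>t. g (x + t *s w) = poly Q t" by blast
  then show ?case by (intro exI[of _ "P + Q"]) (auto intro: degree_add_le)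
next
  case (hpoly_mult m f n g)
  then obtain P Q where *: "degree P \<le> m" "coeff P m = f w" "\<And>t. f (x + t *s w) = poly P t"
    "degree Q \<le> n" "coeff Q n = g w" "\<And>t. g (x + t *s w) = poly Q t" by blast
  have "coeff (P * Q) (m + n) = coeff P m * coeff Q n"
  proof -
    have "coeff P i * coeff Q (m + n - i) = (if i = m then coeff P m * coeff Q n else 0)" if "i \<le> m + n" for i
      using *(1,4) that by (cases i m rule: linorder_cases) (auto simp: coeff_eq_0)
    then have "coeff (P * Q) (m + n) = (\<Sum>i\<le>m + n. if i = m then coeff P m * coeff Q n else 0)"
      unfolding coeff_mult by (intro sum.cong) auto
    then show ?thesis by simp
  qed
  then show ?case using * degree_mult_le[of P Q] by (intro exI[of _ "P * Q"]) auto
qed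

lemma simple_roots_card:
  fixes p :: "complex poly"
  assumes "p \<noteq> 0" "\<And>z. poly p z = 0 \<Longrightarrow> poly (pderiv p) z \<noteq> 0"
  shows "card {z. poly p z = 0} = degree p"
proof -
  have "rsquarefree p" using assms(2) by (auto simp: rsquarefree_roots)
  then have p: "smult (lead_coeff p) (\<Prod>z | poly p z = 0. [:-z, 1:]) = p"
    by (rule complex_poly_decompose_rsquarefree)
  have "degree p = degree (\<Prod>z | poly p z = 0. [:-z, 1:])"
    by (subst p[symmetric]) (use assms(1) in simp)
  also have "\<dots> = (\<Sum>z | poly p z = 0. degree [:-z, 1:])"
    by (rule degree_prod_eq_sum_degree) simp
  finally show ?thesis by simp
qed

text \<open>With \<open>q\<close> on \<open>l\<close> and \<open>r\<close> on \<open>l'\<close>,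
  each vector is transverse to the other line. Exchanging the lines exchanges numerator and
  denominator in \<open>camacho_sad_eq\<close>.\<close>

lemma CS_set_inverse:
  assumes hom: "homogeneous_form (Suc d) \<omega>" and d: "d > 0" and fin: "finite {s. singular_point \<omega> s}"
    and card: "card {l. invariant_line \<omega> l} = 3 * d"
    and \<mu>: "\<mu> \<in> CS_set \<omega>"
  shows "1 / \<mu> \<in> CS_set \<omega>"
proof -
  obtain l s where ls: "\<mu> \<noteq> 0" "\<mu> \<noteq> 1" "invariant_line \<omega> l" "s \<subseteq> l" "nondegenerate \<omega> s" "camacho_sad \<omega> l s = \<mu>"
    using \<mu> unfolding CS_set_def by blast
  have s: "singular_point \<omega> s" using ls(5) by (simp add: nondegenerate_def)
  obtain l' where l': "l' \<noteq> l" "invariant_line \<omega> l'" "s \<subseteq> l'"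
    using reduced_convex_singular_point(2)[OF hom d fin card s] by blast
  have pl: "l \<in> proj_lines" "l' \<in> proj_lines" using ls(3) l'(2) by (auto simp: invariant_line_def)
  obtain p where p: "p \<noteq> 0" "s = vec.span {p}" using s unfolding singular_point_def proj_points_iff by blast
  have ps: "p \<in> s" unfolding p(2) by (simp add: vec.span_base)
  have only: "x \<in> s" if "x \<in> l" "x \<in> l'" for x
  proof (rule ccontr)
    assume "x \<notin> s"
    then have "x \<notin> vec.span {p}" using p(2) by simp
    then have "l = vec.span {p, x}" "l' = vec.span {p, x}"
      using proj_line_frame[OF pl(1) _ p(1) that(1)] proj_line_frame[OF pl(2) _ p(1) that(2)] ps ls(4) l'(3)
      by (metis subsetD)+
    then show False using l'(1) by simp
  qed
  obtain q where q: "q \<in> l" "q \<notin> s" using proj_line_not_subset_point[OF pl(1)] p(2) by metis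
  obtain r where r: "r \<in> l'" "r \<notin> s" using proj_line_not_subset_point[OF pl(2)] p(2) by metis
  have rl: "r \<notin> l" and ql: "q \<notin> l'" using only q r by blast+
  note nz = nondegenerate_jac_nonzero[OF hom ls(3,5,4) ps p(1) q rl]
  have 1: "\<mu> = - jac \<omega> p r q / jac \<omega> p q r"
    using camacho_sad_eq[OF hom ls(3) s ls(4) ps p(1) q rl nz] ls(6) by simp
  have 2: "camacho_sad \<omega> l' s = - jac \<omega> p q r / jac \<omega> p r q"
    by (rule camacho_sad_eq[OF hom l'(2) s l'(3) ps p(1) r ql nz(2,1)])
  have "camacho_sad \<omega> l' s = 1 / \<mu>" unfolding 1 2 using nz by simp
  then show ?thesis unfolding CS_set_def using l' ls(1,2,5) by auto
qed

text \<open>With a nonsingular point of \<open>l\<close> at infinity, the singular points on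
  \<open>l\<close> are the roots of a polynomial \<open>c\<close> of degree \<open>d + 1\<close>,
  simple by non-degeneracy, and the index at a root is \<open>b\<close> divided by the derivative of
  \<open>c\<close>. If all indices were 1, the two polynomials would agree at \<open>d + 1\<close>
  points with degrees at most \<open>d\<close>, but their coefficients of degree \<open>d\<close>
  differ by the factor \<open>d + 1\<close>.\<close>

lemma CS_set_nonempty:
  assumes hom: "homogeneous_form (Suc d) \<omega>" and d: "d > 0" and fin: "finite {s. singular_point \<omega> s}"
    and card: "card {l. invariant_line \<omega> l} = 3 * d"
  shows "CS_set \<omega> \<noteq> {}"
proof
  assume empty: "CS_set \<omega> = {}"
  have "{l. invariant_line \<omega> l} \<noteq> {}" using card d by (metis card.empty mult_is_0 not_less0 zero_neq_numeral)
  then obtain l where l: "invariant_line \<omega> l" by auto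
  have pl: "l \<in> proj_lines" using l by (simp add: invariant_line_def)
  obtain f1 f2 f3 where f: "det3 f1 f2 f3 = 1" "l = {x. det3 f1 f2 x = 0}" by (rule proj_line_basis[OF pl])
  obtain e2 where e2: "e2 \<in> l" "\<omega> e2 \<noteq> 0"
  proof -
    have "\<exists>e2\<in>l. \<omega> e2 \<noteq> 0"
    proof (rule ccontr)
      assume H: "\<not> ?thesis"
      have "f1 + t *s f2 \<noteq> 0" for t
      proof
        assume "f1 + t *s f2 = 0"
        then have "det3 (f1 + t *s f2) f2 f3 = 0" by simp
        then show False using f(1) by (simp add: det3_simps)
      qed
      moreover have "\<omega> (f1 + t *s f2) = 0" for t using H unfolding f(2) by (simp add: det3_simps)
      ultimately have "range (\<lambda>t. vec.span {f1 + t *s f2}) \<subseteq> {s. singular_point \<omega> s}"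
        using singular_point_span[OF hom] by blast
      then have "finite (range (\<lambda>t. vec.span {f1 + t *s f2}))" using fin by (rule finite_subset)
      moreover have "inj (\<lambda>t. vec.span {f1 + t *s f2})"
      proof (rule injI)
        fix t u assume "vec.span {f1 + t *s f2} = vec.span {f1 + u *s f2}"
        then have "f1 + t *s f2 \<in> vec.span {f1 + u *s f2}" using vec.span_base by blast
        then obtain c where c: "f1 + t *s f2 = c *s (f1 + u *s f2)" by (auto simp: mem_span1)
        have "det3 (f1 + t *s f2) f2 f3 = 1" "det3 f1 (f1 + t *s f2) f3 = t"
          "det3 (c *s (f1 + u *s f2)) f2 f3 = c" "det3 f1 (c *s (f1 + u *s f2)) f3 = c * u"
          by (simp_all add: det3_simps f(1))
        then show "t = u" unfolding c by simp
      qed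
      ultimately have "finite (UNIV :: complex set)" by (rule finite_imageD)
      then show False using infinite_UNIV_char_0 by blast
    qed
    then show thesis using that by blast
  qed
  have e20: "e2 \<noteq> 0"
  proof
    assume "e2 = 0"
    then have "form_app \<omega> e2 v = 0" for v using form_app_scale_point[OF hom, of 0 0 v] by simp
    then show False using form_app_eq_0_imp[OF hom, of f1 f2 f3] f(1) e2(2) by simp
  qed
  obtain e1 where e1: "e1 \<in> l" "e1 \<notin> vec.span {e2}" using proj_line_not_subset_point[OF pl] .
  obtain r where r: "det3 e2 e1 r = 1" "l = {x. det3 e2 e1 x = 0}"
    by (rule proj_line_frame[OF pl e2(1) e20 e1])
  \<comment> \<open>The sign compensates the exchange of \<open>e1\<close> and \<open>e2\<close> in
    the frame.\<close>
  define e3 where "e3 = (- 1) *s r"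
  have e: "det3 e1 e2 e3 = 1" "l = {x. det3 e1 e2 x = 0}"
    unfolding det3_swap(1)[of e1 e2] e3_def det3_scale r(1) by (simp_all add: r(2))
  obtain A B where AB: "hpoly d A" "hpoly d B" and form:
    "\<And>x v. form_app \<omega> x v = det3 e1 e2 x * (A x * det3 v e2 e3 + B x * det3 e1 v e3)
        - (A x * det3 x e2 e3 + B x * det3 e1 x e3) * det3 e1 e2 v"
    by (rule homogeneous_form_line_components[OF hom l e(1) e1(1) e2(1) e(2)]) (rule that)
  interpret line_adapted_form d \<omega> e1 e2 e3 A B
    by unfold_locales (rule e(1) AB form)+
  obtain a where a: "degree a \<le> d" "\<And>t. A (e1 + t *s e2) = poly a t"
    using hpoly_line_poly[OF AB(1), of e2 e1] by blast
  obtain b where b: "degree b \<le> d" "coeff b d = B e2" "\<And>t. B (e1 + t *s e2) = poly b t"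
    using hpoly_line_poly[OF AB(2), of e2 e1] by blast
  \<comment> \<open>The tangent cone \<open>x A + y B\<close> at the point with coordinates
    \<open>1\<close> and \<open>t\<close>.\<close>
  define c where "c = a + pCons 0 b"
  have Be2: "B e2 \<noteq> 0"
  proof
    assume "B e2 = 0"
    then have "form_app \<omega> e2 v = 0" for v unfolding form by simp
    then show False using form_app_eq_0_imp[OF hom, of e1 e2 e3] e(1) e2(2) by simp
  qed
  have cd: "coeff c (Suc d) = B e2" using a(1) b(2) by (simp add: c_def coeff_eq_0)
  have "degree c \<le> Suc d" using a(1) b(1) degree_pCons_le[of 0 b] unfolding c_def
    by (intro degree_add_le) auto
  then have deg: "degree c = Suc d" using cd Be2 le_degree[of c "Suc d"] by simp
  have c0: "c \<noteq> 0" using deg by auto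
  have root: "poly (pderiv c) t = poly b t \<and> poly (pderiv c) t \<noteq> 0" if t: "poly c t = 0" for t
  proof -
    let ?p = "e1 + t *s e2" and ?s = "vec.span {e1 + t *s e2}"
    have pc: "det3 ?p e2 e3 = 1" "det3 e1 ?p e3 = t" "det3 e1 e2 ?p = 0" by (simp_all add: det3_simps e(1))
    have p0: "?p \<noteq> 0" using pc(1) by auto
    have "A ?p + B ?p * t = 0" using t unfolding a(2) b(3) c_def by (simp add: algebra_simps)
    then have "form_app \<omega> ?p v = 0" for v unfolding form pc by simp
    then have "\<omega> ?p = 0" using form_app_eq_0_imp[OF hom, of e1 e2 e3] e(1) by simp
    then have s: "singular_point \<omega> ?s" by (rule singular_point_span[OF hom p0])
    have nd: "nondegenerate \<omega> ?s" by (rule reduced_convex_singular_point(1)[OF hom d fin card s])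
    have ps: "?p \<in> ?s" by (simp add: vec.span_base)
    have sl: "?s \<subseteq> l" unfolding e(2) by (auto simp: mem_span1 det3_simps)
    have q: "e2 \<notin> ?s"
    proof
      assume "e2 \<in> ?s"
      then obtain k where k: "e2 = k *s ?p" unfolding mem_span1 by blast
      have "det3 (k *s ?p) e2 e3 = k" unfolding det3_scale pc by simp
      then have "k = 0" unfolding k[symmetric] by simp
      then show False using k e20 by simp
    qed
    have e3l: "e3 \<notin> l" unfolding e(2) using e(1) by simp
    note nz = nondegenerate_jac_nonzero[OF hom l nd sl ps p0 e2(1) q e3l]
    have j1: "jac \<omega> ?p e3 e2 = poly b t"
      using jac_on_line[of ?p e2 e3] pc(3) by (simp add: e(1) b(3))
    have j2: "jac \<omega> ?p e2 e3 = - poly (pderiv c) t"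
    proof -
      have "form_app \<omega> (?p + u *s e2) e3 = - poly c (t + u)" for u
      proof -
        have pe: "?p + u *s e2 = e1 + (t + u) *s e2" by (simp add: vector_sadd_rdistrib)
        show ?thesis unfolding pe form a(2) b(3) c_def by (simp add: det3_simps e(1) algebra_simps)
      qed
      moreover have "((\<lambda>u. - poly c (t + u)) has_field_derivative - poly (pderiv c) t) (at 0)"
        by (auto intro!: derivative_eq_intros)
      ultimately show ?thesis unfolding jac_def by (intro dir_deriv_eqI) simp
    qed
    have CS: "camacho_sad \<omega> l ?s = poly b t / poly (pderiv c) t"
      using camacho_sad_eq[OF hom l s sl ps p0 e2(1) q e3l nz] unfolding j1 j2 by simp
    \<comment> \<open>The value 0 is ruled out by \<open>nz\<close>, which leaves 1.\<close>
    moreover have "camacho_sad \<omega> l ?s = 0 \<or> camacho_sad \<omega> l ?s = 1"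
      using empty l sl nd unfolding CS_set_def by blast
    ultimately show ?thesis using nz unfolding j1 j2 by auto
  qed
  have "b - pderiv c = 0"
  proof (rule ccontr)
    assume nz: "b - pderiv c \<noteq> 0"
    have "{z. poly c z = 0} \<subseteq> {z. poly (b - pderiv c) z = 0}" using root by auto
    then have "card {z. poly c z = 0} \<le> card {z. poly (b - pderiv c) z = 0}"
      by (rule card_mono[OF poly_roots_finite[OF nz]])
    also have "\<dots> \<le> degree (b - pderiv c)" by (rule card_poly_roots_bound[OF nz])
    also have "\<dots> \<le> d" using b(1) degree_pderiv[of c] deg by (intro degree_diff_le) auto
    also have "card {z. poly c z = 0} = Suc d"
      using simple_roots_card[of c] c0 root deg by metis
    finally show False by simp
  qed
  then have "coeff b d = coeff (pderiv c) d" by simp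
  then have "B e2 = of_nat (Suc d) * B e2" unfolding b(2) coeff_pderiv cd .
  then show False using Be2 d by (simp add: algebra_simps)
qed

lemma CS_set_degeneration:
  assumes hom: "homogeneous_form (Suc d) \<omega>" and d: "d > 0" and fin: "finite {s. singular_point \<omega> s}"
    and card: "card {l. invariant_line \<omega> l} = 3 * d"
    and \<mu>: "\<mu> \<in> CS_set \<omega>"
  shows "\<exists>\<eta> l s. homogeneous_foliation d l \<eta> \<and> convex_foliation \<eta> \<and> singular_point \<eta> s \<and> s \<subseteq> l \<and> camacho_sad \<eta> l s = \<mu>"
proof -
  obtain l s where ls: "invariant_line \<omega> l" "s \<subseteq> l" "nondegenerate \<omega> s" "camacho_sad \<omega> l s = \<mu>"
    using \<mu> unfolding CS_set_def by blast
  have s: "singular_point \<omega> s" using ls(3) by (simp add: nondegenerate_def)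
  obtain e1 e2 e3 A B where L: "line_adapted_form d \<omega> e1 e2 e3 A B" and e: "l = vec.span {e1, e2}"
    by (rule invariant_line_adapted[OF hom ls(1)])
  from L obtain \<eta> where \<eta>: "homogeneous_foliation d l \<eta>" "convex_foliation \<eta>"
    "\<And>s. s \<subseteq> l \<Longrightarrow> singular_point \<omega> s \<Longrightarrow> singular_point \<eta> s \<and> camacho_sad \<eta> l s = camacho_sad \<omega> l s"
    using reduced_convex_degeneration[OF _ d fin card] unfolding e by metis
  then show ?thesis using s ls(2,4) by metis
qed

theorem propositionC:
  fixes \<omega> :: one_form and d :: nat
  assumes "d \<ge> 2" and "reduced_convex d \<omega>"
  shows "(CS_set \<omega> \<noteq> {} \<and> CS_set \<omega> \<subseteq> HCS d) \<and> (\<forall>\<mu>\<in>CS_set \<omega>. 1 / \<mu> \<in> CS_set \<omega>)"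
proof -
  have d: "d > 0" using assms(1) by simp
  obtain m where m: "homogeneous_form m \<omega>" and fin: "finite {s. singular_point \<omega> s}"
    and deg: "foliation_degree \<omega> d" and card: "card {l. invariant_line \<omega> l} = 3 * d"
    using assms(2) unfolding reduced_convex_def foliation_iff by blast
  have hom: "homogeneous_form (Suc d) \<omega>" using m foliation_degree_iff[OF m fin] deg by simp
  have inv: "1 / \<mu> \<in> CS_set \<omega>" if "\<mu> \<in> CS_set \<omega>" for \<mu>
    by (rule CS_set_inverse[OF hom d fin card that])
  \<comment> \<open>Both \<open>\<mu>\<close> and its inverse are indices of
    \<open>\<omega>\<close>, so two degenerations, possibly along different lines, provide the
    required pair.\<close>
  have "\<mu> \<in> HCS d" if \<mu>: "\<mu> \<in> CS_set \<omega>" for \<mu>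
  proof -
    have "\<mu> \<noteq> 0" "\<mu> \<noteq> 1" using \<mu> by (auto simp: CS_set_def)
    then show ?thesis
      unfolding HCS_def
      using CS_set_degeneration[OF hom d fin card \<mu>] CS_set_degeneration[OF hom d fin card inv[OF \<mu>]]
      by blast
  qed
  then show ?thesis using inv CS_set_nonempty[OF hom d fin card] by blast
qed

end
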